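(* Let $\Phi$ satisfy the structural assumption below, let $\omega\in A_\Phi$, and let $f\in L^{\Phi^*}(\omega,\Omega)$. Let $u\in W^{1,\Phi}_0(\omega,\Omega)$ satisfy $\int_\Omega\omega\,\mathbf A(\nabla u)\cdot\nabla v\,dx=\int_\Omega\omega fv\,dx$ for all $v\in W^{1,\Phi}_0(\omega,\Omega)$, and let $u_h\in\mathbb V_h$ satisfy $\int_\Omega\omega\,\mathbf A(\nabla u_h)\cdot\nabla v_h\,dx=\int_\Omega\omega fv_h\,dx$ for all $v_h\in\mathbb V_h$. Then $$\|\mathbf V(\nabla u)-\mathbf V(\nabla u_h)\|_{L^2(\omega,\Omega)}\lesssim\inf_{v_h\in\mathbb V_h}\|\mathbf V(\nabla u)-\mathbf V(\nabla v_h)\|_{L^2(\omega,\Omega)},$$ with a constant independent of $h$.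
   Context: $\Omega\subset\mathbb{R}^d$ ($d\ge2$) is a bounded Lipschitz polytope. An $N$-function is $\Phi(t)=\int_0^t\Phi'(s)ds$ with $\Phi'$ right-continuous, nondecreasing, $\Phi'(0)=0$, $\Phi'>0$ on $(0,\infty)$, $\Phi'(s)\to\infty$; $\Phi^*(t)=\int_0^t(\Phi')^{-1}$ with $(\Phi')^{-1}(t)=\sup\{s:\Phi'(s)\le t\}$. Structural assumption: $\Phi$ is an $N$-function with $\Phi\in C^1([0,\infty))\cap C^2((0,\infty))$ and $\Phi'(t)\simeq t\Phi''(t)$ uniformly in $t>0$ (the constants are the "characteristics" of $\Phi$). Define $\Psi$ by $\Psi(0)=0$, $\Psi'(t)=\sqrt{t\Phi'(t)}$, and $\mathbf A(\zeta)=\Phi'(|\zeta|)\zeta/|\zeta|$, $\mathbf V(\zeta)=\Psi'(|\zeta|)\zeta/|\zeta|$ for $\zeta\in\mathbb{R}^d$. A weight is $\omega\in L^1_{loc}(\mathbb R^d)$, $\omega>0$ a.e.; $\omega\in A_\Phi$ means there is $C$ such that for all $\delta>0$ and balls $B$: $\big(\frac1{|B|}\int_B\delta\omega\big)\Phi'\big(\frac1{|B|}\int_B(\Phi')^{-1}(1/(\delta\omega))\big)\le C$. $L^\Phi(\omega,\Omega)$ is the weighted Orlicz space ($v$ measurable with $\int_\Omega\omega\Phi(k|v|)<\infty$ for some $k>0$, Luxemburg norm); $L^2(\omega,\Omega)$ has norm $(\int_\Omega\omega|v|^2)^{1/2}$; $W^{1,\Phi}_0(\omega,\Omega)$ is the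 closure of $C_0^\infty(\Omega)$ functions in $\{v\in L^\Phi(\omega,\Omega):\nabla v\in L^\Phi(\omega,\Omega)\}$. $\mathscr T_h$ is a conforming mesh of $\bar\Omega$ into simplices, from a shape-regular family; $\mathbb V_h=\{v_h\in W^{1,\infty}_0(\Omega):v_h|_T\in\mathbb P_1(T)\ \forall T\in\mathscr T_h\}$. *)

theory Defs
  imports "HOL-Analysis.Analysis"
begin

coinductive cinf :: "('a::euclidean_space \<Rightarrow> real) \<Rightarrow> bool" where
  "(\<forall>x. f differentiable (at x)) \<Longrightarrow>
   (\<forall>i\<in>Basis. cinf (\<lambda>x. frechet_derivative f (at x) i)) \<Longrightarrow> cinf f"

definition test_fun :: "'a::euclidean_space set \<Rightarrow> ('a \<Rightarrow> real) \<Rightarrow> bool" where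
  "test_fun \<Omega> \<phi> \<longleftrightarrow> cinf \<phi> \<and> compact (closure {x. \<phi> x \<noteq> 0})
      \<and> closure {x. \<phi> x \<noteq> 0} \<subseteq> \<Omega>"

definition cgrad :: "('a::euclidean_space \<Rightarrow> real) \<Rightarrow> 'a \<Rightarrow> 'a" where
  "cgrad \<phi> x = (\<Sum>i\<in>Basis. frechet_derivative \<phi> (at x) i *\<^sub>R i)"

definition has_weak_grad :: "'a::euclidean_space set \<Rightarrow> ('a \<Rightarrow> real) \<Rightarrow> ('a \<Rightarrow> 'a) \<Rightarrow> bool" where
  "has_weak_grad \<Omega> v g \<longleftrightarrow>
     (\<forall>K. compact K \<and> K \<subseteq> \<Omega> \<longrightarrow> set_integrable lebesgue K v \<and> set_integrable lebesgue K g) \<and>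
     (\<forall>\<phi>. test_fun \<Omega> \<phi> \<longrightarrow> (\<forall>i\<in>Basis.
        (LINT x:\<Omega>|lebesgue. v x * frechet_derivative \<phi> (at x) i)
          = - (LINT x:\<Omega>|lebesgue. (g x \<bullet> i) * \<phi> x)))"

text \<open>The (a.e. unique) weak gradient; any representative gives the same integrals.\<close>
definition wgrad :: "'a::euclidean_space set \<Rightarrow> ('a \<Rightarrow> real) \<Rightarrow> 'a \<Rightarrow> 'a" where
  "wgrad \<Omega> v = (SOME g. has_weak_grad \<Omega> v g)"

text \<open>\<open>N_function \<Phi> \<phi>\<close>: \<open>\<Phi>\<close> is an N-function with right derivative \<open>\<phi> = \<Phi>'\<close>.\<close>
definition N_function :: "(real \<Rightarrow> real) \<Rightarrow> (real \<Rightarrow> real) \<Rightarrow> bool" where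
  "N_function \<Phi> \<phi> \<longleftrightarrow>
     (\<forall>t\<ge>0. \<phi> integrable_on {0..t} \<and> \<Phi> t = integral {0..t} \<phi>) \<and>
     (\<forall>s\<ge>0. continuous (at_right s) \<phi>) \<and> mono_on {0..} \<phi> \<and> \<phi> 0 = 0 \<and>
     (\<forall>s>0. \<phi> s > 0) \<and> filterlim \<phi> at_top at_top"

definition phi_inv :: "(real \<Rightarrow> real) \<Rightarrow> real \<Rightarrow> real" where
  "phi_inv \<phi> t = Sup {s. s \<ge> 0 \<and> \<phi> s \<le> t}"

definition conj_N :: "(real \<Rightarrow> real) \<Rightarrow> real \<Rightarrow> real" where
  "conj_N \<phi> t = integral {0..t} (phi_inv \<phi>)"

definition structural :: "(real \<Rightarrow> real) \<Rightarrow> (real \<Rightarrow> real) \<Rightarrow> bool" where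
  "structural \<Phi> \<phi> \<longleftrightarrow> N_function \<Phi> \<phi> \<and>
     (\<forall>t\<ge>0. (\<Phi> has_real_derivative \<phi> t) (at t within {0..})) \<and> continuous_on {0..} \<phi> \<and>
     (\<exists>\<phi>2. (\<forall>t>0. (\<phi> has_real_derivative \<phi>2 t) (at t)) \<and> continuous_on {0<..} \<phi>2 \<and>
        (\<exists>c1 c2. c1 > 0 \<and> c2 > 0 \<and>
           (\<forall>t>0. c1 * (t * \<phi>2 t) \<le> \<phi> t \<and> \<phi> t \<le> c2 * (t * \<phi>2 t))))"

definition Aop :: "(real \<Rightarrow> real) \<Rightarrow> 'a::real_normed_vector \<Rightarrow> 'a" where
  "Aop \<phi> z = (\<phi> (norm z) / norm z) *\<^sub>R z"

text \<open>\<open>\<Psi>'(t) = sqrt (t \<Phi>'(t))\<close>, \<open>V(\<zeta>) = \<Psi>'(|\<zeta>|) \<zeta>/|\<zeta>|\<close>\<close>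
definition Vop :: "(real \<Rightarrow> real) \<Rightarrow> 'a::real_normed_vector \<Rightarrow> 'a" where
  "Vop \<phi> z = (sqrt (norm z * \<phi> (norm z)) / norm z) *\<^sub>R z"

definition weight :: "('a::euclidean_space \<Rightarrow> real) \<Rightarrow> bool" where
  "weight \<omega> \<longleftrightarrow> (\<forall>K. compact K \<longrightarrow> set_integrable lebesgue K \<omega>) \<and> (AE x in lebesgue. \<omega> x > 0)"

definition avg :: "'a::euclidean_space set \<Rightarrow> ('a \<Rightarrow> real) \<Rightarrow> real" where
  "avg B g = (LINT y:B|lebesgue. g y) / measure lebesgue B"

definition A_Phi :: "(real \<Rightarrow> real) \<Rightarrow> ('a::euclidean_space \<Rightarrow> real) \<Rightarrow> bool" where
  "A_Phi \<phi> \<omega> \<longleftrightarrow> weight \<omega> \<and> (\<exists>C. \<forall>\<delta>>0. \<forall>x r. r > 0 \<longrightarrow>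
      set_integrable lebesgue (ball x r) (\<lambda>y. phi_inv \<phi> (1 / (\<delta> * \<omega> y))) \<and>
      avg (ball x r) (\<lambda>y. \<delta> * \<omega> y) * \<phi> (avg (ball x r) (\<lambda>y. phi_inv \<phi> (1 / (\<delta> * \<omega> y)))) \<le> C)"

definition orlicz :: "(real \<Rightarrow> real) \<Rightarrow> ('a::euclidean_space \<Rightarrow> real) \<Rightarrow> 'a set
    \<Rightarrow> ('a \<Rightarrow> 'b::real_normed_vector) set" where
  "orlicz \<Phi> \<omega> \<Omega> = {v. v \<in> borel_measurable (lebesgue_on \<Omega>) \<and>
     (\<exists>k>0. integrable (lebesgue_on \<Omega>) (\<lambda>x. \<omega> x * \<Phi> (k * norm (v x))))}"

definition lux :: "(real \<Rightarrow> real) \<Rightarrow> ('a::euclidean_space \<Rightarrow> real) \<Rightarrow> 'a set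
    \<Rightarrow> ('a \<Rightarrow> 'b::real_normed_vector) \<Rightarrow> real" where
  "lux \<Phi> \<omega> \<Omega> v = Inf {l. l > 0 \<and>
     integrable (lebesgue_on \<Omega>) (\<lambda>x. \<omega> x * \<Phi> (norm (v x) / l)) \<and>
     (LINT x|lebesgue_on \<Omega>. \<omega> x * \<Phi> (norm (v x) / l)) \<le> 1}"

definition W0 :: "(real \<Rightarrow> real) \<Rightarrow> ('a::euclidean_space \<Rightarrow> real) \<Rightarrow> 'a set \<Rightarrow> ('a \<Rightarrow> real) set" where
  "W0 \<Phi> \<omega> \<Omega> = {v. v \<in> orlicz \<Phi> \<omega> \<Omega> \<and>
     (\<exists>g. has_weak_grad \<Omega> v g \<and> g \<in> orlicz \<Phi> \<omega> \<Omega> \<and>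
        (\<exists>\<psi>::nat \<Rightarrow> 'a \<Rightarrow> real. (\<forall>k. test_fun \<Omega> (\<psi> k)) \<and>
           (\<lambda>k. lux \<Phi> \<omega> \<Omega> (\<lambda>x. v x - \<psi> k x) + lux \<Phi> \<omega> \<Omega> (\<lambda>x. g x - cgrad (\<psi> k) x))
             \<longlonglongrightarrow> 0))}"

definition L2w :: "('a::euclidean_space \<Rightarrow> real) \<Rightarrow> 'a set \<Rightarrow> ('a \<Rightarrow> 'a) \<Rightarrow> real" where
  "L2w \<omega> \<Omega> v = sqrt (LINT x|lebesgue_on \<Omega>. \<omega> x * (norm (v x))\<^sup>2)"

definition lipschitz_domain :: "'a::euclidean_space set \<Rightarrow> bool" where
  "lipschitz_domain \<Omega> \<longleftrightarrow> open \<Omega> \<and> bounded \<Omega> \<and> \<Omega> \<noteq> {} \<and>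
     (\<forall>p\<in>frontier \<Omega>. \<exists>e r L \<gamma>. norm e = 1 \<and> r > 0 \<and> L-lipschitz_on UNIV \<gamma> \<and>
        (\<forall>x. \<gamma> x = \<gamma> (x - (x \<bullet> e) *\<^sub>R e)) \<and>
        \<Omega> \<inter> ball p r = {x \<in> ball p r. x \<bullet> e > \<gamma> x})"

definition lipschitz_polytope :: "'a::euclidean_space set \<Rightarrow> bool" where
  "lipschitz_polytope \<Omega> \<longleftrightarrow> lipschitz_domain \<Omega> \<and>
     (\<exists>P. finite P \<and> (\<forall>K\<in>P. polytope K) \<and> closure \<Omega> = \<Union>P)"

definition conforming_mesh :: "'a::euclidean_space set \<Rightarrow> 'a set set \<Rightarrow> bool" where
  "conforming_mesh \<Omega> T \<longleftrightarrow> finite T \<and> (\<forall>K\<in>T. int DIM('a) simplex K) \<and>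
     \<Union>T = closure \<Omega> \<and> (\<forall>K\<in>T. \<forall>K'\<in>T. (K \<inter> K') face_of K \<and> (K \<inter> K') face_of K')"

definition inradius :: "'a::euclidean_space set \<Rightarrow> real" where
  "inradius K = Sup {r. r \<ge> 0 \<and> (\<exists>x. cball x r \<subseteq> K)}"

definition shape_regular_family :: "'a::euclidean_space set \<Rightarrow> 'a set set set \<Rightarrow> bool" where
  "shape_regular_family \<Omega> \<T> \<longleftrightarrow> (\<forall>T\<in>\<T>. conforming_mesh \<Omega> T) \<and>
     (\<exists>\<sigma>. \<forall>T\<in>\<T>. \<forall>K\<in>T. diameter K \<le> \<sigma> * inradius K)"

definition Vh :: "'a::euclidean_space set \<Rightarrow> 'a set set \<Rightarrow> ('a \<Rightarrow> real) set" where
  "Vh \<Omega> T = {v. continuous_on UNIV v \<and> (\<forall>x. x \<notin> \<Omega> \<longrightarrow> v x = 0) \<and>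
     (\<forall>K\<in>T. \<exists>a b. \<forall>x\<in>K. v x = a \<bullet> x + b)}"

end

(* With a(P,Q) = phi(m)/m for m = max(|P|,|Q|), the structural assumption gives
     (A(P) - A(Q)).(P - Q) ~ a(P,Q) |P - Q|^2 ~ |V(P) - V(Q)|^2   and   |A(P) - A(Q)| <= C a(P,Q) |P - Q|,
   and, distinguishing whether |P - R| is small compared to |P - Q|,
     (A(P) - A(Q)).(P - R) <= eps |V(P) - V(Q)|^2 + C_eps |V(P) - V(R)|^2.
   Integrating with P, Q, R the gradients of u, u_h, v_h and using Galerkin orthogonality to replace
   P - Q by P - R yields the claim. Orthogonality needs V_h to be contained in the closure of the test
   functions: a piecewise affine v is shrunk to compact support by soft thresholding and then mollified;
   away from a null set the gradients of these approximations eventually equal that of v, so local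
   integrability of the weight and dominated convergence suffice and no maximal function is needed. *)

theory Submission
  imports Defs
begin

subsection \<open>Pointwise estimates for the radial maps\<close>

text \<open>Why V: |V(P)|^2 = |P| \<phi>(|P|) is the energy density, so the error is measured in the
  quantity that Orlicz membership of the gradients controls, and every integral that gets split is
  finite. Why thresholding: the support of a finite element function reaches the boundary, so
  mollifying it directly would leave \<Omega>, whereas {|v| \<ge> e} is compact in \<Omega>. The
  gradient is altered only on {0 < |v| \<le> e}, and these sets shrink to the empty set as e tends
  to 0. A further obstacle is that \<open>wgrad\<close> is an arbitrary choice among weak gradients,
  so not even its linearity comes for free. It is tied to the classical gradient of a piecewise
  affine function by two facts: weak gradients agree almost everywhere (the fundamental lemma,
  proved with smooth cutoffs), and the classical gradient of a Lipschitz function that is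
  differentiable almost everywhere and vanishes off \<Omega> is a weak gradient (proved with
  difference quotients). The final constant is \<open>sqrt K\<close>, with K built from the two
  characteristics of \<Phi> alone.\<close>

lemma structural_basic:
  assumes "structural \<Phi> \<phi>"
  shows "\<phi> 0 = 0" "\<And>s. s > 0 \<Longrightarrow> \<phi> s > 0" "\<And>s t. 0 \<le> s \<Longrightarrow> s \<le> t \<Longrightarrow> \<phi> s \<le> \<phi> t"
    "continuous_on {0..} \<phi>" "\<And>s. s \<ge> 0 \<Longrightarrow> \<phi> s \<ge> 0"
proof -
  show 0: "\<phi> 0 = 0" using assms by (simp add: structural_def N_function_def)
  show 1: "\<phi> s > 0" if "s > 0" for s
    using assms that by (auto simp: structural_def N_function_def)
  show "continuous_on {0..} \<phi>" using assms by (simp add: structural_def)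
  show "\<phi> s \<le> \<phi> t" if "0 \<le> s" "s \<le> t" for s t
    using assms that by (auto simp: structural_def N_function_def intro: mono_onD[of "{0..}" \<phi>])
  show "\<phi> s \<ge> 0" if "s \<ge> 0" for s using 0 1[of s] that by (cases "s = 0") auto
qed

text \<open>The lower characteristic bounds the logarithmic derivative of \<phi> at x by 1 / (c1 x),
  so ln \<phi>(x) - (1/c1) ln x is nonincreasing. This gives power growth with exponent q = 1/c1,
  and in particular doubling.\<close>

lemma structural_scaling:
  assumes S: "structural \<Phi> \<phi>"
  obtains q where "q > 0" "\<And>l t. l \<ge> 1 \<Longrightarrow> t \<ge> 0 \<Longrightarrow> \<phi> (l * t) \<le> l powr q * \<phi> t"
proof -
  obtain \<phi>2 c1 where d: "\<And>t. t > 0 \<Longrightarrow> (\<phi> has_real_derivative \<phi>2 t) (at t)"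
    and c: "c1 > 0" "\<And>t. t > 0 \<Longrightarrow> c1 * (t * \<phi>2 t) \<le> \<phi> t"
    using S unfolding structural_def by metis
  note pos = structural_basic(2)[OF S]
  have "\<phi> (l * t) \<le> l powr (1 / c1) * \<phi> t" if l: "l \<ge> 1" and t: "t \<ge> 0" for l t
  proof (cases "t = 0")
    case True
    then show ?thesis using structural_basic(1)[OF S] by simp
  next
    case False
    then have t: "t > 0" using t by simp
    define g where "g = (\<lambda>x. ln (\<phi> x) - 1 / c1 * ln x)"
    have "g (l * t) \<le> g t"
    proof (rule DERIV_nonpos_imp_nonincreasing[of t "l * t" g])
      show "t \<le> l * t" using l t by simp
      fix x assume x: "t \<le> x" "x \<le> l * t"
      then have x0: "x > 0" using t by simp
      have "(g has_real_derivative (\<phi>2 x / \<phi> x - 1 / c1 * (1 / x))) (at x)"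
        unfolding g_def using x0 pos[OF x0] c(1)
        by (auto intro!: derivative_eq_intros d[OF x0] simp: field_simps)
      moreover have "\<phi>2 x / \<phi> x - 1 / c1 * (1 / x) \<le> 0"
        using c(2)[OF x0] x0 pos[OF x0] c(1) by (simp add: divide_simps mult_ac)
      ultimately show "\<exists>y. (g has_real_derivative y) (at x) \<and> y \<le> 0" by blast
    qed
    then have "ln (\<phi> (l * t)) \<le> ln (\<phi> t) + 1 / c1 * ln l"
      using l t by (simp add: g_def ln_mult add_divide_distrib algebra_simps)
    also have "\<dots> = ln (l powr (1 / c1) * \<phi> t)"
      using l pos[OF t] by (simp add: ln_mult ln_powr)
    finally show ?thesis
      using l t pos[of "l * t"] pos[OF t] by (subst (asm) ln_le_cancel_iff) auto
  qed
  with c show ?thesis by (intro that[of "1 / c1"]) auto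
qed

text \<open>By the mean value theorem a difference quotient of \<phi> equals
  \<open>\<phi>2 z\<close>, which is comparable to \<phi>(z)/z. That in turn compares with
  \<phi>(s)/s only if z is comparable to s, which holds when t \<ge> s/2. For smaller t the length s
  - t is itself comparable to s and monotonicity of \<phi> is enough.\<close>

lemma structural_growth:
  assumes S: "structural \<Phi> \<phi>"
  obtains k K where "k > 0" "K > 0"
    "\<And>s t. 0 \<le> t \<Longrightarrow> t \<le> s \<Longrightarrow> k * (\<phi> s / s) * (s - t) \<le> \<phi> s - \<phi> t"
    "\<And>s t. 0 \<le> t \<Longrightarrow> t \<le> s \<Longrightarrow> \<phi> s - \<phi> t \<le> K * (\<phi> s / s) * (s - t)"
proof -
  obtain \<phi>2 c1 c2 where d: "\<And>t. t > 0 \<Longrightarrow> (\<phi> has_real_derivative \<phi>2 t) (at t)"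
    and c: "c1 > 0" "c2 > 0" "\<And>t. t > 0 \<Longrightarrow> c1 * (t * \<phi>2 t) \<le> \<phi> t"
      "\<And>t. t > 0 \<Longrightarrow> \<phi> t \<le> c2 * (t * \<phi>2 t)"
    using S unfolding structural_def by metis
  obtain q where q: "q > 0" "\<And>l t. l \<ge> 1 \<Longrightarrow> t \<ge> 0 \<Longrightarrow> \<phi> (l * t) \<le> l powr q * \<phi> t"
    using structural_scaling[OF S] by blast
  \<comment> \<open>The doubling constant: \<phi>(s) \<le> D \<phi>(s/2).\<close>
  define D where "D = 2 powr q"
  have D: "D > 0" by (simp add: D_def)
  note pos = structural_basic(2)[OF S] and mono = structural_basic(3)[OF S]
  have mvt: "\<exists>z. t < z \<and> z < s \<and> \<phi> s - \<phi> t = (s - t) * \<phi>2 z" if "0 < t" "t < s" for s t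
    using MVT2[OF that(2), of \<phi> \<phi>2] d that by force
  have lo_half: "1 / (c2 * D) * (\<phi> s / s) * (s - t) \<le> \<phi> s - \<phi> t" if st: "s / 2 \<le> t" "t < s" "0 < s" for s t
  proof -
    obtain z where z: "t < z" "z < s" "\<phi> s - \<phi> t = (s - t) * \<phi>2 z" using mvt[of t s] st by auto
    have z0: "z > 0" using z st by linarith
    have "\<phi> s \<le> D * \<phi> (s / 2)" using q(2)[of 2 "s / 2"] st by (simp add: D_def)
    also have "\<dots> \<le> D * \<phi> z" using mono[of "s / 2" z] z st D by simp
    finally have "\<phi> s / s \<le> D * \<phi> z / s" using st by (simp add: divide_right_mono)
    also have "\<dots> \<le> D * \<phi> z / z" using z z0 st D pos[OF z0] by (intro divide_left_mono) auto
    also have "\<dots> \<le> D * c2 * \<phi>2 z" using c(4)[OF z0] z0 D by (simp add: field_simps)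
    finally have "\<phi> s / s / (c2 * D) \<le> \<phi>2 z"
      using c D by (subst pos_divide_le_eq) (simp_all add: mult_ac)
    then have "\<phi> s / s / (c2 * D) * (s - t) \<le> \<phi>2 z * (s - t)" using st by (intro mult_right_mono) auto
    then show ?thesis using z(3) by (simp add: mult_ac)
  qed
  \<comment> \<open>The extra factor 2 pays for t < s/2, where s - t may be as large as s while only
    the increment over [s/2, s] is used.\<close>
  have lo: "1 / (2 * c2 * D) * (\<phi> s / s) * (s - t) \<le> \<phi> s - \<phi> t" if st: "0 \<le> t" "t < s" for s t
  proof (cases "s / 2 \<le> t")
    case True
    have "1 / (2 * c2 * D) * (\<phi> s / s) * (s - t) \<le> 1 / (c2 * D) * (\<phi> s / s) * (s - t)"
      using st c D pos[of s] by (intro mult_right_mono frac_le) auto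
    then show ?thesis using lo_half[OF True] st by linarith
  next
    case False
    have "1 / (2 * c2 * D) * (\<phi> s / s) * (s - t) \<le> 1 / (2 * c2 * D) * (\<phi> s / s) * s"
      using st c D pos[of s] by (intro mult_left_mono) auto
    also have "\<dots> = 1 / (c2 * D) * (\<phi> s / s) * (s - s / 2)" using st by simp
    also have "\<dots> \<le> \<phi> s - \<phi> (s / 2)" using lo_half[of s "s / 2"] st by auto
    also have "\<dots> \<le> \<phi> s - \<phi> t" using mono[of t "s / 2"] st False by simp
    finally show ?thesis .
  qed
  \<comment> \<open>The summand 2/c1 serves t \<ge> s/2, where 1/z \<le> 2/s; the summand 2 serves t
    < s/2, where s \<le> 2 (s - t).\<close>
  have up: "\<phi> s - \<phi> t \<le> (2 / c1 + 2) * (\<phi> s / s) * (s - t)" if st: "0 \<le> t" "t < s" for s t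
  proof -
    have s: "s > 0" "\<phi> s > 0" using st pos[of s] by auto
    show ?thesis
    proof (cases "s / 2 \<le> t")
      case True
      then obtain z where z: "t < z" "z < s" "\<phi> s - \<phi> t = (s - t) * \<phi>2 z" using mvt[of t s] st by auto
      have z0: "z > 0" using z st by linarith
      have "\<phi>2 z \<le> \<phi> z / (c1 * z)"
        using c(3)[OF z0] c(1) z0 by (subst pos_le_divide_eq) (simp_all add: mult_ac)
      also have "\<dots> \<le> \<phi> s / (c1 * (s / 2))"
        using mono[of z s] z z0 c s True by (intro frac_le mult_left_mono) auto
      also have "\<dots> = 2 / c1 * (\<phi> s / s)" by simp
      also have "\<dots> \<le> (2 / c1 + 2) * (\<phi> s / s)" using s by (intro mult_right_mono) auto
      finally have "\<phi>2 z * (s - t) \<le> (2 / c1 + 2) * (\<phi> s / s) * (s - t)"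
        using st by (intro mult_right_mono) auto
      then show ?thesis using z(3) by (simp add: mult.commute)
    next
      case False
      have "\<phi> s - \<phi> t \<le> \<phi> s" using structural_basic(5)[OF S] st by simp
      also have "\<dots> = 2 * (\<phi> s / s) * (s / 2)" using s by simp
      also have "\<dots> \<le> (2 / c1 + 2) * (\<phi> s / s) * (s - t)"
        using False s c by (intro mult_mono) auto
      finally show ?thesis .
    qed
  qed
  show ?thesis
  proof
    show "1 / (2 * c2 * D) > 0" "2 / c1 + 2 > 0" using c D by (auto simp: add_pos_pos)
    show "1 / (2 * c2 * D) * (\<phi> s / s) * (s - t) \<le> \<phi> s - \<phi> t"
      "\<phi> s - \<phi> t \<le> (2 / c1 + 2) * (\<phi> s / s) * (s - t)" if "0 \<le> t" "t \<le> s" for s t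
      using lo[of t s] up[of t s] that by (cases "t = s"; simp)+
  qed
qed

text \<open>The common form of \<open>Aop\<close>, with profile \<phi>, and \<open>Vop\<close>, with
  profile sqrt(t \<phi>(t)), so that each vector comparison is proved once for a general
  profile.\<close>

definition radial :: "(real \<Rightarrow> real) \<Rightarrow> 'a::real_normed_vector \<Rightarrow> 'a" where
  "radial f z = (f (norm z) / norm z) *\<^sub>R z"

lemma affine_nonneg_between:
  fixes A B c r :: real
  assumes "\<bar>c\<bar> \<le> r" "0 \<le> A + B * r" "0 \<le> A - B * r"
  shows "0 \<le> A + B * c"
proof (cases "B \<ge> 0")
  case True
  then have "B * (-r) \<le> B * c" using assms by (intro mult_left_mono) auto
  then show ?thesis using assms by simp
next
  case False
  then have "B * r \<le> B * c" using assms by (intro mult_left_mono_neg) auto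
  then show ?thesis using assms by simp
qed

lemma norm_diff_square:
  fixes P Q :: "'a::real_inner"
  shows "(norm (P - Q))\<^sup>2 = (norm P)\<^sup>2 + (norm Q)\<^sup>2 - 2 * (P \<bullet> Q)"
  by (simp add: power2_norm_eq_inner inner_diff_left inner_diff_right inner_commute)

lemma norm_radial:
  assumes "f 0 = 0" "\<And>t. t \<ge> 0 \<Longrightarrow> f t \<ge> 0"
  shows "norm (radial f z) = f (norm z)"
  using assms by (simp add: radial_def)

lemma norm_radial_diff_square:
  fixes P Q :: "'a::real_inner"
  assumes "f 0 = 0" "\<And>t. t \<ge> 0 \<Longrightarrow> f t \<ge> 0"
  shows "(norm (radial f P - radial f Q))\<^sup>2 =
    (f (norm P))\<^sup>2 + (f (norm Q))\<^sup>2 - 2 * (f (norm P) / norm P * (f (norm Q) / norm Q)) * (P \<bullet> Q)"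
  unfolding norm_diff_square using norm_radial[of f, OF assms(1)] assms by (simp add: radial_def mult_ac)

text \<open>All three comparisons are affine in \<open>P \<bullet> Q\<close> once the two norms are fixed, so that they only
  have to be checked for parallel and antiparallel vectors.\<close>

lemma radial_diff_le:
  fixes P Q :: "'a::real_inner"
  assumes "f 0 = 0" "\<And>t. t \<ge> 0 \<Longrightarrow> f t \<ge> 0"
    and "(f (norm P) - f (norm Q))\<^sup>2 \<le> k * (norm P - norm Q)\<^sup>2"
    and "(f (norm P) + f (norm Q))\<^sup>2 \<le> k * (norm P + norm Q)\<^sup>2"
  shows "(norm (radial f P - radial f Q))\<^sup>2 \<le> k * (norm (P - Q))\<^sup>2"
proof -
  define A where "A = k * ((norm P)\<^sup>2 + (norm Q)\<^sup>2) - ((f (norm P))\<^sup>2 + (f (norm Q))\<^sup>2)"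
  define B where "B = 2 * (f (norm P) / norm P * (f (norm Q) / norm Q)) - 2 * k"
  \<comment> \<open>Since f vanishes at 0, the quotients f(|P|)/|P| and f(|Q|)/|Q| cancel against
    the norms even when P or Q is zero.\<close>
  have Br: "B * (norm P * norm Q) = 2 * f (norm P) * f (norm Q) - 2 * k * (norm P * norm Q)"
    using assms(1) by (auto simp: B_def algebra_simps)
  have "0 \<le> A + B * (P \<bullet> Q)"
  proof (rule affine_nonneg_between)
    show "\<bar>P \<bullet> Q\<bar> \<le> norm P * norm Q" by (rule Cauchy_Schwarz_ineq2)
    show "0 \<le> A + B * (norm P * norm Q)" "0 \<le> A - B * (norm P * norm Q)"
      using assms(3,4) unfolding Br A_def by (auto simp: power2_eq_square algebra_simps)
  qed
  moreover have "A + B * (P \<bullet> Q) = k * (norm (P - Q))\<^sup>2 - (norm (radial f P - radial f Q))\<^sup>2"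
    unfolding norm_radial_diff_square[of f, OF assms(1,2), simplified] norm_diff_square[of P Q] A_def B_def
    by (simp add: algebra_simps)
  ultimately show ?thesis by simp
qed

lemma radial_diff_ge:
  fixes P Q :: "'a::real_inner"
  assumes "f 0 = 0" "\<And>t. t \<ge> 0 \<Longrightarrow> f t \<ge> 0"
    and "k * (norm P - norm Q)\<^sup>2 \<le> (f (norm P) - f (norm Q))\<^sup>2"
    and "k * (norm P + norm Q)\<^sup>2 \<le> (f (norm P) + f (norm Q))\<^sup>2"
  shows "k * (norm (P - Q))\<^sup>2 \<le> (norm (radial f P - radial f Q))\<^sup>2"
proof -
  define A where "A = ((f (norm P))\<^sup>2 + (f (norm Q))\<^sup>2) - k * ((norm P)\<^sup>2 + (norm Q)\<^sup>2)"
  define B where "B = 2 * k - 2 * (f (norm P) / norm P * (f (norm Q) / norm Q))"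
  have Br: "B * (norm P * norm Q) = 2 * k * (norm P * norm Q) - 2 * f (norm P) * f (norm Q)"
    using assms(1) by (auto simp: B_def algebra_simps)
  have "0 \<le> A + B * (P \<bullet> Q)"
  proof (rule affine_nonneg_between)
    show "\<bar>P \<bullet> Q\<bar> \<le> norm P * norm Q" by (rule Cauchy_Schwarz_ineq2)
    show "0 \<le> A + B * (norm P * norm Q)" "0 \<le> A - B * (norm P * norm Q)"
      using assms(3,4) unfolding Br A_def by (auto simp: power2_eq_square algebra_simps)
  qed
  moreover have "A + B * (P \<bullet> Q) = (norm (radial f P - radial f Q))\<^sup>2 - k * (norm (P - Q))\<^sup>2"
    unfolding norm_radial_diff_square[of f, OF assms(1,2), simplified] norm_diff_square[of P Q] A_def B_def
    by (simp add: algebra_simps)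
  ultimately show ?thesis by simp
qed

lemma radial_monotone:
  fixes P Q :: "'a::real_inner"
  assumes "f 0 = 0"
    and "k * (norm P - norm Q)\<^sup>2 \<le> (f (norm P) - f (norm Q)) * (norm P - norm Q)"
    and "k * (norm P + norm Q)\<^sup>2 \<le> (f (norm P) + f (norm Q)) * (norm P + norm Q)"
  shows "k * (norm (P - Q))\<^sup>2 \<le> (radial f P - radial f Q) \<bullet> (P - Q)"
proof -
  have nn: "f (norm z) / norm z * (z \<bullet> z) = f (norm z) * norm z" for z :: 'a
    by (simp add: power2_norm_eq_inner[symmetric] power2_eq_square)
  define A where "A = f (norm P) * norm P + f (norm Q) * norm Q - k * ((norm P)\<^sup>2 + (norm Q)\<^sup>2)"
  define B where "B = 2 * k - (f (norm P) / norm P + f (norm Q) / norm Q)"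
  have Br: "B * (norm P * norm Q) = 2 * k * (norm P * norm Q) - f (norm P) * norm Q - f (norm Q) * norm P"
    using assms(1) by (auto simp: B_def algebra_simps)
  have "0 \<le> A + B * (P \<bullet> Q)"
  proof (rule affine_nonneg_between)
    show "\<bar>P \<bullet> Q\<bar> \<le> norm P * norm Q" by (rule Cauchy_Schwarz_ineq2)
    show "0 \<le> A + B * (norm P * norm Q)" "0 \<le> A - B * (norm P * norm Q)"
      using assms(2,3) unfolding Br A_def by (auto simp: power2_eq_square algebra_simps)
  qed
  moreover have "(radial f P - radial f Q) \<bullet> (P - Q) = f (norm P) * norm P + f (norm Q) * norm Q
      - (f (norm P) / norm P + f (norm Q) / norm Q) * (P \<bullet> Q)"
    unfolding radial_def inner_diff_left inner_diff_right inner_scaleR_left nn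
    by (simp add: inner_commute[of Q P] algebra_simps)
  then have "A + B * (P \<bullet> Q) = (radial f P - radial f Q) \<bullet> (P - Q) - k * (norm (P - Q))\<^sup>2"
    unfolding norm_diff_square A_def B_def by (simp add: algebra_simps)
  ultimately show ?thesis by simp
qed

text \<open>This is the coefficient a(P,Q). Up to constants it is the second derivative of \<Phi> at
  |P| + |Q|, the usual weight in the calculus of shifted N-functions; with the maximum in place of
  the sum it depends on the larger norm only.\<close>

definition slope :: "(real \<Rightarrow> real) \<Rightarrow> 'a::real_normed_vector \<Rightarrow> 'a \<Rightarrow> real" where
  "slope \<phi> P Q = \<phi> (max (norm P) (norm Q)) / max (norm P) (norm Q)"

section \<open>Scalar growth bounds and their vector form\<close>

lemma Aop_radial: "Aop \<phi> = radial \<phi>"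
  by (simp add: Aop_def radial_def fun_eq_iff)

lemma Vop_radial: "Vop \<phi> = radial (\<lambda>t. sqrt (t * \<phi> t))"
  by (simp add: Vop_def radial_def fun_eq_iff)

text \<open>These are the end point conditions of the radial comparisons with s = |P| and t = |Q|:
  differences belong to parallel vectors, sums to antiparallel ones. By symmetry only t \<le> s has
  to be treated.\<close>

lemma growth_pairs:
  assumes S: "structural \<Phi> \<phi>"
  obtains C where "C \<ge> 1"
    "\<And>s t a. s \<ge> 0 \<Longrightarrow> t \<ge> 0 \<Longrightarrow> a = \<phi> (max s t) / max s t \<Longrightarrow>
       \<bar>\<phi> s - \<phi> t\<bar> \<le> C * a * \<bar>s - t\<bar> \<and> \<phi> s + \<phi> t \<le> C * a * (s + t) \<and>
       a * (s - t)\<^sup>2 \<le> C * ((\<phi> s - \<phi> t) * (s - t)) \<and> a * (s + t)\<^sup>2 \<le> C * ((\<phi> s + \<phi> t) * (s + t)) \<and>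
       (sqrt (s * \<phi> s) - sqrt (t * \<phi> t))\<^sup>2 \<le> C * a * (s - t)\<^sup>2 \<and>
       (sqrt (s * \<phi> s) + sqrt (t * \<phi> t))\<^sup>2 \<le> C * a * (s + t)\<^sup>2 \<and>
       a * (s - t)\<^sup>2 \<le> C * (sqrt (s * \<phi> s) - sqrt (t * \<phi> t))\<^sup>2 \<and>
       a * (s + t)\<^sup>2 \<le> C * (sqrt (s * \<phi> s) + sqrt (t * \<phi> t))\<^sup>2"
proof -
  obtain k K where k: "k > 0" "K > 0"
    and lo: "\<And>s t. 0 \<le> t \<Longrightarrow> t \<le> s \<Longrightarrow> k * (\<phi> s / s) * (s - t) \<le> \<phi> s - \<phi> t"
    and up: "\<And>s t. 0 \<le> t \<Longrightarrow> t \<le> s \<Longrightarrow> \<phi> s - \<phi> t \<le> K * (\<phi> s / s) * (s - t)"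
    using structural_growth[OF S] by blast
  note basic = structural_basic[OF S]
  let ?\<psi> = "\<lambda>t. sqrt (t * \<phi> t)"
  \<comment> \<open>The summand 4 serves the bounds with sums, K and 1/k the increments of \<phi>,
    and the two squares the squared increments of the profile sqrt(t \<phi>(t)).\<close>
  define C where "C = 4 + K + 1 / k + (K + 1)\<^sup>2 + 4 / k\<^sup>2"
  have Cge: "C \<ge> 4" "C \<ge> K" "C \<ge> 1 / k" "C \<ge> (K + 1)\<^sup>2" "C \<ge> 4 / k\<^sup>2"
    using k by (auto simp: C_def intro!: add_nonneg_nonneg)
  have main: "\<phi> s - \<phi> t \<le> C * (\<phi> s / s) * (s - t) \<and> \<phi> s + \<phi> t \<le> C * (\<phi> s / s) * (s + t) \<and>
       (\<phi> s / s) * (s - t)\<^sup>2 \<le> C * ((\<phi> s - \<phi> t) * (s - t)) \<and>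
       (\<phi> s / s) * (s + t)\<^sup>2 \<le> C * ((\<phi> s + \<phi> t) * (s + t)) \<and>
       (?\<psi> s - ?\<psi> t)\<^sup>2 \<le> C * (\<phi> s / s) * (s - t)\<^sup>2 \<and>
       (?\<psi> s + ?\<psi> t)\<^sup>2 \<le> C * (\<phi> s / s) * (s + t)\<^sup>2 \<and>
       (\<phi> s / s) * (s - t)\<^sup>2 \<le> C * (?\<psi> s - ?\<psi> t)\<^sup>2 \<and>
       (\<phi> s / s) * (s + t)\<^sup>2 \<le> C * (?\<psi> s + ?\<psi> t)\<^sup>2" if st: "0 \<le> t" "t \<le> s" for s t
  proof (cases "s = 0")
    case True
    then show ?thesis using st basic(1) by simp
  next
    case False
    then have s: "s > 0" "\<phi> s > 0" using st basic(2)[of s] by auto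
    define a where "a = \<phi> s / s"
    have a: "a > 0" "\<phi> s = a * s" using s by (auto simp: a_def)
    have tp: "0 \<le> \<phi> t" "\<phi> t \<le> \<phi> s" using basic st by auto
    have l: "k * a * (s - t) \<le> \<phi> s - \<phi> t" and u: "\<phi> s - \<phi> t \<le> K * a * (s - t)"
      using lo[OF st] up[OF st] by (auto simp: a_def)
    define r where "r = sqrt a"
    have r: "r > 0" "r\<^sup>2 = a" using a by (auto simp: r_def)
    have ps: "?\<psi> s = r * s"
      using s by (simp add: a r_def real_sqrt_mult mult_ac)
    have pt0: "0 \<le> ?\<psi> t" using st tp by simp
    have ptle: "?\<psi> t \<le> ?\<psi> s" using st tp by (intro real_sqrt_le_mono mult_mono) auto
    \<comment> \<open>Multiplying the increment of the square root profile by the sum of its two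
      values leaves only increments of \<phi> and of the identity. The sum lies between
      \<open>r * s\<close> and \<open>2 * (r * s)\<close>, so dividing by it afterwards costs a
      factor 2 at most.\<close>
    have id: "(?\<psi> s - ?\<psi> t) * (?\<psi> s + ?\<psi> t) = s * (\<phi> s - \<phi> t) + \<phi> t * (s - t)"
    proof -
      have "(?\<psi> s - ?\<psi> t) * (?\<psi> s + ?\<psi> t) = (?\<psi> s)\<^sup>2 - (?\<psi> t)\<^sup>2"
        by (simp add: power2_eq_square algebra_simps)
      also have "\<dots> = s * \<phi> s - t * \<phi> t" using st s tp by simp
      finally show ?thesis by (simp add: algebra_simps)
    qed
    have pu: "?\<psi> s - ?\<psi> t \<le> (K + 1) * r * (s - t)"
    proof -
      have "(?\<psi> s - ?\<psi> t) * (r * s) \<le> (?\<psi> s - ?\<psi> t) * (?\<psi> s + ?\<psi> t)"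
        using ptle pt0 ps by (intro mult_left_mono) auto
      also have "\<dots> \<le> s * (K * a * (s - t)) + \<phi> s * (s - t)"
        unfolding id using u tp st s by (intro add_mono mult_left_mono mult_right_mono) auto
      also have "\<dots> = ((K + 1) * r * (s - t)) * (r * s)"
        unfolding a(2) r(2)[symmetric] by (simp add: power2_eq_square algebra_simps)
      finally show ?thesis by (rule mult_right_le_imp_le) (use r s in simp)
    qed
    have pl: "k / 2 * r * (s - t) \<le> ?\<psi> s - ?\<psi> t"
    proof -
      have "(k / 2 * r * (s - t)) * (2 * (r * s)) = s * (k * a * (s - t))"
        unfolding r(2)[symmetric] by (simp add: power2_eq_square)
      also have "\<dots> \<le> s * (\<phi> s - \<phi> t) + \<phi> t * (s - t)"
        using l s tp st by (intro add_increasing2 mult_left_mono) auto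
      also have "\<dots> = (?\<psi> s - ?\<psi> t) * (?\<psi> s + ?\<psi> t)" by (simp add: id)
      also have "\<dots> \<le> (?\<psi> s - ?\<psi> t) * (2 * (r * s))"
        using ptle pt0 ps by (intro mult_left_mono) auto
      finally show ?thesis by (rule mult_right_le_imp_le) (use r s in simp)
    qed
    have 1: "\<phi> s - \<phi> t \<le> C * a * (s - t)"
    proof -
      have "K * a * (s - t) \<le> C * a * (s - t)" using Cge a st by (intro mult_right_mono) auto
      then show ?thesis using u by linarith
    qed
    have 2: "\<phi> s + \<phi> t \<le> C * a * (s + t)"
    proof -
      have "\<phi> s + \<phi> t \<le> 2 * a * s" using tp a by simp
      also have "\<dots> \<le> C * a * (s + t)" using Cge a st by (intro mult_mono) auto
      finally show ?thesis .
    qed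
    have 3: "a * (s - t)\<^sup>2 \<le> C * ((\<phi> s - \<phi> t) * (s - t))"
    proof -
      have "a * (s - t)\<^sup>2 = 1 / k * ((k * a * (s - t)) * (s - t))"
        using k by (simp add: power2_eq_square)
      also have "\<dots> \<le> C * ((\<phi> s - \<phi> t) * (s - t))"
        using Cge k l st a tp by (intro mult_mono) auto
      finally show ?thesis .
    qed
    have 4: "a * (s + t)\<^sup>2 \<le> C * ((\<phi> s + \<phi> t) * (s + t))"
    proof -
      have "a * (s + t)\<^sup>2 = (a * s + a * t) * (s + t)" by (simp add: power2_eq_square algebra_simps)
      also have "\<dots> \<le> (2 * \<phi> s) * (s + t)" using a st by (intro mult_right_mono) auto
      also have "\<dots> = 2 * (\<phi> s * (s + t))" by simp
      also have "\<dots> \<le> C * ((\<phi> s + \<phi> t) * (s + t))"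
        using Cge tp s st by (intro mult_mono) auto
      finally show ?thesis .
    qed
    have 5: "(?\<psi> s - ?\<psi> t)\<^sup>2 \<le> C * a * (s - t)\<^sup>2"
    proof -
      have "(?\<psi> s - ?\<psi> t)\<^sup>2 \<le> ((K + 1) * r * (s - t))\<^sup>2"
        using pu ptle by (intro power_mono) auto
      also have "\<dots> = (K + 1)\<^sup>2 * a * (s - t)\<^sup>2" by (simp add: power_mult_distrib r(2))
      also have "\<dots> \<le> C * a * (s - t)\<^sup>2" using Cge a by (intro mult_right_mono) auto
      finally show ?thesis .
    qed
    have 6: "(?\<psi> s + ?\<psi> t)\<^sup>2 \<le> C * a * (s + t)\<^sup>2"
    proof -
      have "(?\<psi> s + ?\<psi> t)\<^sup>2 \<le> (2 * (r * s))\<^sup>2"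
        using ptle pt0 ps r s by (intro power_mono) (linarith, simp)
      also have "\<dots> = 4 * a * s\<^sup>2" by (simp add: power_mult_distrib r(2))
      also have "\<dots> \<le> C * a * (s + t)\<^sup>2" using Cge a st s by (intro mult_mono power_mono) auto
      finally show ?thesis .
    qed
    have 7: "a * (s - t)\<^sup>2 \<le> C * (?\<psi> s - ?\<psi> t)\<^sup>2"
    proof -
      have "a * (s - t)\<^sup>2 = 4 / k\<^sup>2 * (k / 2 * r * (s - t))\<^sup>2"
        using k by (simp add: power_mult_distrib r(2) power_divide)
      also have "\<dots> \<le> C * (?\<psi> s - ?\<psi> t)\<^sup>2"
        using pl Cge k r st by (intro mult_mono power_mono) auto
      finally show ?thesis .
    qed
    have 8: "a * (s + t)\<^sup>2 \<le> C * (?\<psi> s + ?\<psi> t)\<^sup>2"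
    proof -
      have "a * (s + t)\<^sup>2 \<le> a * (2 * s)\<^sup>2" using a st s by (intro mult_left_mono power_mono) auto
      also have "\<dots> = 4 * (?\<psi> s)\<^sup>2" unfolding ps by (simp add: power_mult_distrib r(2))
      also have "\<dots> \<le> C * (?\<psi> s + ?\<psi> t)\<^sup>2"
        using Cge pt0 ptle by (intro mult_mono power_mono) auto
      finally show ?thesis .
    qed
    show ?thesis using 1 2 3 4 5 6 7 8 by (simp only: a_def)
  qed
  show ?thesis
  proof (rule that)
    show "C \<ge> 1" using Cge by simp
    fix s t a :: real
    assume st: "s \<ge> 0" "t \<ge> 0" and a: "a = \<phi> (max s t) / max s t"
    show "\<bar>\<phi> s - \<phi> t\<bar> \<le> C * a * \<bar>s - t\<bar> \<and> \<phi> s + \<phi> t \<le> C * a * (s + t) \<and>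
       a * (s - t)\<^sup>2 \<le> C * ((\<phi> s - \<phi> t) * (s - t)) \<and> a * (s + t)\<^sup>2 \<le> C * ((\<phi> s + \<phi> t) * (s + t)) \<and>
       (?\<psi> s - ?\<psi> t)\<^sup>2 \<le> C * a * (s - t)\<^sup>2 \<and>
       (?\<psi> s + ?\<psi> t)\<^sup>2 \<le> C * a * (s + t)\<^sup>2 \<and>
       a * (s - t)\<^sup>2 \<le> C * (?\<psi> s - ?\<psi> t)\<^sup>2 \<and>
       a * (s + t)\<^sup>2 \<le> C * (?\<psi> s + ?\<psi> t)\<^sup>2"
    proof (cases "t \<le> s")
      case True
      then have "max s t = s" by simp
      then show ?thesis using main[OF st(2) True] True basic(3)[OF st(2) True] a by simp
    next
      case False
      then have m: "max s t = t" and le: "s \<le> t" by auto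
      have e: "(s - t)\<^sup>2 = (t - s)\<^sup>2" "(?\<psi> s - ?\<psi> t)\<^sup>2 = (?\<psi> t - ?\<psi> s)\<^sup>2"
        "(\<phi> s - \<phi> t) * (s - t) = (\<phi> t - \<phi> s) * (t - s)"
        by (auto simp: power2_commute algebra_simps)
      show ?thesis using main[OF st(1) le] le basic(3)[OF st(1) le] a m
        unfolding e by (simp add: add.commute)
    qed
  qed
qed

lemma slope_nonneg:
  assumes "structural \<Phi> \<phi>"
  shows "slope \<phi> P Q \<ge> 0"
  unfolding slope_def using structural_basic(5)[OF assms]
  by (intro divide_nonneg_nonneg) (auto simp: le_max_iff_disj)

text \<open>Once the two norms are frozen, \<open>slope\<close> is a number, so the radial
  comparisons apply with constants made of \<open>slope\<close> and C.\<close>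

lemma slope_estimates:
  assumes S: "structural \<Phi> \<phi>"
  obtains C where "C \<ge> 1"
    "\<And>P Q :: 'a::real_inner. norm (Aop \<phi> P - Aop \<phi> Q) \<le> C * slope \<phi> P Q * norm (P - Q)"
    "\<And>P Q :: 'a. slope \<phi> P Q * (norm (P - Q))\<^sup>2 \<le> C * ((Aop \<phi> P - Aop \<phi> Q) \<bullet> (P - Q))"
    "\<And>P Q :: 'a. (norm (Vop \<phi> P - Vop \<phi> Q))\<^sup>2 \<le> C * slope \<phi> P Q * (norm (P - Q))\<^sup>2"
    "\<And>P Q :: 'a. slope \<phi> P Q * (norm (P - Q))\<^sup>2 \<le> C * (norm (Vop \<phi> P - Vop \<phi> Q))\<^sup>2"
proof -
  note basic = structural_basic[OF S]
  obtain C where C: "C \<ge> 1" and g: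
    "\<And>s t a. s \<ge> 0 \<Longrightarrow> t \<ge> 0 \<Longrightarrow> a = \<phi> (max s t) / max s t \<Longrightarrow>
       \<bar>\<phi> s - \<phi> t\<bar> \<le> C * a * \<bar>s - t\<bar> \<and> \<phi> s + \<phi> t \<le> C * a * (s + t) \<and>
       a * (s - t)\<^sup>2 \<le> C * ((\<phi> s - \<phi> t) * (s - t)) \<and> a * (s + t)\<^sup>2 \<le> C * ((\<phi> s + \<phi> t) * (s + t)) \<and>
       (sqrt (s * \<phi> s) - sqrt (t * \<phi> t))\<^sup>2 \<le> C * a * (s - t)\<^sup>2 \<and>
       (sqrt (s * \<phi> s) + sqrt (t * \<phi> t))\<^sup>2 \<le> C * a * (s + t)\<^sup>2 \<and>
       a * (s - t)\<^sup>2 \<le> C * (sqrt (s * \<phi> s) - sqrt (t * \<phi> t))\<^sup>2 \<and>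
       a * (s + t)\<^sup>2 \<le> C * (sqrt (s * \<phi> s) + sqrt (t * \<phi> t))\<^sup>2"
    using growth_pairs[OF S] by metis
  let ?\<psi> = "\<lambda>t. sqrt (t * \<phi> t)"
  have psi: "?\<psi> 0 = 0" "\<And>t. t \<ge> 0 \<Longrightarrow> ?\<psi> t \<ge> 0" using basic by auto
  have gg: "\<bar>\<phi> (norm P) - \<phi> (norm Q)\<bar> \<le> C * slope \<phi> P Q * \<bar>norm P - norm Q\<bar>"
    "\<phi> (norm P) + \<phi> (norm Q) \<le> C * slope \<phi> P Q * (norm P + norm Q)"
    "slope \<phi> P Q * (norm P - norm Q)\<^sup>2 \<le> C * ((\<phi> (norm P) - \<phi> (norm Q)) * (norm P - norm Q))"
    "slope \<phi> P Q * (norm P + norm Q)\<^sup>2 \<le> C * ((\<phi> (norm P) + \<phi> (norm Q)) * (norm P + norm Q))"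
    "(?\<psi> (norm P) - ?\<psi> (norm Q))\<^sup>2 \<le> C * slope \<phi> P Q * (norm P - norm Q)\<^sup>2"
    "(?\<psi> (norm P) + ?\<psi> (norm Q))\<^sup>2 \<le> C * slope \<phi> P Q * (norm P + norm Q)\<^sup>2"
    "slope \<phi> P Q * (norm P - norm Q)\<^sup>2 \<le> C * (?\<psi> (norm P) - ?\<psi> (norm Q))\<^sup>2"
    "slope \<phi> P Q * (norm P + norm Q)\<^sup>2 \<le> C * (?\<psi> (norm P) + ?\<psi> (norm Q))\<^sup>2"
    for P Q :: 'a
    using g[of "norm P" "norm Q" "slope \<phi> P Q"] by (auto simp: slope_def)
  note sl = slope_nonneg[OF S]
  show ?thesis
  proof (rule that[OF C])
    fix P Q :: 'a
    have CC: "slope \<phi> P Q * z = C * (slope \<phi> P Q / C * z)" for z using C by simp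
    \<comment> \<open>The comparison lemma speaks of squared norms, hence the squared constant,
      whose root is taken afterwards.\<close>
    have "(norm (Aop \<phi> P - Aop \<phi> Q))\<^sup>2 \<le> (C * slope \<phi> P Q)\<^sup>2 * (norm (P - Q))\<^sup>2"
      unfolding Aop_radial
    proof (rule radial_diff_le)
      show "(\<phi> (norm P) - \<phi> (norm Q))\<^sup>2 \<le> (C * slope \<phi> P Q)\<^sup>2 * (norm P - norm Q)\<^sup>2"
        using power_mono[OF gg(1)[of P Q], of 2] by (simp add: power_mult_distrib)
      show "(\<phi> (norm P) + \<phi> (norm Q))\<^sup>2 \<le> (C * slope \<phi> P Q)\<^sup>2 * (norm P + norm Q)\<^sup>2"
        using power_mono[OF gg(2)[of P Q], of 2] basic(5) by (simp add: power_mult_distrib)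
    qed (use basic in auto)
    then show "norm (Aop \<phi> P - Aop \<phi> Q) \<le> C * slope \<phi> P Q * norm (P - Q)"
      using sl[of P Q] C by (simp add: power_mult_distrib[symmetric] power2_le_iff_abs_le abs_mult)
    have "slope \<phi> P Q / C * (norm (P - Q))\<^sup>2 \<le> (Aop \<phi> P - Aop \<phi> Q) \<bullet> (P - Q)"
      unfolding Aop_radial using gg[of P Q] C basic
      by (intro radial_monotone) (auto simp: divide_le_eq mult_ac)
    then show "slope \<phi> P Q * (norm (P - Q))\<^sup>2 \<le> C * ((Aop \<phi> P - Aop \<phi> Q) \<bullet> (P - Q))"
      using C by (simp add: divide_le_eq mult_ac)
    show "(norm (Vop \<phi> P - Vop \<phi> Q))\<^sup>2 \<le> C * slope \<phi> P Q * (norm (P - Q))\<^sup>2"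
      unfolding Vop_radial by (rule radial_diff_le[of ?\<psi>, OF psi gg(5,6)])
    have "slope \<phi> P Q / C * (norm (P - Q))\<^sup>2 \<le> (norm (Vop \<phi> P - Vop \<phi> Q))\<^sup>2"
      unfolding Vop_radial using gg[of P Q] C psi
      by (intro radial_diff_ge[of ?\<psi>]) (auto simp: divide_le_eq mult_ac)
    then show "slope \<phi> P Q * (norm (P - Q))\<^sup>2 \<le> C * (norm (Vop \<phi> P - Vop \<phi> Q))\<^sup>2"
      using C by (simp add: divide_le_eq mult_ac)
  qed
qed

text \<open>This lets R replace Q when |P - R| is not small against |P - Q|. The function
  \<phi>(t)/t need not be monotone and may blow up at 0 (as for powers t^(p-1) with p < 2), so a
  bound on max(|P|,|Q|) from above is not enough: when this maximum is tiny, the factor |P - Q| has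
  to compensate for it.\<close>

lemma slope_change:
  assumes S: "structural \<Phi> \<phi>" and d: "0 < d" "d \<le> 1"
  obtains K where "K > 0"
    "\<And>P Q R :: 'a::real_inner. d * norm (P - Q) < norm (P - R) \<Longrightarrow>
       slope \<phi> P Q * norm (P - Q) \<le> K * (slope \<phi> P R * norm (P - R))"
proof -
  note basic = structural_basic[OF S]
  obtain q where q: "q > 0" "\<And>l t. l \<ge> 1 \<Longrightarrow> t \<ge> 0 \<Longrightarrow> \<phi> (l * t) \<le> l powr q * \<phi> t"
    using structural_scaling[OF S] by blast
  \<comment> \<open>Obtained from |Q| \<le> |P| + |P - Q| \<le> n + 2 n / d \<le> 3 n / d, where n =
    max(|P|,|R|) and d \<le> 1.\<close>
  define l where "l = 3 / d"
  have l: "l \<ge> 1" using d by (simp add: l_def)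
  define K where "K = 4 + 2 * l powr q / d"
  have K: "K \<ge> 4" "K \<ge> 2 * l powr q / d" using d by (auto simp: K_def)
  show ?thesis
  proof (rule that)
    show "K > 0" using K by simp
    fix P Q R :: 'a
    assume far: "d * norm (P - Q) < norm (P - R)"
    define m where "m = max (norm P) (norm Q)"
    define n where "n = max (norm P) (norm R)"
    have PR: "norm (P - R) > 0" using far d by (smt (verit) mult_nonneg_nonneg norm_ge_zero)
    have PR2: "norm (P - R) \<le> 2 * n" using norm_triangle_ineq4[of P R] by (simp add: n_def)
    then have n: "n > 0" using PR by linarith
    have m0: "m \<ge> 0" by (simp add: m_def le_max_iff_disj)
    have PQ: "norm (P - Q) \<le> norm (P - R) / d" using far d by (simp add: field_simps)
    have sn: "slope \<phi> P R = \<phi> n / n" and sm: "slope \<phi> P Q = \<phi> m / m"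
      by (simp_all add: slope_def n_def m_def)
    have pn: "\<phi> n > 0" using basic n by simp
    show "slope \<phi> P Q * norm (P - Q) \<le> K * (slope \<phi> P R * norm (P - R))"
    proof (cases "m \<le> n / 2")
      \<comment> \<open>Here R alone carries the norm n, so |P - R| \<ge> n/2, and the denominator m
        cancels against |P - Q| \<le> 2 m.\<close>
      case True
      then have "norm P \<le> n / 2" by (simp add: m_def)
      moreover from this n have "norm R = n" by (auto simp: n_def max_def split: if_splits)
      ultimately have PRn: "n / 2 \<le> norm (P - R)"
        using norm_triangle_ineq2[of R P] by (simp add: norm_minus_commute)
      have "norm (P - Q) \<le> 2 * m" using norm_triangle_ineq4[of P Q] by (simp add: m_def)
      then have "slope \<phi> P Q * norm (P - Q) \<le> \<phi> m / m * (2 * m)"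
        unfolding sm using basic(5)[OF m0] m0 by (intro mult_left_mono) auto
      also have "\<dots> \<le> 2 * \<phi> n"
        using basic(1) basic(3)[OF m0, of n] True n pn by (cases "m = 0") auto
      also have "\<dots> = 4 * (\<phi> n / n * (n / 2))" using n by simp
      also have "\<dots> \<le> K * (\<phi> n / n * norm (P - R))"
        using K PRn n pn by (intro mult_mono) auto
      finally show ?thesis by (simp add: sn)
    next
      case False
      have "norm Q \<le> norm P + norm (P - Q)" using norm_triangle_sub[of Q P] by (simp add: norm_minus_commute)
      also have "\<dots> \<le> n + 2 * n / d"
        using PQ divide_right_mono[OF PR2, of d] d by (simp add: n_def)
      also have "\<dots> \<le> l * n" using d n by (simp add: l_def field_simps)
      finally have "norm Q \<le> l * n" .
      moreover have "norm P \<le> l * n"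
        using mult_right_mono[OF l, of n] n unfolding n_def by linarith
      ultimately have "m \<le> l * n" by (simp add: m_def)
      then have "\<phi> m \<le> l powr q * \<phi> n"
        using basic(3)[OF m0, of "l * n"] q(2)[OF l, of n] n by linarith
      then have "\<phi> m / m \<le> l powr q * \<phi> n / (n / 2)"
        using False n pn m0 by (intro frac_le) auto
      then have "slope \<phi> P Q * norm (P - Q) \<le> l powr q * \<phi> n / (n / 2) * (norm (P - R) / d)"
        unfolding sm using PQ pn n by (intro mult_mono) auto
      also have "\<dots> = 2 * l powr q / d * (\<phi> n / n * norm (P - R))" by (simp add: mult_ac)
      also have "\<dots> \<le> K * (\<phi> n / n * norm (P - R))"
        using K n pn by (intro mult_right_mono) auto
      finally show ?thesis by (simp add: sn)
    qed
  qed
qed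

text \<open>The same C occurs in both bounds, doubled in the second. After integration, twice the
  error is then at most the error plus K times the best approximation error, and the error can be
  absorbed.\<close>

lemma Vop_quasi_optimal_pointwise:
  assumes S: "structural \<Phi> \<phi>"
  obtains C K where "C > 0" "K > 0"
    "\<And>P Q :: 'a::real_inner. (norm (Vop \<phi> P - Vop \<phi> Q))\<^sup>2 \<le> C * ((Aop \<phi> P - Aop \<phi> Q) \<bullet> (P - Q))"
    "\<And>P Q R :: 'a. 2 * C * ((Aop \<phi> P - Aop \<phi> Q) \<bullet> (P - R)) \<le>
       (norm (Vop \<phi> P - Vop \<phi> Q))\<^sup>2 + K * (norm (Vop \<phi> P - Vop \<phi> R))\<^sup>2"
proof -
  note basic = structural_basic[OF S]
  obtain c where c: "c \<ge> 1"
    and e1: "\<And>P Q :: 'a. norm (Aop \<phi> P - Aop \<phi> Q) \<le> c * slope \<phi> P Q * norm (P - Q)"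
    and e2: "\<And>P Q :: 'a. slope \<phi> P Q * (norm (P - Q))\<^sup>2 \<le> c * ((Aop \<phi> P - Aop \<phi> Q) \<bullet> (P - Q))"
    and e3: "\<And>P Q :: 'a. (norm (Vop \<phi> P - Vop \<phi> Q))\<^sup>2 \<le> c * slope \<phi> P Q * (norm (P - Q))\<^sup>2"
    and e4: "\<And>P Q :: 'a. slope \<phi> P Q * (norm (P - Q))\<^sup>2 \<le> c * (norm (Vop \<phi> P - Vop \<phi> Q))\<^sup>2"
    using slope_estimates[OF S, where 'a='a] by blast
  \<comment> \<open>Chosen so that 2 c^3 d c = 1: when |P - R| \<le> d |P - Q|, the mixed term is
    then absorbed with coefficient exactly 1.\<close>
  define d where "d = 1 / (2 * c ^ 4)"
  have "c ^ 4 \<ge> 1" using c by simp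
  then have d: "0 < d" "d \<le> 1" by (auto simp: d_def divide_le_eq)
  obtain L where L: "L > 0" "\<And>P Q R :: 'a. d * norm (P - Q) < norm (P - R) \<Longrightarrow>
       slope \<phi> P Q * norm (P - Q) \<le> L * (slope \<phi> P R * norm (P - R))"
    using slope_change[OF S d, where 'a='a] by blast
  note sl = slope_nonneg[OF S]
  show ?thesis
  \<comment> \<open>One factor c passes from V to \<open>slope\<close> and another from
    \<open>slope\<close> to A, which gives C = c^2. The far case collects 2 c^3 from Cauchy-Schwarz,
    L from the exchange of Q for R and c from the return to V.\<close>
  proof (rule that[of "c\<^sup>2" "2 * c ^ 4 * L"])
    fix P Q R :: 'a
    have "(norm (Vop \<phi> P - Vop \<phi> Q))\<^sup>2 \<le> c * (slope \<phi> P Q * (norm (P - Q))\<^sup>2)"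
      using e3[of P Q] by (simp add: mult.assoc)
    also have "\<dots> \<le> c * (c * ((Aop \<phi> P - Aop \<phi> Q) \<bullet> (P - Q)))"
      using e2[of P Q] c by (intro mult_left_mono) auto
    finally show "(norm (Vop \<phi> P - Vop \<phi> Q))\<^sup>2 \<le> c\<^sup>2 * ((Aop \<phi> P - Aop \<phi> Q) \<bullet> (P - Q))"
      by (simp add: power2_eq_square mult.assoc)
    have "(Aop \<phi> P - Aop \<phi> Q) \<bullet> (P - R) \<le> norm (Aop \<phi> P - Aop \<phi> Q) * norm (P - R)"
      by (rule norm_cauchy_schwarz)
    also have "\<dots> \<le> c * slope \<phi> P Q * norm (P - Q) * norm (P - R)"
      using e1 by (intro mult_right_mono) auto
    finally have "2 * c\<^sup>2 * ((Aop \<phi> P - Aop \<phi> Q) \<bullet> (P - R)) \<le>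
        2 * c\<^sup>2 * (c * slope \<phi> P Q * norm (P - Q) * norm (P - R))"
      using c by (intro mult_left_mono) auto
    also have "\<dots> = 2 * c ^ 3 * (slope \<phi> P Q * norm (P - Q) * norm (P - R))"
      by (simp add: power2_eq_square power3_eq_cube)
    also have "\<dots> \<le> (norm (Vop \<phi> P - Vop \<phi> Q))\<^sup>2 + 2 * c ^ 4 * L * (norm (Vop \<phi> P - Vop \<phi> R))\<^sup>2"
    proof (cases "d * norm (P - Q) < norm (P - R)")
      case True
      have "slope \<phi> P Q * norm (P - Q) * norm (P - R) \<le> L * (slope \<phi> P R * norm (P - R)) * norm (P - R)"
        using L(2)[OF True] by (intro mult_right_mono) auto
      also have "\<dots> = L * (slope \<phi> P R * (norm (P - R))\<^sup>2)" by (simp add: power2_eq_square)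
      also have "\<dots> \<le> L * (c * (norm (Vop \<phi> P - Vop \<phi> R))\<^sup>2)"
        using e4[of P R] L by (intro mult_left_mono) auto
      finally have "2 * c ^ 3 * (slope \<phi> P Q * norm (P - Q) * norm (P - R)) \<le>
          2 * c ^ 3 * (L * (c * (norm (Vop \<phi> P - Vop \<phi> R))\<^sup>2))"
        using c by (intro mult_left_mono) auto
      also have "\<dots> = 2 * c ^ 4 * L * (norm (Vop \<phi> P - Vop \<phi> R))\<^sup>2"
        by (simp add: power3_eq_cube power4_eq_xxxx)
      finally show ?thesis by (simp add: add_increasing)
    next
      case False
      have "slope \<phi> P Q * norm (P - Q) * norm (P - R) \<le> slope \<phi> P Q * norm (P - Q) * (d * norm (P - Q))"
        using False sl[of P Q] by (intro mult_left_mono) auto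
      also have "\<dots> = d * (slope \<phi> P Q * (norm (P - Q))\<^sup>2)" by (simp add: power2_eq_square)
      also have "\<dots> \<le> d * (c * (norm (Vop \<phi> P - Vop \<phi> Q))\<^sup>2)"
        using e4[of P Q] d by (intro mult_left_mono) auto
      finally have "2 * c ^ 3 * (slope \<phi> P Q * norm (P - Q) * norm (P - R)) \<le>
          2 * c ^ 3 * (d * (c * (norm (Vop \<phi> P - Vop \<phi> Q))\<^sup>2))"
        using c by (intro mult_left_mono) auto
      also have "\<dots> = (norm (Vop \<phi> P - Vop \<phi> Q))\<^sup>2"
        using c by (simp add: d_def power3_eq_cube power4_eq_xxxx)
      finally show ?thesis using L c by (simp add: add_increasing2)
    qed
    finally show "2 * c\<^sup>2 * ((Aop \<phi> P - Aop \<phi> Q) \<bullet> (P - R)) \<le>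
       (norm (Vop \<phi> P - Vop \<phi> Q))\<^sup>2 + 2 * c ^ 4 * L * (norm (Vop \<phi> P - Vop \<phi> R))\<^sup>2" .
  qed (use c L in auto)
qed

subsection \<open>Smooth bump functions\<close>

lemma has_derivative_cgrad:
  assumes "f differentiable at x"
  shows "(f has_derivative (\<lambda>h. cgrad f x \<bullet> h)) (at x)"
proof -
  let ?D = "frechet_derivative f (at x)"
  have D: "(f has_derivative ?D) (at x)"
    using assms frechet_derivative_works by blast
  interpret linear ?D by (rule linear_frechet_derivative[OF assms])
  have "?D h = cgrad f x \<bullet> h" for h
  proof -
    have "?D h = ?D (\<Sum>i\<in>Basis. (h \<bullet> i) *\<^sub>R i)" by (simp add: euclidean_representation)
    also have "\<dots> = (\<Sum>i\<in>Basis. (h \<bullet> i) * ?D i)" by (simp add: sum scale)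
    also have "\<dots> = cgrad f x \<bullet> h"
      by (simp add: cgrad_def inner_sum_left inner_commute[of h] mult.commute)
    finally show ?thesis .
  qed
  then have "?D = (\<lambda>h. cgrad f x \<bullet> h)" by (rule ext)
  with D show ?thesis by simp
qed

lemma cgrad_unique:
  assumes "(f has_derivative (\<lambda>h. a \<bullet> h)) (at x)"
  shows "cgrad f x = a"
proof -
  have "frechet_derivative f (at x) = (\<lambda>h. a \<bullet> h)"
    using frechet_derivative_at[OF assms] by simp
  then show ?thesis by (simp add: cgrad_def euclidean_representation)
qed

lemma frechet_derivative_eq_cgrad:
  "i \<in> Basis \<Longrightarrow> frechet_derivative f (at x) i = cgrad f x \<bullet> i"
  by (simp add: cgrad_def inner_sum_left inner_Basis if_distrib cong: if_cong)

text \<open>Finite orders replace the coinductive \<open>cinf\<close> in closure proofs. A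
  coinduction for products or compositions would need a relation closed under all the sums and
  products that repeated differentiation creates, while induction on the order meets them one
  derivative at a time.\<close>

primrec ck :: "nat \<Rightarrow> ('a::euclidean_space \<Rightarrow> real) \<Rightarrow> bool" where
  "ck 0 f \<longleftrightarrow> True"
| "ck (Suc n) f \<longleftrightarrow> (\<forall>x. f differentiable at x) \<and>
     (\<forall>i\<in>Basis. ck n (\<lambda>x. frechet_derivative f (at x) i))"

lemma cinf_iff_ck: "cinf f \<longleftrightarrow> (\<forall>n. ck n f)"
proof
  assume "cinf f"
  then show "\<forall>n. ck n f"
  proof (intro allI)
    fix n from \<open>cinf f\<close> show "ck n f"
      by (induction n arbitrary: f) (auto elim: cinf.cases)
  qed
next
  assume *: "\<forall>n. ck n f"
  show "cinf f"
  proof (rule cinf.coinduct[of "\<lambda>f. \<forall>n. ck n f", OF *])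
    fix g :: "'a \<Rightarrow> real" assume g: "\<forall>n. ck n g"
    have "\<forall>x. g differentiable at x" using g[rule_format, of "Suc 0"] by simp
    moreover have "ck n (\<lambda>x. frechet_derivative g (at x) i)" if "i \<in> Basis" for i n
      using g[rule_format, of "Suc n"] that by simp
    ultimately show "\<exists>f. g = f \<and> (\<forall>x. f differentiable at x) \<and>
      (\<forall>i\<in>Basis. (\<forall>n. ck n (\<lambda>x. frechet_derivative f (at x) i)) \<or> cinf (\<lambda>x. frechet_derivative f (at x) i))"
      by blast
  qed
qed

lemma ck_SucI:
  assumes "\<And>x. (f has_derivative f' x) (at x)" "\<And>i. i \<in> Basis \<Longrightarrow> ck n (\<lambda>x. f' x i)"
  shows "ck (Suc n) f"
proof -
  have "frechet_derivative f (at x) = f' x" for x using frechet_derivative_at[OF assms(1)] by simp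
  then show ?thesis using assms by (auto simp: differentiable_def)
qed

lemma ck_Suc_D:
  assumes "ck (Suc n) f"
  shows "(f has_derivative frechet_derivative f (at x)) (at x)"
    "i \<in> Basis \<Longrightarrow> ck n (\<lambda>x. frechet_derivative f (at x) i)"
  using assms frechet_derivative_works by auto

lemma ck_mono: "ck (Suc n) f \<Longrightarrow> ck n f"
  by (induction n arbitrary: f) auto

lemma ck_const: "ck n (\<lambda>x. c)"
  by (induction n arbitrary: c) auto

lemma ck_add: "ck n f \<Longrightarrow> ck n g \<Longrightarrow> ck n (\<lambda>x. f x + g x)"
proof (induction n arbitrary: f g)
  case (Suc n)
  show ?case
  proof (rule ck_SucI)
    show "((\<lambda>x. f x + g x) has_derivative
      (\<lambda>h. frechet_derivative f (at x) h + frechet_derivative g (at x) h)) (at x)" for x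
      using Suc.prems by (intro has_derivative_add ck_Suc_D(1))
  qed (use Suc ck_Suc_D(2) in blast)
qed simp

lemma ck_mult: "ck n f \<Longrightarrow> ck n g \<Longrightarrow> ck n (\<lambda>x. f x * g x)"
proof (induction n arbitrary: f g)
  case (Suc n)
  show ?case
  proof (rule ck_SucI)
    show "((\<lambda>x. f x * g x) has_derivative
      (\<lambda>h. f x * frechet_derivative g (at x) h + frechet_derivative f (at x) h * g x)) (at x)" for x
      using Suc.prems by (intro has_derivative_mult ck_Suc_D(1))
    show "ck n (\<lambda>x. f x * frechet_derivative g (at x) i + frechet_derivative f (at x) i * g x)"
      if "i \<in> Basis" for i
      using Suc that by (intro ck_add Suc.IH ck_mono[of n f] ck_mono[of n g] ck_Suc_D(2)) auto
  qed
qed simp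

lemma ck_cmult: "ck n f \<Longrightarrow> ck n (\<lambda>x. c * f x)"
  by (rule ck_mult[OF ck_const])

lemma ck_inner: "ck n (\<lambda>x. x \<bullet> a)"
proof (cases n)
  case (Suc m)
  have "ck (Suc m) (\<lambda>x. x \<bullet> a)"
    by (rule ck_SucI[where f' = "\<lambda>x h. h \<bullet> a"]) (auto intro!: derivative_eq_intros ck_const)
  then show ?thesis using Suc by simp
qed simp

lemma ck_norm_square: "ck n (\<lambda>x. x \<bullet> x)"
proof (cases n)
  case (Suc m)
  have "ck (Suc m) (\<lambda>x :: 'a. x \<bullet> x)"
  proof (rule ck_SucI[where f' = "\<lambda>x h. 2 * (x \<bullet> h)"])
    show "((\<lambda>x. x \<bullet> x) has_derivative (\<lambda>h. 2 * (x \<bullet> h))) (at x)" for x :: 'a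
      by (auto intro!: derivative_eq_intros simp: inner_commute)
  qed (intro ck_cmult ck_inner)
  then show ?thesis using Suc by simp
qed simp

text \<open>The classical flat function exp(-1/t), divided by powers of t. The parameter k makes the
  family closed under differentiation up to linear combinations, which is what an induction on the
  order of smoothness requires.\<close>

definition flat :: "nat \<Rightarrow> real \<Rightarrow> real" where
  "flat k t = (if t > 0 then exp (- (1 / t)) / t ^ k else 0)"

lemma flat_tendsto_0: "(flat k \<longlongrightarrow> 0) (at 0)"
proof (rule filterlim_split_at)
  have "((\<lambda>x. inverse x ^ k / exp (inverse x)) \<longlongrightarrow> (0::real)) (at_right 0)"
    by (rule filterlim_compose[OF tendsto_power_div_exp_0 filterlim_inverse_at_top_right])
  moreover have "\<forall>\<^sub>F x in at_right 0. inverse x ^ k / exp (inverse x) = flat k x"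
    unfolding eventually_at_right_field
    by (intro exI[of _ 1]) (simp add: flat_def exp_minus inverse_eq_divide power_divide)
  ultimately show "(flat k \<longlongrightarrow> 0) (at_right 0)" by (rule Lim_transform_eventually)
  have "\<forall>\<^sub>F x in at_left 0. 0 = flat k x"
    unfolding eventually_at_left_field by (intro exI[of _ "-1"]) (simp add: flat_def)
  then show "(flat k \<longlongrightarrow> 0) (at_left 0)" by (rule Lim_transform_eventually[OF tendsto_const])
qed

lemma flat_has_derivative:
  "(flat k has_real_derivative (flat (k + 2) t - real k * flat (k + 1) t)) (at t)"
proof (cases t "0 :: real" rule: linorder_cases)
  case less
  have "((\<lambda>x. 0) has_real_derivative 0) (at t)" by simp
  moreover have "open {..<0::real}" by simp
  ultimately have "(flat k has_real_derivative 0) (at t)"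
    by (rule has_field_derivative_transform_within_open) (use less in \<open>auto simp: flat_def\<close>)
  then show ?thesis using less by (simp add: flat_def)
next
  case equal
  \<comment> \<open>At the origin the difference quotient of \<open>flat k\<close> is again a member
    of the family, \<open>flat (Suc k)\<close>, and so tends to 0.\<close>
  have "((\<lambda>h. (flat k h - flat k 0) / h) \<longlongrightarrow> 0) (at 0)"
  proof (rule Lim_transform_eventually[OF flat_tendsto_0[of "Suc k"]])
    show "\<forall>\<^sub>F x in at 0. flat (Suc k) x = (flat k x - flat k 0) / x"
      by (rule always_eventually) (auto simp: flat_def)
  qed
  then show ?thesis using equal by (simp add: flat_def has_field_derivative_iff)
next
  case greater
  have "((\<lambda>x. exp (- (1 / x)) / x ^ k) has_real_derivative
      (flat (k + 2) t - real k * flat (k + 1) t)) (at t)"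
  \<comment> \<open>The split keeps the exponent k - 1 in the derivative of t^k meaningful.\<close>
  proof (cases k)
    case 0
    then show ?thesis using greater
      by (auto intro!: derivative_eq_intros simp: flat_def power2_eq_square)
  next
    case (Suc m)
    have "((\<lambda>x. exp (- (1 / x)) / x ^ k) has_real_derivative
      (exp (- (1 / t)) * (1 / (t * t)) * t ^ k - exp (- (1 / t)) * (real k * t ^ m)) / (t ^ k * t ^ k)) (at t)"
      using greater Suc DERIV_power[OF DERIV_ident, of k t UNIV]
      by (auto intro!: derivative_eq_intros simp: algebra_simps) (cases m; simp)
    also have "(exp (- (1 / t)) * (1 / (t * t)) * t ^ k - exp (- (1 / t)) * (real k * t ^ m)) / (t ^ k * t ^ k)
       = flat (k + 2) t - real k * flat (k + 1) t"
      using greater Suc by (simp add: flat_def diff_divide_distrib)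
    finally show ?thesis .
  qed
  moreover have "open {0::real<..}" by simp
  ultimately show ?thesis
    by (rule has_field_derivative_transform_within_open) (use greater in \<open>auto simp: flat_def\<close>)
qed

lemma ck_flat: "ck n f \<Longrightarrow> ck n (\<lambda>x. flat k (f x))"
proof (induction n arbitrary: k)
  case (Suc n)
  show ?case
  proof (rule ck_SucI)
    show "((\<lambda>x. flat k (f x)) has_derivative (\<lambda>h. (flat (k + 2) (f x) + (- real k) * flat (k + 1) (f x)) *
       frechet_derivative f (at x) h)) (at x)" for x
      using has_derivative_compose[OF ck_Suc_D(1)[OF Suc.prems, of x],
          of "flat k" "\<lambda>h. (flat (k + 2) (f x) - real k * flat (k + 1) (f x)) * h"]
        flat_has_derivative[of k "f x"]
      by (simp add: has_field_derivative_def)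
    show "ck n (\<lambda>x. (flat (k + 2) (f x) + (- real k) * flat (k + 1) (f x)) * frechet_derivative f (at x) i)"
      if "i \<in> Basis" for i
      using Suc.prems that by (intro ck_mult ck_add ck_cmult Suc.IH ck_mono[OF Suc.prems] ck_Suc_D(2)[OF Suc.prems])
  qed
qed simp

lemma ck_continuous: "ck (Suc n) f \<Longrightarrow> continuous_on S f"
  by (meson continuous_at_imp_continuous_on differentiable_imp_continuous_within ck.simps(2))

lemma ck_cgrad_continuous: "ck (Suc (Suc n)) f \<Longrightarrow> continuous_on S (cgrad f)"
  unfolding cgrad_def by (intro continuous_intros ck_continuous[of n]) simp

lemma cinf_cgrad_continuous: "cinf f \<Longrightarrow> continuous_on S (cgrad f)"
  using ck_cgrad_continuous[of 0 f] by (simp only: cinf_iff_ck)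

lemma cinf_continuous: "cinf f \<Longrightarrow> continuous_on S f"
  using ck_continuous[of 0 f] by (simp only: cinf_iff_ck)

lemma cinf_differentiable: "cinf f \<Longrightarrow> f differentiable (at x)"
  by (auto elim: cinf.cases)

text \<open>Using the square of the norm keeps the inner function polynomial and hence smooth at the
  origin as well.\<close>

definition bump :: "real \<Rightarrow> 'a::euclidean_space \<Rightarrow> real" where
  "bump e x = flat 0 (e\<^sup>2 - x \<bullet> x)"

lemma cinf_bump: "cinf (bump e)"
  unfolding cinf_iff_ck bump_def
proof
  fix n
  have "ck n (\<lambda>x :: 'a. e\<^sup>2 + (-1) * (x \<bullet> x))" by (intro ck_add ck_const ck_cmult ck_norm_square)
  from ck_flat[OF this] show "ck n (\<lambda>x :: 'a. flat 0 (e\<^sup>2 - x \<bullet> x))" by simp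
qed

lemma bump_nonneg: "bump e x \<ge> 0"
  by (simp add: bump_def flat_def)

lemma bump_pos_iff: "e > 0 \<Longrightarrow> bump e x > 0 \<longleftrightarrow> norm x < e"
  using power_mono_iff[of e "norm x" 2]
  by (simp add: bump_def flat_def power2_norm_eq_inner[symmetric] flip: not_le)

lemma integrable_continuous_compact_support:
  fixes f :: "'a::euclidean_space \<Rightarrow> real"
  assumes "continuous_on UNIV f" "\<And>x. norm x > R \<Longrightarrow> f x = 0"
  shows "integrable lborel f"
proof -
  have "integrable lborel (\<lambda>x. indicator (cball 0 R) x *\<^sub>R f x)"
    using assms by (intro borel_integrable_compact) (auto intro: continuous_on_subset)
  moreover have "(\<lambda>x. indicator (cball 0 R) x *\<^sub>R f x) = f"
    using assms(2) by (auto simp: fun_eq_iff indicator_def not_le)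
  ultimately show ?thesis by simp
qed

lemma bump_eq_0: "e > 0 \<Longrightarrow> norm x \<ge> e \<Longrightarrow> bump e x = 0"
  using bump_pos_iff[of e x] bump_nonneg[of e x] by linarith

lemma bump_integrable: "e > 0 \<Longrightarrow> integrable lborel (bump e)"
  by (rule integrable_continuous_compact_support[of _ e]) (auto intro!: cinf_continuous cinf_bump bump_eq_0)

lemma bump_integral_pos:
  assumes "e > 0" shows "(LINT x|lborel. bump e (x :: 'a::euclidean_space)) > 0"
proof -
  have "(LINT x|lborel. bump e (x::'a)) \<noteq> 0"
  proof
    assume "(LINT x|lborel. bump e (x::'a)) = 0"
    then have "AE x in lborel. bump e (x::'a) = 0"
      using integral_nonneg_eq_0_iff_AE[OF bump_integrable[OF assms]] bump_nonneg by auto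
    then have "AE x in lborel. x \<notin> ball (0::'a) e"
    proof (rule eventually_mono)
      fix x :: 'a assume "bump e x = 0"
      then show "x \<notin> ball 0 e" using bump_pos_iff[OF assms, of x] by auto
    qed
    then have "emeasure lborel (ball (0::'a) e) = 0"
      using AE_iff_measurable[of "ball (0::'a) e" lborel "\<lambda>x. x \<notin> ball (0::'a) e"] by (simp add: ball_def)
    then show False using assms unit_ball_vol_pos[of "real DIM('a)"] by (simp add: emeasure_ball)
  qed
  moreover have "(LINT x|lborel. bump e (x::'a)) \<ge> 0" by (simp add: bump_nonneg)
  ultimately show ?thesis by simp
qed

definition mollifier :: "real \<Rightarrow> 'a::euclidean_space \<Rightarrow> real" where
  "mollifier e x = bump e x / (LINT y|lborel. bump e (y :: 'a))"

lemma mollifier_props: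
  fixes x :: "'a::euclidean_space"
  assumes e: "e > 0"
  shows "cinf (mollifier e :: 'a \<Rightarrow> real)" "mollifier e x \<ge> 0" "norm x \<ge> e \<Longrightarrow> mollifier e x = 0"
    "integrable lborel (mollifier e :: 'a \<Rightarrow> real)" "(LINT x|lborel. mollifier e (x :: 'a)) = 1"
proof -
  let ?I = "LINT y|lborel. bump e (y :: 'a)"
  note I = bump_integral_pos[OF e, where 'a='a]
  have "cinf (\<lambda>x. (1 / ?I) * bump e (x::'a))"
    using cinf_bump unfolding cinf_iff_ck by (blast intro: ck_cmult)
  then show "cinf (mollifier e :: 'a \<Rightarrow> real)" by (simp add: mollifier_def[abs_def])
  show "mollifier e x \<ge> 0" using I by (simp add: mollifier_def bump_nonneg)
  show "norm x \<ge> e \<Longrightarrow> mollifier e x = 0"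
    using bump_eq_0[OF e, of x] by (simp add: mollifier_def)
  show "integrable lborel (mollifier e :: 'a \<Rightarrow> real)"
    using bump_integrable[OF e, where 'a='a] unfolding mollifier_def[abs_def] by (rule integrable_divide_zero[rotated]) 
  show "(LINT x|lborel. mollifier e (x :: 'a)) = 1"
    using I by (simp add: mollifier_def)
qed

subsection \<open>Mollification\<close>

lemma integral_lborel_translate:
  fixes f :: "'a::euclidean_space \<Rightarrow> real"
  assumes "f \<in> borel_measurable borel"
  shows "(LINT z|lborel. f (x + z)) = (LINT y|lborel. f y)"
proof -
  have "(LINT y|lborel. f y) = (LINT y|distr lborel borel ((+) x). f y)"
    by (simp add: lborel_distr_plus)
  also have "\<dots> = (LINT z|lborel. f (x + z))"
    using assms by (subst integral_distr) auto
  finally show ?thesis by simp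
qed

text \<open>Differentiation under the integral over a fixed box: x occurs only in the kernel, so
  continuity of v suffices, and the inner derivative of y - x produces the minus sign. Order 2 of
  the kernel makes its gradient continuous.\<close>

lemma integral_kernel_has_derivative:
  fixes k v :: "'a::euclidean_space \<Rightarrow> real"
  assumes k: "ck (Suc (Suc 0)) k" and v: "continuous_on UNIV v"
  shows "((\<lambda>x. integral (cbox a b) (\<lambda>y. k (y - x) * v y)) has_derivative
    (\<lambda>h. integral (cbox a b) (\<lambda>y. - (cgrad k (y - x) \<bullet> h) * v y))) (at x)"
proof -
  let ?G = "\<lambda>x y. (- v y) *\<^sub>R cgrad k (y - x)"
  have cg: "continuous_on UNIV (cgrad k)" by (rule ck_cgrad_continuous[OF k])
  have contG: "continuous_on UNIV (\<lambda>p. ?G (fst p) (snd p))"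
    by (intro continuous_intros continuous_on_compose2[OF v] continuous_on_compose2[OF cg]) auto
  have d: "((\<lambda>x. k (y - x) * v y) has_derivative blinfun_inner_left (?G x y)) (at x within UNIV)" for x y
  proof -
    have "(k has_derivative (\<lambda>h. cgrad k (y - x) \<bullet> h)) (at (y - x))"
      using k by (intro has_derivative_cgrad) simp
    then have "((\<lambda>x. k (y - x)) has_derivative (\<lambda>h. cgrad k (y - x) \<bullet> (- h))) (at x)"
      by (rule has_derivative_compose[rotated]) (auto intro!: derivative_eq_intros)
    then have "((\<lambda>x. k (y - x) * v y) has_derivative (\<lambda>h. (cgrad k (y - x) \<bullet> (- h)) * v y)) (at x)"
      by (rule has_derivative_mult_left)
    then show ?thesis by (simp add: inner_commute mult.commute)
  qed
  have "((\<lambda>x. integral (cbox a b) (\<lambda>y. k (y - x) * v y)) has_derivative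
      integral (cbox a b) (\<lambda>y. blinfun_inner_left (?G x y))) (at x within UNIV)"
  proof (rule leibniz_rule[OF d])
    show "(\<lambda>y. k (y - x) * v y) integrable_on cbox a b" for x
      by (intro integrable_continuous continuous_intros continuous_on_compose2[OF ck_continuous[OF k]]
          continuous_on_subset[OF v]) auto
    show "continuous_on (UNIV \<times> cbox a b) (\<lambda>(x, y). blinfun_inner_left (?G x y))"
      unfolding case_prod_beta
      by (intro bounded_linear.continuous_on[OF bounded_linear_blinfun_inner_left]
          continuous_on_subset[OF contG]) auto
  qed auto
  also have "blinfun_apply (integral (cbox a b) (\<lambda>y. blinfun_inner_left (?G x y))) =
      (\<lambda>h. integral (cbox a b) (\<lambda>y. - (cgrad k (y - x) \<bullet> h) * v y))"
  proof
   fix h show "blinfun_apply (integral (cbox a b) (\<lambda>y. blinfun_inner_left (?G x y))) h =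
      integral (cbox a b) (\<lambda>y. - (cgrad k (y - x) \<bullet> h) * v y)"
  proof (subst blinfun_apply_integral)
    show "(\<lambda>y. blinfun_inner_left (?G x y)) integrable_on cbox a b"
      by (intro integrable_continuous bounded_linear.continuous_on[OF bounded_linear_blinfun_inner_left]
         continuous_intros continuous_on_subset[OF v] continuous_on_compose2[OF cg]) auto
  qed (simp add: inner_commute mult.commute)
  qed
  finally show ?thesis by simp
qed

lemma cinf_partial: "cinf f \<Longrightarrow> i \<in> Basis \<Longrightarrow> cinf (\<lambda>x. frechet_derivative f (at x) i)"
  by (auto elim: cinf.cases)

lemma cinf_uminus: "cinf f \<Longrightarrow> cinf (\<lambda>x. - f x)"
  using ck_cmult[of _ f "-1"] by (simp add: cinf_iff_ck)

text \<open>A partial derivative in x is an integral of the same shape, with kernel minus a partial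
  derivative of k, again smooth; hence the induction over all kernels.\<close>

lemma cinf_integral_kernel:
  fixes k v :: "'a::euclidean_space \<Rightarrow> real"
  assumes "cinf k" and v: "continuous_on UNIV v"
  shows "cinf (\<lambda>x. integral (cbox a b) (\<lambda>y. k (y - x) * v y))"
  unfolding cinf_iff_ck
proof
  fix n show "ck n (\<lambda>x. integral (cbox a b) (\<lambda>y. k (y - x) * v y))"
    using assms(1)
  proof (induction n arbitrary: k)
    case (Suc n)
    show ?case
    proof (rule ck_SucI)
      show "((\<lambda>x. integral (cbox a b) (\<lambda>y. k (y - x) * v y)) has_derivative
         (\<lambda>h. integral (cbox a b) (\<lambda>y. - (cgrad k (y - x) \<bullet> h) * v y))) (at x)" for x
        using Suc.prems by (intro integral_kernel_has_derivative v) (simp only: cinf_iff_ck)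
      show "ck n (\<lambda>x. integral (cbox a b) (\<lambda>y. - (cgrad k (y - x) \<bullet> i) * v y))" if "i \<in> Basis" for i
        using Suc.IH[OF cinf_uminus[OF cinf_partial[OF Suc.prems that]]]
        by (simp add: frechet_derivative_eq_cgrad[OF that])
    qed
  qed simp
qed

text \<open>The usual convolution, since the mollifier is even. Written as an average of translates
  of v it passes on Lipschitz bounds and local affinity without any differentiation.\<close>

definition smoothing :: "real \<Rightarrow> ('a::euclidean_space \<Rightarrow> real) \<Rightarrow> 'a \<Rightarrow> real" where
  "smoothing e v x = (LINT z|lborel. mollifier e z * v (x + z))"

lemma mollifier_mult_integrable:
  fixes w :: "'a::euclidean_space \<Rightarrow> real"
  assumes e: "e > 0" and w: "continuous_on UNIV w"
  shows "integrable lborel (\<lambda>z. mollifier e z * w z)"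
proof (rule integrable_continuous_compact_support[where R = e])
  show "continuous_on UNIV (\<lambda>z. mollifier e z * w z)"
    by (rule continuous_on_mult[OF cinf_continuous[OF mollifier_props(1)[OF e]] w])
qed (simp add: mollifier_props[OF e])

text \<open>The mollifier is a probability density supported in the ball of radius e. The closeness,
  Lipschitz, vanishing and affine properties of \<open>smoothing\<close> all come from this
  bound.\<close>

lemma mollifier_average_bound:
  fixes w :: "'a::euclidean_space \<Rightarrow> real"
  assumes e: "e > 0" and w: "continuous_on UNIV w" and B: "\<And>z. norm z < e \<Longrightarrow> \<bar>w z - c\<bar> \<le> B"
  shows "\<bar>(LINT z|lborel. mollifier e z * w z) - c\<bar> \<le> B"
proof -
  have i: "integrable lborel (\<lambda>z. mollifier e z * w z)" "integrable lborel (\<lambda>z. mollifier e z * (w z - c))"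
    using w by (auto intro!: mollifier_mult_integrable[OF e] continuous_intros)
  have "(LINT z|lborel. mollifier e z * w z) - c = (LINT z|lborel. mollifier e z * w z) - (LINT z|lborel. mollifier e (z::'a) * c)"
    using mollifier_props[OF e, where 'a='a] by simp
  also have "\<dots> = (LINT z|lborel. mollifier e z * (w z - c))"
    using i mollifier_props[OF e, where 'a='a]
    by (simp add: right_diff_distrib)
  finally have "\<bar>(LINT z|lborel. mollifier e z * w z) - c\<bar> = \<bar>LINT z|lborel. mollifier e z * (w z - c)\<bar>"
    by simp
  also have "\<dots> \<le> (LINT z|lborel. \<bar>mollifier e z * (w z - c)\<bar>)"
    by (rule integral_abs_bound)
  also have "\<dots> \<le> (LINT z|lborel. mollifier e (z::'a) * B)"
  proof (rule integral_mono)
    fix z :: 'a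
    show "\<bar>mollifier e z * (w z - c)\<bar> \<le> mollifier e z * B"
      using B[of z] mollifier_props(2,3)[OF e, of z]
      by (cases "norm z < e") (auto simp: abs_mult intro!: mult_left_mono)
  qed (use i mollifier_props[OF e, where 'a='a] in auto)
  finally show ?thesis using mollifier_props[OF e, where 'a='a] by simp
qed

text \<open>The offset c serves two purposes: c = 0 gives the Lipschitz bound, and c equal to a
  linear increment with B = 0 gives exact preservation of affine pieces.\<close>

lemma smoothing_diff_bound:
  fixes v :: "'a::euclidean_space \<Rightarrow> real"
  assumes e: "e > 0" and v: "continuous_on UNIV v"
    and B: "\<And>z. norm z < e \<Longrightarrow> \<bar>v (x + z) - v (y + z) - c\<bar> \<le> B"
  shows "\<bar>smoothing e v x - smoothing e v y - c\<bar> \<le> B"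
proof -
  have c: "continuous_on UNIV (\<lambda>z. v (x + z))" for x
    by (intro continuous_on_compose2[OF v] continuous_intros) auto
  have "smoothing e v x - smoothing e v y = (LINT z|lborel. mollifier e z * (v (x + z) - v (y + z)))"
    unfolding smoothing_def
    using mollifier_mult_integrable[OF e c[of x]] mollifier_mult_integrable[OF e c[of y]]
    by (simp add: right_diff_distrib)
  then show ?thesis using mollifier_average_bound[OF e continuous_on_diff[OF c c] B] by simp
qed

lemma smoothing_lipschitz:
  fixes v :: "'a::euclidean_space \<Rightarrow> real"
  assumes "e > 0" and v: "L-lipschitz_on UNIV v"
  shows "L-lipschitz_on UNIV (smoothing e v)"
proof (rule lipschitz_onI)
  fix x y
  have "\<bar>v (x + z) - v (y + z) - 0\<bar> \<le> L * dist x y" for z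
    using lipschitz_onD[OF v, of "x + z" "y + z"] by (simp add: dist_real_def)
  from smoothing_diff_bound[OF assms(1) lipschitz_on_continuous_on[OF v] this]
  show "dist (smoothing e v x) (smoothing e v y) \<le> L * dist x y" by (simp add: dist_real_def)
qed (use v lipschitz_on_nonneg in blast)

lemma smoothing_close:
  fixes v :: "'a::euclidean_space \<Rightarrow> real"
  assumes e: "e > 0" and v: "L-lipschitz_on UNIV v"
  shows "\<bar>smoothing e v x - v x\<bar> \<le> L * e"
  unfolding smoothing_def
proof (rule mollifier_average_bound[OF e])
  show "continuous_on UNIV (\<lambda>z. v (x + z))"
    by (intro continuous_on_compose2[OF lipschitz_on_continuous_on[OF v]] continuous_intros) auto
  show "\<bar>v (x + z) - v x\<bar> \<le> L * e" if "norm z < e" for z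
  proof -
    have "\<bar>v (x + z) - v x\<bar> \<le> L * norm z"
      using lipschitz_onD[OF v, of "x + z" x] by (simp add: dist_real_def dist_norm)
    also have "\<dots> \<le> L * e" using that lipschitz_on_nonneg[OF v] by (intro mult_left_mono) auto
    finally show ?thesis .
  qed
qed

lemma smoothing_eq_0:
  fixes v :: "'a::euclidean_space \<Rightarrow> real"
  assumes e: "e > 0" and v: "continuous_on UNIV v" and 0: "\<And>z. norm z < e \<Longrightarrow> v (x + z) = 0"
  shows "smoothing e v x = 0"
proof -
  have "continuous_on UNIV (\<lambda>z. v (x + z))"
    by (intro continuous_on_compose2[OF v] continuous_intros) auto
  from mollifier_average_bound[OF e this, of 0 0] 0 show ?thesis by (simp add: smoothing_def)
qed

text \<open>Translation moves the variable x from v into the smooth kernel, and the bounded support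
  of v confines the integral to one box that does not depend on x.\<close>

lemma cinf_smoothing:
  fixes v :: "'a::euclidean_space \<Rightarrow> real"
  assumes e: "e > 0" and v: "continuous_on UNIV v" and S: "bounded S" "\<And>x. x \<notin> S \<Longrightarrow> v x = 0"
  shows "cinf (smoothing e v)"
proof -
  obtain a where a: "S \<subseteq> cbox (-a) a" using bounded_subset_cbox_symmetric[OF S(1)] by blast
  note m = mollifier_props[OF e, where 'a='a]
  have "smoothing e v x = integral (cbox (-a) a) (\<lambda>y. mollifier e (y - x) * v y)" for x
  proof -
    have c: "continuous_on UNIV (\<lambda>y. mollifier e (y - x) * v y)"
      by (rule continuous_on_mult[OF continuous_on_compose2[OF cinf_continuous[OF m(1)]] v])
         (auto intro!: continuous_intros)
    have "smoothing e v x = (LINT z|lborel. (\<lambda>y. mollifier e (y - x) * v y) (x + z))"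
      by (simp add: smoothing_def)
    also have "\<dots> = (LINT y|lborel. mollifier e (y - x) * v y)"
      by (rule integral_lborel_translate[OF borel_measurable_continuous_onI[OF c]])
    also have "\<dots> = (LINT y|lborel. indicator (cbox (-a) a) y *\<^sub>R (mollifier e (y - x) * v y))"
      using a S(2) by (intro Bochner_Integration.integral_cong) (auto simp: indicator_def)
    also have "\<dots> = integral (cbox (-a) a) (\<lambda>y. mollifier e (y - x) * v y)"
      using set_borel_integral_eq_integral(2)[of "cbox (-a) a" "\<lambda>y. mollifier e (y - x) * v y"]
        borel_integrable_compact[OF compact_cbox continuous_on_subset[OF c]]
      by (simp add: set_integrable_def set_lebesgue_integral_def)
    finally show ?thesis .
  qed
  then have "smoothing e v = (\<lambda>x. integral (cbox (-a) a) (\<lambda>y. mollifier e (y - x) * v y))" by (rule ext)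
  then show ?thesis using cinf_integral_kernel[OF m(1) v, of "-a" a] by simp
qed

lemma test_fun_smoothing:
  fixes v :: "'a::euclidean_space \<Rightarrow> real"
  assumes e: "e > 0" and v: "continuous_on UNIV v" and S: "compact S" "\<And>x. x \<notin> S \<Longrightarrow> v x = 0"
    and sub: "(\<Union>x\<in>S. cball x e) \<subseteq> \<Omega>"
  shows "test_fun \<Omega> (smoothing e v)" "x \<notin> (\<Union>x\<in>S. cball x e) \<Longrightarrow> smoothing e v x = 0"
    "compact (\<Union>x\<in>S. cball x e)"
proof -
  let ?K = "\<Union>x\<in>S. cball x e"
  show 0: "smoothing e v x = 0" if "x \<notin> ?K" for x
  proof (rule smoothing_eq_0[OF e v])
    fix z :: 'a assume "norm z < e"
    then have "x \<in> cball (x + z) e" by (simp add: dist_norm)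
    with that have "x + z \<notin> S" by blast
    then show "v (x + z) = 0" by (rule S(2))
  qed
  \<comment> \<open>The closed neighbourhood is compact as a sum of two compact sets.\<close>
  have "?K = {x + y | x y. x \<in> S \<and> y \<in> cball 0 e}"
  proof (intro equalityI subsetI)
    fix y assume "y \<in> ?K"
    then obtain x where "x \<in> S" "dist x y \<le> e" by auto
    then show "y \<in> {x + y | x y. x \<in> S \<and> y \<in> cball 0 e}"
      by (intro CollectI exI[of _ x] exI[of _ "y - x"]) (auto simp: dist_norm norm_minus_commute)
  next
    fix z assume "z \<in> {x + y | x y. x \<in> S \<and> y \<in> cball 0 e}"
    then obtain x y where "z = x + y" "x \<in> S" "norm y \<le> e" by auto
    then show "z \<in> ?K" by (intro UN_I[of x]) (auto simp: dist_norm)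
  qed
  then show K: "compact ?K" using compact_sums[OF S(1) compact_cball[of 0 e]] by simp
  have cl: "closure {x. smoothing e v x \<noteq> 0} \<subseteq> ?K"
    using 0 compact_imp_closed[OF K] by (intro closure_minimal subsetI) blast+
  then have "compact (closure {x. smoothing e v x \<noteq> 0})"
    unfolding compact_closure
    by (rule bounded_subset[OF compact_imp_bounded[OF K] order_trans[OF closure_subset]])
  then show "test_fun \<Omega> (smoothing e v)"
    unfolding test_fun_def using cl sub cinf_smoothing[OF e v compact_imp_bounded[OF S(1)] S(2)] by auto
qed

text \<open>Differentiate in the direction of the gradient g itself: the derivative is |g|^2, while
  the difference quotients are bounded by L |g|.\<close>

lemma cgrad_norm_le_lipschitz:
  fixes f :: "'a::euclidean_space \<Rightarrow> real"
  assumes f: "L-lipschitz_on UNIV f" and d: "f differentiable at x"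
  shows "norm (cgrad f x) \<le> L"
proof -
  let ?g = "cgrad f x"
  have "((\<lambda>t. f (x + t *\<^sub>R ?g)) has_derivative (\<lambda>t. ?g \<bullet> (t *\<^sub>R ?g))) (at 0)"
    by (rule has_derivative_compose[of "\<lambda>t. x + t *\<^sub>R ?g"])
       (use has_derivative_cgrad[OF d] in \<open>auto intro!: derivative_eq_intros\<close>)
  then have "((\<lambda>t. f (x + t *\<^sub>R ?g)) has_real_derivative (?g \<bullet> ?g)) (at 0)"
    by (simp add: has_field_derivative_def mult.commute[of _ "?g \<bullet> ?g"])
  then have "((\<lambda>t. norm ((f (x + t *\<^sub>R ?g) - f x) / t)) \<longlongrightarrow> norm (?g \<bullet> ?g)) (at 0)"
    unfolding has_field_derivative_iff by (intro tendsto_norm) simp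
  moreover have "\<forall>\<^sub>F t in at 0. norm ((f (x + t *\<^sub>R ?g) - f x) / t) \<le> L * norm ?g"
  proof (rule eventually_at_filter[THEN iffD2], intro always_eventually allI impI)
    fix t :: real assume t: "t \<noteq> 0"
    have "\<bar>f (x + t *\<^sub>R ?g) - f x\<bar> \<le> L * (\<bar>t\<bar> * norm ?g)"
      using lipschitz_onD[OF f, of "x + t *\<^sub>R ?g" x] by (simp add: dist_real_def dist_norm)
    then show "norm ((f (x + t *\<^sub>R ?g) - f x) / t) \<le> L * norm ?g" using t by (simp add: divide_le_eq mult_ac)
  qed
  ultimately have "norm (?g \<bullet> ?g) \<le> L * norm ?g" by (rule tendsto_upperbound) simp
  then have "norm ?g * norm ?g \<le> L * norm ?g" by (simp add: power2_norm_eq_inner[symmetric] power2_eq_square)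
  then show ?thesis using lipschitz_on_nonneg[OF f] by (cases "?g = 0") auto
qed

text \<open>A piecewise affine function has this property off the boundaries of its cells. It gives
  differentiability there and, by \<open>cgrad_smoothing\<close>, exact equality of gradients after
  smoothing at a small scale.\<close>

definition locally_affine_at :: "('a::euclidean_space \<Rightarrow> real) \<Rightarrow> 'a \<Rightarrow> bool" where
  "locally_affine_at v x \<longleftrightarrow> (\<exists>e>0. \<exists>a. \<forall>y\<in>ball x e. v y = v x + a \<bullet> (y - x))"

lemma affine_has_derivative:
  fixes v :: "'a::euclidean_space \<Rightarrow> real"
  assumes "e > 0" "\<And>y. y \<in> ball x e \<Longrightarrow> v y = v x + a \<bullet> (y - x)"
  shows "(v has_derivative (\<lambda>h. a \<bullet> h)) (at x)"
proof -
  have "((\<lambda>y. v x + a \<bullet> (y - x)) has_derivative (\<lambda>h. a \<bullet> h)) (at x)"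
    by (rule derivative_eq_intros | simp)+
  moreover have "open (ball x e)" "x \<in> ball x e" using assms(1) by auto
  moreover have "v x + a \<bullet> (y - x) = v y" if "y \<in> ball x e" for y using assms(2)[OF that] by simp
  ultimately show ?thesis by (rule has_derivative_transform_within_open)
qed

lemma locally_affine_at_differentiable:
  assumes "locally_affine_at v x"
  shows "v differentiable at x"
proof -
  obtain e a where "e > 0" "\<And>y. y \<in> ball x e \<Longrightarrow> v y = v x + a \<bullet> (y - x)"
    using assms unfolding locally_affine_at_def by blast
  then have "(v has_derivative (\<lambda>h. a \<bullet> h)) (at x)" by (rule affine_has_derivative[of e x v a])
  then show ?thesis by (rule differentiableI)
qed

text \<open>For y within e of x, all translates x + z and y + z with |z| < e lie in the ball of
  radius 2 e, where the increment of v is exactly linear; averaging keeps it so.\<close>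

lemma cgrad_smoothing:
  fixes v :: "'a::euclidean_space \<Rightarrow> real"
  assumes v: "continuous_on UNIV v" and e: "0 < e" "2 * e \<le> r"
    and a: "\<And>y. y \<in> ball x r \<Longrightarrow> v y = c + a \<bullet> y"
  shows "cgrad (smoothing e v) x = a"
proof (rule cgrad_unique, rule affine_has_derivative[OF e(1)])
  fix y assume y: "y \<in> ball x e"
  have "\<bar>smoothing e v y - smoothing e v x - a \<bullet> (y - x)\<bar> \<le> 0"
  proof (rule smoothing_diff_bound[OF e(1) v])
    fix z :: 'a assume z: "norm z < e"
    have "y + z \<in> ball x r"
      using y z e dist_triangle[of x "y + z" y] by (simp add: dist_norm[of y "y + z"])
    moreover have "x + z \<in> ball x r" using z e by (simp add: dist_norm)
    ultimately have "v (y + z) = c + a \<bullet> (y + z)" "v (x + z) = c + a \<bullet> (x + z)"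
      using a by blast+
    then show "\<bar>v (y + z) - v (x + z) - a \<bullet> (y - x)\<bar> \<le> 0"
      by (simp add: inner_diff_right inner_add_right)
  qed
  then show "smoothing e v y = smoothing e v x + a \<bullet> (y - x)" by simp
qed

subsection \<open>Difference quotients and the fundamental lemma\<close>

lemma borel_measurable_lebesgueI: "f \<in> borel_measurable borel \<Longrightarrow> f \<in> borel_measurable lebesgue"
  by (rule measurable_completion) simp

lemma continuous_borel_measurable_lebesgue:
  "continuous_on UNIV f \<Longrightarrow> f \<in> borel_measurable lebesgue"
  by (intro borel_measurable_lebesgueI borel_measurable_continuous_onI)

text \<open>The steps 1/(n+1) form a sequence, as measurability of limits and dominated convergence
  require, and none of them exceeds 1.\<close>

definition diff_quotient :: "('a::euclidean_space \<Rightarrow> real) \<Rightarrow> 'a \<Rightarrow> nat \<Rightarrow> 'a \<Rightarrow> real" where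
  "diff_quotient f i n x = (f (x + (1 / real (Suc n)) *\<^sub>R i) - f x) * real (Suc n)"

lemma diff_quotient_tendsto:
  assumes "f differentiable at x"
  shows "(\<lambda>n. diff_quotient f i n x) \<longlonglongrightarrow> cgrad f x \<bullet> i"
proof -
  have "((\<lambda>t. f (x + t *\<^sub>R i)) has_derivative (\<lambda>t. cgrad f x \<bullet> (t *\<^sub>R i))) (at 0)"
    by (rule has_derivative_compose[of "\<lambda>t. x + t *\<^sub>R i"])
       (use has_derivative_cgrad[OF assms] in \<open>auto intro!: derivative_eq_intros\<close>)
  then have "((\<lambda>t. f (x + t *\<^sub>R i)) has_real_derivative (cgrad f x \<bullet> i)) (at 0)"
    by (simp add: has_field_derivative_def mult.commute[of _ "cgrad f x \<bullet> i"])
  then have "((\<lambda>t. (f (x + t *\<^sub>R i) - f x) / t) \<longlongrightarrow> cgrad f x \<bullet> i) (at 0)"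
    by (simp add: has_field_derivative_iff)
  moreover have "filterlim (\<lambda>n. 1 / real (Suc n)) (at 0) sequentially"
    unfolding filterlim_at using LIMSEQ_inverse_real_of_nat by (simp add: inverse_eq_divide)
  ultimately have "(\<lambda>n. (f (x + (1 / real (Suc n)) *\<^sub>R i) - f x) / (1 / real (Suc n))) \<longlonglongrightarrow> cgrad f x \<bullet> i"
    by (rule filterlim_compose)
  then show ?thesis by (simp add: diff_quotient_def)
qed

lemma diff_quotient_continuous:
  assumes "continuous_on UNIV f"
  shows "continuous_on UNIV (diff_quotient f i n)"
  unfolding diff_quotient_def[abs_def]
  by (intro continuous_intros continuous_on_compose2[OF assms]) auto

text \<open>At points of differentiability the gradient is a limit of continuous difference
  quotients; completeness of Lebesgue measure takes care of the exceptional null set.\<close>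

lemma cgrad_measurable:
  fixes f :: "'a::euclidean_space \<Rightarrow> real"
  assumes f: "continuous_on UNIV f" and ae: "AE x in lebesgue. f differentiable at x"
  shows "cgrad f \<in> borel_measurable lebesgue"
proof (rule borel_measurable_AE)
  let ?s = "\<lambda>n x. \<Sum>i\<in>Basis. diff_quotient f i n x *\<^sub>R i"
  have "?s n \<in> borel_measurable borel" for n
    by (intro borel_measurable_continuous_onI continuous_intros diff_quotient_continuous[OF f])
  then show "(\<lambda>x. lim (\<lambda>n. ?s n x)) \<in> borel_measurable lebesgue"
    by (intro borel_measurable_lebesgueI borel_measurable_lim_metric)
  show "AE x in lebesgue. lim (\<lambda>n. ?s n x) = cgrad f x"
    using ae
  proof eventually_elim
    case (elim x)
    have "(\<lambda>n. ?s n x) \<longlonglongrightarrow> (\<Sum>i\<in>Basis. (cgrad f x \<bullet> i) *\<^sub>R i)"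
      by (intro tendsto_intros diff_quotient_tendsto elim)
    then show ?case by (simp add: euclidean_representation limI)
  qed
qed

lemma diff_quotient_bound:
  fixes f :: "'a::euclidean_space \<Rightarrow> real"
  assumes "B-lipschitz_on UNIV f" "i \<in> Basis"
  shows "\<bar>diff_quotient f i n x\<bar> \<le> B"
proof -
  have "\<bar>f (x + (1 / real (Suc n)) *\<^sub>R i) - f x\<bar> \<le> B * (1 / real (Suc n))"
    using lipschitz_onD[OF assms(1), of "x + (1 / real (Suc n)) *\<^sub>R i" x] assms(2)
    by (simp add: dist_real_def dist_norm)
  then have "\<bar>f (x + (1 / real (Suc n)) *\<^sub>R i) - f x\<bar> * real (Suc n) \<le> B * (1 / real (Suc n)) * real (Suc n)"
    by (rule mult_right_mono) simp
  then show ?thesis by (simp add: diff_quotient_def abs_mult del: of_nat_Suc)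
qed

lemma integral_diff_quotient:
  fixes f :: "'a::euclidean_space \<Rightarrow> real"
  assumes f: "continuous_on UNIV f" and supp: "\<And>x. norm x > R \<Longrightarrow> f x = 0"
  shows "(LINT x|lborel. diff_quotient f i n x) = 0"
proof -
  let ?c = "(1 / real (Suc n)) *\<^sub>R i"
  have m: "f \<in> borel_measurable borel" by (rule borel_measurable_continuous_onI[OF f])
  have i: "integrable lborel f" by (rule integrable_continuous_compact_support[OF f supp])
  have i': "integrable lborel (\<lambda>x. f (x + ?c))"
  proof (rule integrable_continuous_compact_support[where R = "R + norm ?c"])
    show "continuous_on UNIV (\<lambda>x. f (x + ?c))"
      by (intro continuous_on_compose2[OF f] continuous_intros) auto
    show "f (x + ?c) = 0" if "norm x > R + norm ?c" for x
      using supp[of "x + ?c"] that norm_triangle_ineq2[of x "- ?c"] by (simp only: norm_minus_cancel diff_minus_eq_add)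
  qed
  have "(LINT x|lborel. f (x + ?c)) = (LINT x|lborel. f x)"
    using integral_lborel_translate[OF m, of ?c] by (simp add: add.commute)
  then show ?thesis using i i' by (simp add: diff_quotient_def del: of_nat_Suc)
qed

text \<open>Difference quotients have vanishing integral by translation invariance.\<close>

lemma integral_cgrad_eq_0:
  fixes f :: "'a::euclidean_space \<Rightarrow> real"
  assumes f: "B-lipschitz_on UNIV f" and supp: "\<And>x. norm x > R \<Longrightarrow> f x = 0"
    and ae: "AE x in lebesgue. f differentiable at x" and i: "i \<in> Basis"
  shows "integrable lebesgue (\<lambda>x. cgrad f x \<bullet> i)" "(LINT x|lebesgue. cgrad f x \<bullet> i) = 0"
proof -
  have c: "continuous_on UNIV f" by (rule lipschitz_on_continuous_on[OF f])
  have B: "B \<ge> 0" by (rule lipschitz_on_nonneg[OF f])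
  \<comment> \<open>A step of length at most 1 enlarges the support by at most 1, so one radius
    dominates all difference quotients.\<close>
  let ?w = "\<lambda>x. indicator (cball (0::'a) (R + 1)) x * B"
  have m1: "(\<lambda>x. cgrad f x \<bullet> i) \<in> borel_measurable lebesgue"
    by (intro borel_measurable_inner cgrad_measurable[OF c ae]) simp
  have m2: "diff_quotient f i n \<in> borel_measurable lebesgue" for n
    by (intro continuous_borel_measurable_lebesgue diff_quotient_continuous c)
  have m3: "integrable lebesgue ?w"
  proof (intro integrable_mult_left integrable_real_indicator)
    have "cball (0::'a) (R + 1) \<in> lmeasurable" by simp
    then show "emeasure lebesgue (cball (0::'a) (R + 1)) < \<infinity>" by (rule fmeasurableD2[THEN top.not_eq_extremum[THEN iffD1], folded infinity_ennreal_def])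
  qed simp
  have lim: "AE x in lebesgue. (\<lambda>n. diff_quotient f i n x) \<longlonglongrightarrow> cgrad f x \<bullet> i"
    using ae by eventually_elim (rule diff_quotient_tendsto)
  have b: "AE x in lebesgue. norm (diff_quotient f i n x) \<le> ?w x" for n
  proof (rule AE_I2)
    fix x :: 'a
    show "norm (diff_quotient f i n x) \<le> ?w x"
    proof (cases "norm x \<le> R + 1")
      case True
      then show ?thesis using diff_quotient_bound[OF f i, of n x] by simp
    next
      case False
      let ?c = "(1 / real (Suc n)) *\<^sub>R i"
      have "norm ?c \<le> 1" using i by (simp add: divide_le_eq)
      then have "norm (x + ?c) > R"
        using False norm_triangle_ineq2[of x "- ?c"] by (simp only: norm_minus_cancel diff_minus_eq_add)
      then show ?thesis using False supp by (simp add: diff_quotient_def del: of_nat_Suc)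
    qed
  qed
  show "integrable lebesgue (\<lambda>x. cgrad f x \<bullet> i)"
    by (rule integrable_dominated_convergence[OF m1 m2 m3 lim b])
  have "(\<lambda>n. LINT x|lebesgue. diff_quotient f i n x) \<longlonglongrightarrow> (LINT x|lebesgue. cgrad f x \<bullet> i)"
    by (rule integral_dominated_convergence[OF m1 m2 m3 lim b])
  moreover have "(LINT x|lebesgue. diff_quotient f i n x) = 0" for n
    using integral_diff_quotient[OF c supp] borel_measurable_continuous_onI[OF diff_quotient_continuous[OF c]]
    by (subst integral_completion) auto
  ultimately show "(LINT x|lebesgue. cgrad f x \<bullet> i) = 0" by (simp add: LIMSEQ_const_iff)
qed

text \<open>Inner regularity: the set where g is positive contains a closed T that misses only
  measure e of it. As a closed subset of C, T is compact, so the positive g has integral 0 over T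
  and T is null; hence the set itself has measure at most e.\<close>

lemma nonpos_AE_if_compact_integrals_0:
  fixes g :: "'a::euclidean_space \<Rightarrow> real"
  assumes C: "compact C" and g: "set_integrable lebesgue C g"
    and 0: "\<And>K. compact K \<Longrightarrow> K \<subseteq> C \<Longrightarrow> (LINT x:K|lebesgue. g x) = 0"
  shows "AE x in lebesgue. x \<in> C \<longrightarrow> g x \<le> 0"
proof -
  define P where "P = {x \<in> C. g x > 0}"
  have m: "(\<lambda>x. indicator C x *\<^sub>R g x) \<in> borel_measurable lebesgue"
    using g unfolding set_integrable_def by (rule borel_measurable_integrable)
  have "{x \<in> space lebesgue. indicator C x *\<^sub>R g x > 0} \<in> sets lebesgue"
    by (rule borel_measurable_less[OF _ m]) simp
  moreover have "{x \<in> space lebesgue. indicator C x *\<^sub>R g x > 0} = P"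
    unfolding P_def by (intro Collect_cong) (simp add: indicator_def)
  ultimately have P: "P \<in> sets lebesgue" by simp
  have small: "emeasure lebesgue P \<le> ennreal e" if e: "e > 0" for e :: real
  proof -
    obtain T where T: "closed T" "T \<subseteq> P" "P - T \<in> lmeasurable" "emeasure lebesgue (P - T) < ennreal e"
      using sets_lebesgue_inner_closed[OF P e] by blast
    have TC: "T \<subseteq> C" using T(2) unfolding P_def by blast
    have Tc: "compact T"
      using compact_Int_closed[OF C T(1)] TC by (simp add: Int_absorb1)
    have Ts: "T \<in> sets lebesgue" using T(1) by simp
    have Ti: "integrable lebesgue (\<lambda>x. indicator T x *\<^sub>R g x)"
      using set_integrable_subset[OF g Ts TC] by (simp add: set_integrable_def)
    have Tp: "g x > 0" if "x \<in> T" for x using that T(2) unfolding P_def by blast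
    have nn: "AE x in lebesgue. 0 \<le> indicator T x *\<^sub>R g x"
      by (rule AE_I2) (use Tp in \<open>auto simp: indicator_def less_imp_le\<close>)
    have "AE x in lebesgue. indicator T x *\<^sub>R g x = 0"
      using integral_nonneg_eq_0_iff_AE[OF Ti nn] 0[OF Tc TC, unfolded set_lebesgue_integral_def] by (rule iffD1)
    then have "AE x in lebesgue. x \<notin> T"
    proof (rule eventually_mono)
      fix x assume "indicator T x *\<^sub>R g x = 0"
      then show "x \<notin> T" using Tp[of x] by auto
    qed
    then have "T \<in> null_sets lebesgue" using AE_iff_null_sets[OF Ts] by blast
    then have "emeasure lebesgue T = 0" by (rule null_setsD1)
    moreover have "emeasure lebesgue T + emeasure lebesgue (P - T) = emeasure lebesgue (T \<union> (P - T))"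
      by (rule plus_emeasure[OF Ts sets.Diff[OF P Ts]]) blast
    moreover have "T \<union> (P - T) = P" using T(2) by blast
    ultimately show ?thesis using T(4) by simp
  qed
  have "emeasure lebesgue P \<le> 0"
  proof (rule ennreal_le_epsilon)
    show "emeasure lebesgue P \<le> 0 + ennreal e" if "e > 0" for e using small[OF that] by simp
  qed
  then have "P \<in> null_sets lebesgue" using P by (simp add: null_setsI)
  from AE_not_in[OF this] show ?thesis
    by (rule eventually_mono) (simp add: P_def not_less)
qed

text \<open>The one-sided statement is applied to g and to -g on a countable exhaustion of \<Omega>
  by compact sets.\<close>

lemma AE_0_if_compact_integrals_0:
  fixes g :: "'a::euclidean_space \<Rightarrow> real"
  assumes \<Omega>: "open \<Omega>" and g: "\<And>K. compact K \<Longrightarrow> K \<subseteq> \<Omega> \<Longrightarrow> set_integrable lebesgue K g"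
    and 0: "\<And>K. compact K \<Longrightarrow> K \<subseteq> \<Omega> \<Longrightarrow> (LINT x:K|lebesgue. g x) = 0"
  shows "AE x in lebesgue. x \<in> \<Omega> \<longrightarrow> g x = 0"
proof -
  obtain C :: "nat \<Rightarrow> 'a set" where C: "\<And>n. compact (C n)" "\<And>n. C n \<subseteq> \<Omega>" "\<Union>(range C) = \<Omega>"
  proof (rule open_Union_compact_subsets[OF \<Omega>])
    fix C :: "nat \<Rightarrow> 'a set"
    assume "\<And>n. compact (C n)" "\<And>n. C n \<subseteq> \<Omega>" "\<Union>(range C) = \<Omega>"
    then show thesis by (rule that)
  qed
  have "AE x in lebesgue. x \<in> C n \<longrightarrow> g x = 0" for n :: nat
  proof -
    have "AE x in lebesgue. x \<in> C n \<longrightarrow> g x \<le> 0"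
    proof (rule nonpos_AE_if_compact_integrals_0[OF C(1) g[OF C(1,2)]])
      show "(LINT x:K|lebesgue. g x) = 0" if "compact K" "K \<subseteq> C n" for K
        using 0[of K] that C(2)[of n] by simp
    qed
    moreover have "AE x in lebesgue. x \<in> C n \<longrightarrow> - g x \<le> 0"
    proof (rule nonpos_AE_if_compact_integrals_0[OF C(1)])
      show "set_integrable lebesgue (C n) (\<lambda>x. - g x)"
        using g[OF C(1,2)] by (simp add: set_integrable_def)
      show "(LINT x:K|lebesgue. - g x) = 0" if "compact K" "K \<subseteq> C n" for K
        using 0[of K] that C(2)[of n] by (simp add: set_lebesgue_integral_def)
    qed
    ultimately show ?thesis by eventually_elim auto
  qed
  then have "AE x in lebesgue. \<forall>n. x \<in> C n \<longrightarrow> g x = 0"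
    unfolding AE_all_countable by blast
  then show ?thesis by eventually_elim (use C(3) in blast)
qed

section \<open>Smooth cutoffs and the fundamental lemma of the calculus of variations\<close>

lemma integrable_indicator_mult_bounded:
  fixes g c :: "'a::euclidean_space \<Rightarrow> real"
  assumes g: "set_integrable lebesgue K g" and c: "continuous_on UNIV c" "\<And>x. \<bar>c x\<bar> \<le> M"
  shows "integrable lebesgue (\<lambda>x. indicator K x * (g x * c x))"
proof (rule Bochner_Integration.integrable_bound)
  have i: "integrable lebesgue (\<lambda>x. indicator K x * g x)" using g by (simp add: set_integrable_def)
  then show "integrable lebesgue (\<lambda>x. M * (indicator K x * g x))" by simp
  have "(\<lambda>x. (indicator K x * g x) * c x) \<in> borel_measurable lebesgue"
    by (rule borel_measurable_times[OF borel_measurable_integrable[OF i] continuous_borel_measurable_lebesgue[OF c(1)]])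
  then show "(\<lambda>x. indicator K x * (g x * c x)) \<in> borel_measurable lebesgue" by (simp add: mult.assoc)
  show "AE x in lebesgue. norm (indicator K x * (g x * c x)) \<le> norm (M * (indicator K x * g x))"
  proof (rule AE_I2)
    fix x
    have "\<bar>c x\<bar> \<le> \<bar>M\<bar>" using c(2)[of x] by simp
    then show "norm (indicator K x * (g x * c x)) \<le> norm (M * (indicator K x * g x))"
      using mult_left_mono[of "\<bar>c x\<bar>" "\<bar>M\<bar>" "indicator K x * \<bar>g x\<bar>"] by (simp add: abs_mult mult_ac)
  qed
qed

text \<open>Steepening ramps in the distance to K decrease to the indicator of K; smoothing turns
  them into test functions. The common compact set K' and the uniform bound prepare dominated
  convergence.\<close>

lemma cutoff_approximation:
  fixes K \<Omega> :: "'a::euclidean_space set"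
  assumes \<Omega>: "open \<Omega>" and K: "compact K" "K \<subseteq> \<Omega>"
  obtains \<psi> :: "nat \<Rightarrow> 'a \<Rightarrow> real" and K' where "compact K'" "K' \<subseteq> \<Omega>" "K \<subseteq> K'"
    "\<And>n. test_fun \<Omega> (\<psi> n)" "\<And>n x. x \<notin> K' \<Longrightarrow> \<psi> n x = 0" "\<And>n x. \<bar>\<psi> n x\<bar> \<le> 2"
    "\<And>x. (\<lambda>n. \<psi> n x) \<longlonglongrightarrow> indicator K x"
\<comment> \<open>The distance to the empty set is 0 by convention, so the ramps would not vanish
  anywhere.\<close>
proof (cases "K = {}")
  case True
  have "cinf (\<lambda>x :: 'a. 0)" by (simp add: cinf_iff_ck ck_const)
  then have "test_fun \<Omega> (\<lambda>x. 0)" by (simp add: test_fun_def)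
  then show ?thesis using True by (intro that[of "{}" "\<lambda>n x. 0"]) auto
next
  case False
  obtain r where r: "r > 0" "(\<Union>x\<in>K. cball x r) \<subseteq> \<Omega>"
    using compact_subset_open_imp_cball_epsilon_subset[OF K(1) \<Omega> K(2)] by blast
  \<comment> \<open>Half of the available room is for the ramp and half for the smoothing.\<close>
  define e where "e = r / 2"
  have e: "e > 0" using r by (simp add: e_def)
  define S where "S = {x. infdist x K \<le> e}"
  have S: "compact S" unfolding S_def by (rule compact_infdist_le[OF False K(1) e])
  define K' where "K' = {x. infdist x K \<le> r}"
  have K': "compact K'" unfolding K'_def by (rule compact_infdist_le[OF False K(1) r(1)])
  have K'\<Omega>: "K' \<subseteq> \<Omega>"
  proof
    fix x assume "x \<in> K'"
    moreover obtain a where "a \<in> K" "infdist x K = dist x a"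
      using infdist_attains_inf[OF compact_imp_closed[OF K(1)] False] by metis
    ultimately have "x \<in> (\<Union>x\<in>K. cball x r)" by (auto simp: K'_def dist_commute)
    then show "x \<in> \<Omega>" using r(2) by blast
  qed
  define c where "c = (\<lambda>n x. max 0 (1 - real (Suc n) / e * infdist x K))"
  have lip: "(real (Suc n) / e)-lipschitz_on UNIV (c n)" for n
  proof (rule lipschitz_onI)
    fix x y
    have "\<bar>max 0 (1 - a) - max 0 (1 - b)\<bar> \<le> \<bar>a - b\<bar>" for a b :: real by linarith
    then have "\<bar>c n x - c n y\<bar> \<le> \<bar>real (Suc n) / e * infdist x K - real (Suc n) / e * infdist y K\<bar>"
      unfolding c_def by blast
    also have "\<dots> = real (Suc n) / e * \<bar>infdist x K - infdist y K\<bar>"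
      using e by (subst right_diff_distrib[symmetric]) (simp add: abs_mult del: of_nat_Suc)
    also have "\<dots> \<le> real (Suc n) / e * dist x y"
      using e infdist_triangle_abs[of x K y] by (intro mult_left_mono) auto
    finally show "dist (c n x) (c n y) \<le> real (Suc n) / e * dist x y" by (simp add: dist_real_def)
  qed (use e in simp)
  have c0: "c n x = 0" if "x \<notin> S" for n x
  proof -
    have "1 \<le> infdist x K / e" using that e by (simp add: S_def)
    then have "1 * 1 \<le> real (Suc n) * (infdist x K / e)" by (intro mult_mono) auto
    then show ?thesis by (simp add: c_def)
  qed
  \<comment> \<open>The ramp has Lipschitz constant (n+1)/e, so this quadratic scale keeps the
    smoothing error below 1/(n+1).\<close>
  define d where "d = (\<lambda>n. e / (real (Suc n))\<^sup>2)"
  have d: "d n > 0" "d n \<le> e" for n using e by (auto simp: d_def divide_le_eq)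
  have sub: "(\<Union>x\<in>S. cball x (d n)) \<subseteq> K'" for n
  proof
    fix y assume "y \<in> (\<Union>x\<in>S. cball x (d n))"
    then obtain x where "infdist x K \<le> e" "dist x y \<le> d n" by (auto simp: S_def)
    then show "y \<in> K'" using infdist_triangle[of y K x] d(2)[of n] by (simp add: K'_def e_def dist_commute)
  qed
  define \<psi> where "\<psi> = (\<lambda>n. smoothing (d n) (c n))"
  have close: "\<bar>\<psi> n x - c n x\<bar> \<le> 1 / real (Suc n)" for n x
  proof -
    have "real (Suc n) / e * d n = 1 / real (Suc n)"
      using e by (simp add: d_def power2_eq_square del: of_nat_Suc)
    then show ?thesis using smoothing_close[OF d(1) lip, of n n x] by (simp add: \<psi>_def del: of_nat_Suc)
  qed
  show ?thesis
  proof (rule that[of K' \<psi>])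
    show "K \<subseteq> K'" using r by (auto simp: K'_def)
    fix n
    have c: "continuous_on UNIV (c n)" by (rule lipschitz_on_continuous_on[OF lip])
    show "test_fun \<Omega> (\<psi> n)"
      unfolding \<psi>_def by (rule test_fun_smoothing(1)[OF d(1) c S c0 order_trans[OF sub K'\<Omega>]])
    show "\<psi> n x = 0" if "x \<notin> K'" for x
      unfolding \<psi>_def
    proof (rule test_fun_smoothing(2)[OF d(1) c S c0 order_trans[OF sub K'\<Omega>]])
      show "x \<notin> (\<Union>x\<in>S. cball x (d n))" using that sub[of n] by blast
    qed
    show "\<bar>\<psi> n x\<bar> \<le> 2" for x
    proof -
      have "1 / real (Suc n) \<le> 1" by simp
      moreover have "0 \<le> c n x" "c n x \<le> 1" using e by (auto simp: c_def infdist_nonneg)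
      ultimately show ?thesis using close[of n x] by linarith
    qed
  next
    fix x
    have "(\<lambda>n. c n x) \<longlonglongrightarrow> indicator K x"
    proof (cases "x \<in> K")
      case True
      then show ?thesis by (simp add: c_def)
    next
      case False
      then have p: "infdist x K > 0"
        using K \<open>K \<noteq> {}\<close> by (intro infdist_pos_not_in_closed compact_imp_closed) auto
      obtain N where N: "e / infdist x K < real N" using reals_Archimedean2 by blast
      have "c n x = 0" if "n \<ge> N" for n
      proof -
        have "e / infdist x K \<le> real (Suc n)" using N that by linarith
        then have "1 \<le> real (Suc n) / e * infdist x K" using p e by (simp add: field_simps)
        then show ?thesis by (simp add: c_def)
      qed
      then have "\<forall>\<^sub>F n in sequentially. c n x = 0" by (auto simp: eventually_sequentially)
      then show ?thesis using False by (simp add: tendsto_eventually)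
    qed
    moreover have "(\<lambda>n. \<psi> n x - c n x) \<longlonglongrightarrow> 0"
      by (rule Lim_null_comparison[OF always_eventually LIMSEQ_inverse_real_of_nat])
         (use close in \<open>simp add: inverse_eq_divide\<close>)
    ultimately have "(\<lambda>n. c n x + (\<psi> n x - c n x)) \<longlonglongrightarrow> indicator K x + 0" by (rule tendsto_add)
    then show "(\<lambda>n. \<psi> n x) \<longlonglongrightarrow> indicator K x" by simp
  qed (use K' K'\<Omega> in auto)
qed

text \<open>The cutoffs reduce the claim to indicators of compact sets: they are bounded by 2 and
  supported in one compact K' on which g is integrable, so dominated convergence applies.\<close>

lemma AE_0_if_test_integrals_0:
  fixes g :: "'a::euclidean_space \<Rightarrow> real"
  assumes \<Omega>: "open \<Omega>" and g: "\<And>K. compact K \<Longrightarrow> K \<subseteq> \<Omega> \<Longrightarrow> set_integrable lebesgue K g"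
    and 0: "\<And>\<phi>. test_fun \<Omega> \<phi> \<Longrightarrow> (LINT x:\<Omega>|lebesgue. g x * \<phi> x) = 0"
  shows "AE x in lebesgue. x \<in> \<Omega> \<longrightarrow> g x = 0"
proof (rule AE_0_if_compact_integrals_0[OF \<Omega> g])
  fix K assume K: "compact K" "K \<subseteq> \<Omega>"
  obtain \<psi> :: "nat \<Rightarrow> 'a \<Rightarrow> real" and K' where \<psi>: "compact K'" "K' \<subseteq> \<Omega>" "K \<subseteq> K'"
    "\<And>n. test_fun \<Omega> (\<psi> n)" "\<And>n x. x \<notin> K' \<Longrightarrow> \<psi> n x = 0" "\<And>n x. \<bar>\<psi> n x\<bar> \<le> 2"
    "\<And>x. (\<lambda>n. \<psi> n x) \<longlonglongrightarrow> indicator K x"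
    using cutoff_approximation[OF \<Omega> K] by metis
  have gK: "integrable lebesgue (\<lambda>x. indicator K' x * g x)"
    using g[OF \<psi>(1,2)] by (simp add: set_integrable_def)
  have gK2: "integrable lebesgue (\<lambda>x. indicator K x * g x)"
    using g[OF K] by (simp add: set_integrable_def)
  have "(\<lambda>n. LINT x|lebesgue. indicator K' x * (g x * \<psi> n x)) \<longlonglongrightarrow> (LINT x|lebesgue. indicator K x * g x)"
  proof (rule integral_dominated_convergence[where w = "\<lambda>x. 2 * \<bar>indicator K' x * g x\<bar>"])
    show "(\<lambda>x. indicator K' x * (g x * \<psi> n x)) \<in> borel_measurable lebesgue" for n
      using \<psi>(4)[of n] \<psi>(6)[of n]
      by (intro borel_measurable_integrable integrable_indicator_mult_bounded[OF g[OF \<psi>(1,2)]] cinf_continuous)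
         (auto simp: test_fun_def)
    show "AE x in lebesgue. (\<lambda>n. indicator K' x * (g x * \<psi> n x)) \<longlonglongrightarrow> indicator K x * g x"
    proof (rule AE_I2)
      fix x
      have "(\<lambda>n. indicator K' x * (g x * \<psi> n x)) \<longlonglongrightarrow> indicator K' x * (g x * indicator K x)"
        by (intro tendsto_intros \<psi>(7))
      then show "(\<lambda>n. indicator K' x * (g x * \<psi> n x)) \<longlonglongrightarrow> indicator K x * g x"
        using \<psi>(3) by (auto simp: indicator_def split: if_splits)
    qed
    show "AE x in lebesgue. norm (indicator K' x * (g x * \<psi> n x)) \<le> 2 * \<bar>indicator K' x * g x\<bar>" for n
    proof (rule AE_I2)
      fix x
      show "norm (indicator K' x * (g x * \<psi> n x)) \<le> 2 * \<bar>indicator K' x * g x\<bar>"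
        using mult_right_mono[OF \<psi>(6)[of n x], of "indicator K' x * \<bar>g x\<bar>"] by (simp add: abs_mult mult_ac)
    qed
  qed (use gK gK2 in auto)
  moreover have "(LINT x|lebesgue. indicator K' x * (g x * \<psi> n x)) = 0" for n
  proof -
    have "(LINT x|lebesgue. indicator K' x * (g x * \<psi> n x)) = (LINT x:\<Omega>|lebesgue. g x * \<psi> n x)"
      unfolding set_lebesgue_integral_def
      using \<psi>(2,5) by (intro Bochner_Integration.integral_cong) (auto simp: indicator_def)
    then show ?thesis using 0[OF \<psi>(4)] by simp
  qed
  ultimately show "(LINT x:K|lebesgue. g x) = 0"
    by (simp add: LIMSEQ_const_iff set_lebesgue_integral_def)
qed

subsection \<open>Weak gradients of Lipschitz functions\<close>

lemma test_fun_support: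
  assumes "test_fun \<Omega> \<phi>"
  obtains K where "compact K" "K \<subseteq> \<Omega>" "\<And>x. x \<notin> K \<Longrightarrow> \<phi> x = 0" "\<And>x. x \<notin> K \<Longrightarrow> cgrad \<phi> x = 0"
proof (rule that[of "closure {x. \<phi> x \<noteq> 0}"])
  let ?K = "closure {x. \<phi> x \<noteq> 0}"
  show "compact ?K" "?K \<subseteq> \<Omega>" using assms by (auto simp: test_fun_def)
  show 0: "\<phi> x = 0" if "x \<notin> ?K" for x using that closure_subset[of "{x. \<phi> x \<noteq> 0}"] by blast
  show "cgrad \<phi> x = 0" if "x \<notin> ?K" for x
  proof (rule cgrad_unique)
    have "((\<lambda>y. 0) has_derivative (\<lambda>h. 0 \<bullet> h)) (at x)" by simp
    moreover have "open (- ?K)" "x \<in> - ?K" using that by auto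
    moreover have "0 = \<phi> y" if "y \<in> - ?K" for y using 0[of y] that by simp
    ultimately show "(\<phi> has_derivative (\<lambda>h. 0 \<bullet> h)) (at x)"
      by (rule has_derivative_transform_within_open)
  qed
qed

lemma continuous_compact_support_bounded:
  fixes f :: "'a::euclidean_space \<Rightarrow> 'b::real_normed_vector"
  assumes "continuous_on UNIV f" "compact K" "\<And>x. x \<notin> K \<Longrightarrow> f x = 0"
  obtains M where "M \<ge> 0" "\<And>x. norm (f x) \<le> M"
proof -
  have "bounded (f ` K)"
    using assms by (intro compact_imp_bounded compact_continuous_image) (auto intro: continuous_on_subset)
  then obtain M where M: "\<And>x. x \<in> K \<Longrightarrow> norm (f x) \<le> M" by (auto simp: bounded_iff)
  show ?thesis
  proof (rule that[of "max 0 M"])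
    fix x show "norm (f x) \<le> max 0 M"
      using M[of x] assms(3)[of x] by (cases "x \<in> K") (auto simp: le_max_iff_disj)
  qed simp
qed

lemma test_fun_lipschitz:
  fixes \<phi> :: "'a::euclidean_space \<Rightarrow> real"
  assumes \<phi>: "test_fun \<Omega> \<phi>"
  obtains L M where "L-lipschitz_on UNIV \<phi>" "\<And>x. \<bar>\<phi> x\<bar> \<le> M"
proof -
  have ci: "cinf \<phi>" using \<phi> by (simp add: test_fun_def)
  obtain K where K: "compact K" "K \<subseteq> \<Omega>" "\<And>x. x \<notin> K \<Longrightarrow> \<phi> x = 0" "\<And>x. x \<notin> K \<Longrightarrow> cgrad \<phi> x = 0"
    using test_fun_support[OF \<phi>] by blast
  obtain M where M: "\<And>x. norm (\<phi> x) \<le> M"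
    using continuous_compact_support_bounded[OF cinf_continuous[OF ci] K(1,3)] by blast
  obtain L where L: "L \<ge> 0" "\<And>x. norm (cgrad \<phi> x) \<le> L"
    using continuous_compact_support_bounded[OF cinf_cgrad_continuous[OF ci] K(1,4)] by blast
  have "L-lipschitz_on UNIV \<phi>"
  proof (rule bounded_derivative_imp_lipschitz)
    show "(\<phi> has_derivative (\<lambda>h. cgrad \<phi> x \<bullet> h)) (at x within UNIV)" for x
      by (simp add: has_derivative_cgrad cinf_differentiable[OF ci])
    show "onorm (\<lambda>h. cgrad \<phi> x \<bullet> h) \<le> L" for x
    proof (rule onorm_bound[OF L(1)])
      fix h
      have "norm (cgrad \<phi> x \<bullet> h) \<le> norm (cgrad \<phi> x) * norm h" by (simp add: Cauchy_Schwarz_ineq2)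
      also have "\<dots> \<le> L * norm h" using L(2) by (intro mult_right_mono) auto
      finally show "norm (cgrad \<phi> x \<bullet> h) \<le> L * norm h" .
    qed
  qed (use L in auto)
  then show ?thesis by (rule that) (use M in simp)
qed

lemma integrable_mult_test_fun:
  fixes g \<phi> :: "'a::euclidean_space \<Rightarrow> real"
  assumes \<phi>: "test_fun \<Omega> \<phi>" and g: "\<And>K. compact K \<Longrightarrow> K \<subseteq> \<Omega> \<Longrightarrow> set_integrable lebesgue K g"
  shows "set_integrable lebesgue \<Omega> (\<lambda>x. g x * \<phi> x)"
proof -
  obtain K where K: "compact K" "K \<subseteq> \<Omega>" "\<And>x. x \<notin> K \<Longrightarrow> \<phi> x = 0" "\<And>x. x \<notin> K \<Longrightarrow> cgrad \<phi> x = 0"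
    using test_fun_support[OF \<phi>] by blast
  obtain L M where "L-lipschitz_on UNIV \<phi>" and M: "\<And>x. \<bar>\<phi> x\<bar> \<le> M" using test_fun_lipschitz[OF \<phi>] by blast
  have c: "continuous_on UNIV \<phi>" using \<phi> by (simp add: test_fun_def cinf_continuous)
  have "integrable lebesgue (\<lambda>x. indicator K x * (g x * \<phi> x))"
    by (rule integrable_indicator_mult_bounded[OF g[OF K(1,2)] c M])
  moreover have "(\<lambda>x. indicator K x * (g x * \<phi> x)) = (\<lambda>x. indicator \<Omega> x *\<^sub>R (g x * \<phi> x))"
    using K(2,3) by (auto simp: indicator_def fun_eq_iff)
  ultimately show ?thesis by (simp add: set_integrable_def)
qed

lemma set_integrable_inner_left:
  assumes "set_integrable M A f"
  shows "set_integrable M A (\<lambda>x. f x \<bullet> i)"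
  using integrable_inner_left[of i M "\<lambda>x. indicator A x *\<^sub>R f x"] assms by (simp add: set_integrable_def)

text \<open>This makes the choice in \<open>wgrad\<close> harmless. Each component of the difference
  of two weak gradients integrates to 0 against every test function.\<close>

lemma weak_grad_unique:
  fixes v :: "'a::euclidean_space \<Rightarrow> real"
  assumes \<Omega>: "open \<Omega>" and g: "has_weak_grad \<Omega> v g" and g': "has_weak_grad \<Omega> v g'"
  shows "AE x in lebesgue. x \<in> \<Omega> \<longrightarrow> g x = g' x"
proof -
  have gi: "set_integrable lebesgue K (\<lambda>x. g x \<bullet> i)" "set_integrable lebesgue K (\<lambda>x. g' x \<bullet> i)"
    if "compact K" "K \<subseteq> \<Omega>" for K i
    using that g g' unfolding has_weak_grad_def by (auto intro!: set_integrable_inner_left)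
  have "AE x in lebesgue. x \<in> \<Omega> \<longrightarrow> g x \<bullet> i - g' x \<bullet> i = 0" if i: "i \<in> Basis" for i
  proof (rule AE_0_if_test_integrals_0[OF \<Omega>])
    show "set_integrable lebesgue K (\<lambda>x. g x \<bullet> i - g' x \<bullet> i)" if "compact K" "K \<subseteq> \<Omega>" for K
      by (rule set_integral_diff(1)[OF gi[OF that]])
    show "(LINT x:\<Omega>|lebesgue. (g x \<bullet> i - g' x \<bullet> i) * \<phi> x) = 0" if \<phi>: "test_fun \<Omega> \<phi>" for \<phi>
    proof -
      have s: "set_integrable lebesgue \<Omega> (\<lambda>x. (g x \<bullet> i) * \<phi> x)" "set_integrable lebesgue \<Omega> (\<lambda>x. (g' x \<bullet> i) * \<phi> x)"
        using integrable_mult_test_fun[OF \<phi> gi(1)] integrable_mult_test_fun[OF \<phi> gi(2)] by blast+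
      have "(LINT x:\<Omega>|lebesgue. v x * frechet_derivative \<phi> (at x) i) = - (LINT x:\<Omega>|lebesgue. (h x \<bullet> i) * \<phi> x)"
        if "has_weak_grad \<Omega> v h" for h
        using that \<phi> i unfolding has_weak_grad_def by blast
      from this[OF g] this[OF g']
      have "(LINT x:\<Omega>|lebesgue. (g x \<bullet> i) * \<phi> x) = (LINT x:\<Omega>|lebesgue. (g' x \<bullet> i) * \<phi> x)" by simp
      then show ?thesis using set_integral_diff(2)[OF s] by (simp add: left_diff_distrib)
    qed
  qed
  then have "AE x in lebesgue. \<forall>i\<in>Basis. x \<in> \<Omega> \<longrightarrow> g x \<bullet> i - g' x \<bullet> i = 0"
    by (intro AE_finite_allI) auto
  then show ?thesis by (rule eventually_mono) (auto intro: euclidean_eqI)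
qed

lemma set_integrable_bounded_measurable:
  fixes g :: "'a::euclidean_space \<Rightarrow> 'b::euclidean_space"
  assumes "g \<in> borel_measurable lebesgue" "AE x in lebesgue. norm (g x) \<le> B" "compact K"
  shows "set_integrable lebesgue K g"
  unfolding set_integrable_def
proof (rule Bochner_Integration.integrable_bound)
  have K: "K \<in> lmeasurable" by (rule lmeasurable_compact[OF assms(3)])
  then show "integrable lebesgue (\<lambda>x. indicator K x * B)"
    by (intro integrable_mult_left) (simp add: lmeasurable_iff_integrable)
  show "(\<lambda>x. indicator K x *\<^sub>R g x) \<in> borel_measurable lebesgue"
    using K assms(1) by (intro borel_measurable_scaleR borel_measurable_indicator) auto
  show "AE x in lebesgue. norm (indicator K x *\<^sub>R g x) \<le> norm (indicator K x * B)"
    using assms(2) by eventually_elim (auto simp: indicator_def)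
qed

text \<open>Integration by parts: the product F of v with a test function is Lipschitz and, as v
  vanishes off the bounded \<Omega>, has bounded support. Its partial derivatives therefore have
  integral 0 over the whole space, and the product rule splits this into the two sides.\<close>

lemma has_weak_grad_lipschitz:
  fixes v :: "'a::euclidean_space \<Rightarrow> real"
  assumes \<Omega>: "bounded \<Omega>" and v: "L-lipschitz_on UNIV v" and v0: "\<And>x. x \<notin> \<Omega> \<Longrightarrow> v x = 0"
    and ae: "AE x in lebesgue. v differentiable at x"
  shows "has_weak_grad \<Omega> v (cgrad v)"
  unfolding has_weak_grad_def
proof (intro conjI allI impI ballI)
  have cv: "continuous_on UNIV v" by (rule lipschitz_on_continuous_on[OF v])
  have mg: "cgrad v \<in> borel_measurable lebesgue" by (rule cgrad_measurable[OF cv ae])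
  have gb: "AE x in lebesgue. norm (cgrad v x) \<le> L"
    using ae by eventually_elim (rule cgrad_norm_le_lipschitz[OF v])
  obtain M where M: "\<And>x. norm (v x) \<le> M"
  proof (rule continuous_compact_support_bounded[OF cv, of "closure \<Omega>"])
    show "compact (closure \<Omega>)" using \<Omega> by simp
    show "v x = 0" if "x \<notin> closure \<Omega>" for x using that v0 closure_subset by blast
  qed blast
  show "set_integrable lebesgue K v" if "compact K \<and> K \<subseteq> \<Omega>" for K
    using that M
    by (intro set_integrable_bounded_measurable[where B = M] continuous_borel_measurable_lebesgue cv) auto
  show "set_integrable lebesgue K (cgrad v)" if "compact K \<and> K \<subseteq> \<Omega>" for K
    using that by (intro set_integrable_bounded_measurable[OF mg gb]) simp
  fix \<phi> i assume \<phi>: "test_fun \<Omega> \<phi>" and i: "i \<in> (Basis :: 'a set)"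
  have ci: "cinf \<phi>" using \<phi> by (simp add: test_fun_def)
  obtain K where K: "compact K" "K \<subseteq> \<Omega>" "\<And>x. x \<notin> K \<Longrightarrow> \<phi> x = 0" "\<And>x. x \<notin> K \<Longrightarrow> cgrad \<phi> x = 0"
    using test_fun_support[OF \<phi>] by blast
  obtain L' M' where L': "L'-lipschitz_on UNIV \<phi>" and M': "\<And>x. \<bar>\<phi> x\<bar> \<le> M'"
    using test_fun_lipschitz[OF \<phi>] by blast
  obtain R where R: "\<And>x. x \<in> \<Omega> \<Longrightarrow> norm x \<le> R" using \<Omega> by (auto simp: bounded_iff)
  define F where "F = (\<lambda>x. v x * \<phi> x)"
  have F: "(M * L' + M' * L)-lipschitz_on UNIV F"
  proof (rule lipschitz_onI)
    have M0: "0 \<le> M" "0 \<le> M'" using M[of 0] M'[of 0] by auto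
    then show "0 \<le> M * L' + M' * L"
      using lipschitz_on_nonneg[OF v] lipschitz_on_nonneg[OF L'] by simp
    fix x y
    have "\<bar>F x - F y\<bar> = \<bar>v x * (\<phi> x - \<phi> y) + \<phi> y * (v x - v y)\<bar>"
      unfolding F_def by (rule arg_cong[of _ _ abs]) (simp add: algebra_simps)
    also have "\<dots> \<le> \<bar>v x\<bar> * \<bar>\<phi> x - \<phi> y\<bar> + \<bar>\<phi> y\<bar> * \<bar>v x - v y\<bar>"
      using abs_triangle_ineq by (simp add: abs_mult[symmetric])
    also have "\<dots> \<le> M * (L' * dist x y) + M' * (L * dist x y)"
      using M[of x] M'[of y] lipschitz_onD[OF v, of x y] lipschitz_onD[OF L', of x y] M0
      by (intro add_mono mult_mono) (auto simp: dist_real_def)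
    finally show "dist (F x) (F y) \<le> (M * L' + M' * L) * dist x y"
      by (simp add: dist_real_def algebra_simps)
  qed
  have F0: "F x = 0" if "norm x > R" for x
    using v0[of x] R[of x] that by (auto simp: F_def)
  have dF: "F differentiable at x \<and> cgrad F x \<bullet> i = v x * (cgrad \<phi> x \<bullet> i) + (cgrad v x \<bullet> i) * \<phi> x"
    if "v differentiable at x" for x
  proof -
    have "(F has_derivative (\<lambda>h. v x * (cgrad \<phi> x \<bullet> h) + (cgrad v x \<bullet> h) * \<phi> x)) (at x)"
      unfolding F_def
      by (intro has_derivative_mult has_derivative_cgrad that cinf_differentiable ci)
    also have "(\<lambda>h. v x * (cgrad \<phi> x \<bullet> h) + (cgrad v x \<bullet> h) * \<phi> x) =
        (\<lambda>h. (v x *\<^sub>R cgrad \<phi> x + \<phi> x *\<^sub>R cgrad v x) \<bullet> h)"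
      by (simp add: fun_eq_iff inner_add_left mult.commute)
    finally have d: "(F has_derivative (\<lambda>h. (v x *\<^sub>R cgrad \<phi> x + \<phi> x *\<^sub>R cgrad v x) \<bullet> h)) (at x)" .
    show ?thesis using differentiableI[OF d] cgrad_unique[OF d] by (simp add: inner_add_left mult.commute)
  qed
  have aeF: "AE x in lebesgue. F differentiable at x" using ae by eventually_elim (use dF in blast)
  note int0 = integral_cgrad_eq_0[OF F F0 aeF i]
  have i1: "set_integrable lebesgue \<Omega> (\<lambda>x. (cgrad v x \<bullet> i) * \<phi> x)"
    by (rule integrable_mult_test_fun[OF \<phi>])
       (intro set_integrable_inner_left set_integrable_bounded_measurable[OF mg gb])
  have c2: "continuous_on UNIV (\<lambda>x. v x * (cgrad \<phi> x \<bullet> i))"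
    by (intro continuous_intros cv cinf_cgrad_continuous ci)
  have "integrable lborel (\<lambda>x. v x * (cgrad \<phi> x \<bullet> i))"
    by (rule integrable_continuous_compact_support[OF c2, of R]) (use v0 R in force)
  then have i2: "integrable lebesgue (\<lambda>x. v x * (cgrad \<phi> x \<bullet> i))"
    using borel_measurable_continuous_onI[OF c2] by (simp add: integrable_completion)
  have e1: "(\<lambda>x. indicator \<Omega> x *\<^sub>R ((cgrad v x \<bullet> i) * \<phi> x)) = (\<lambda>x. (cgrad v x \<bullet> i) * \<phi> x)"
    using K by (auto simp: fun_eq_iff indicator_def)
  have e2: "(\<lambda>x. indicator \<Omega> x *\<^sub>R (v x * (cgrad \<phi> x \<bullet> i))) = (\<lambda>x. v x * (cgrad \<phi> x \<bullet> i))"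
    using v0 by (auto simp: fun_eq_iff indicator_def)
  have i1': "integrable lebesgue (\<lambda>x. (cgrad v x \<bullet> i) * \<phi> x)"
    using i1 unfolding set_integrable_def e1 .
  have "(LINT x|lebesgue. v x * (cgrad \<phi> x \<bullet> i)) + (LINT x|lebesgue. (cgrad v x \<bullet> i) * \<phi> x)
     = (LINT x|lebesgue. v x * (cgrad \<phi> x \<bullet> i) + (cgrad v x \<bullet> i) * \<phi> x)"
    by (rule Bochner_Integration.integral_add[OF i2 i1', symmetric])
  also have "\<dots> = (LINT x|lebesgue. cgrad F x \<bullet> i)"
  proof (rule integral_cong_AE)
    show "(\<lambda>x. v x * (cgrad \<phi> x \<bullet> i) + (cgrad v x \<bullet> i) * \<phi> x) \<in> borel_measurable lebesgue"
      using i1' i2 by (intro borel_measurable_add borel_measurable_integrable)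
    show "(\<lambda>x. cgrad F x \<bullet> i) \<in> borel_measurable lebesgue"
      using int0(1) by (rule borel_measurable_integrable)
    show "AE x in lebesgue. v x * (cgrad \<phi> x \<bullet> i) + (cgrad v x \<bullet> i) * \<phi> x = cgrad F x \<bullet> i"
      using ae by eventually_elim (use dF in simp)
  qed
  also have "\<dots> = 0" by (rule int0(2))
  finally show "(LINT x:\<Omega>|lebesgue. v x * frechet_derivative \<phi> (at x) i)
      = - (LINT x:\<Omega>|lebesgue. (cgrad v x \<bullet> i) * \<phi> x)"
    unfolding set_lebesgue_integral_def frechet_derivative_eq_cgrad[OF i] e1 e2 by simp
qed

text \<open>The shrinkage operator. It vanishes on [-e, e] and is a translation on either side of
  it, so composition with v cuts the support without changing the gradient where |v| > e.\<close>

definition soft_threshold :: "real \<Rightarrow> real \<Rightarrow> real" where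
  "soft_threshold e t = t - max (- e) (min e t)"

lemma soft_threshold_props:
  "\<bar>soft_threshold e s - soft_threshold e t\<bar> \<le> \<bar>s - t\<bar>"
  "e \<ge> 0 \<Longrightarrow> \<bar>soft_threshold e t - t\<bar> \<le> e"
  "\<bar>t\<bar> \<le> e \<Longrightarrow> soft_threshold e t = 0"
  "e \<ge> 0 \<Longrightarrow> e \<le> t \<Longrightarrow> soft_threshold e t = t - e"
  "e \<ge> 0 \<Longrightarrow> t \<le> - e \<Longrightarrow> soft_threshold e t = t + e"
  unfolding soft_threshold_def by linarith+

text \<open>At almost every zero of a piecewise affine function the gradient vanishes; there the
  soft threshold vanishes in a neighbourhood and so keeps the gradient as well.\<close>

lemma soft_threshold_locally_affine:
  fixes v :: "'a::euclidean_space \<Rightarrow> real"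
  assumes v: "L-lipschitz_on UNIV v" and x: "locally_affine_at v x" "v x \<noteq> 0 \<or> cgrad v x = 0"
  obtains r where "r > 0" "\<And>e. 0 \<le> e \<Longrightarrow> e \<le> r \<Longrightarrow>
    \<exists>c. \<forall>y\<in>ball x r. soft_threshold e (v y) = c + cgrad v x \<bullet> y"
proof -
  obtain r0 a where r0: "r0 > 0" "\<And>y. y \<in> ball x r0 \<Longrightarrow> v y = v x + a \<bullet> (y - x)"
    using x(1) unfolding locally_affine_at_def by blast
  have a: "cgrad v x = a" by (rule cgrad_unique, rule affine_has_derivative[of r0 x v a]) (fact r0)+
  show ?thesis
  proof (cases "v x = 0")
    case True
    then have v0: "v y = 0" if "y \<in> ball x r0" for y using x(2) a r0(2)[OF that] by simp
    show ?thesis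
    proof (rule that[OF r0(1)])
      fix e :: real assume "0 \<le> e"
      then show "\<exists>c. \<forall>y\<in>ball x r0. soft_threshold e (v y) = c + cgrad v x \<bullet> y"
        using True x(2) by (intro exI[of _ 0]) (auto simp: v0 soft_threshold_props(3))
    qed
  next
    case False
    have L: "L \<ge> 0" by (rule lipschitz_on_nonneg[OF v])
    \<comment> \<open>On a ball of this radius v changes by at most |v x|/2, and r itself is at most
      |v x|/2, so every threshold e \<le> r stays below |v y|. Using L + 1 in place of L secures the
      second bound and avoids division by 0.\<close>
    define r where "r = min r0 (\<bar>v x\<bar> / (2 * (L + 1)))"
    have r: "r > 0" "r \<le> r0" using r0(1) False L by (auto simp: r_def)
    have "r \<le> \<bar>v x\<bar> / (2 * (L + 1))" by (simp add: r_def)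
    then have rL: "(L + 1) * r \<le> \<bar>v x\<bar> / 2" using L by (simp add: field_simps)
    moreover have "0 \<le> L * r" using L r(1) by simp
    ultimately have r2: "r \<le> \<bar>v x\<bar> / 2" by (simp add: distrib_right)
    have near: "\<bar>v y - v x\<bar> \<le> \<bar>v x\<bar> / 2" if "y \<in> ball x r" for y
    proof -
      have "\<bar>v y - v x\<bar> \<le> L * dist y x" using lipschitz_onD[OF v, of y x] by (simp add: dist_real_def)
      also have "\<dots> \<le> (L + 1) * r" using that L by (intro mult_mono) (auto simp: dist_commute)
      finally show ?thesis using rL by simp
    qed
    show ?thesis
    proof (rule that[OF r(1)])
      fix e :: real assume e: "0 \<le> e" "e \<le> r"
      have "soft_threshold e (v y) = (v x - a \<bullet> x - sgn (v x) * e) + cgrad v x \<bullet> y" if y: "y \<in> ball x r" for y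
      proof -
        have "v y = v x + a \<bullet> (y - x)" using y r by (intro r0(2)) auto
        moreover have "soft_threshold e (v y) = v y - sgn (v x) * e"
        proof (cases "v x > 0")
          case True
          then have "e \<le> v y" using near[OF y] e r2 by linarith
          then show ?thesis using True soft_threshold_props(4)[OF e(1)] by simp
        next
          case neg: False
          then have "v y \<le> - e" using near[OF y] e r2 False by linarith
          then show ?thesis using neg False soft_threshold_props(5)[OF e(1)] by simp
        qed
        ultimately show ?thesis by (simp add: a inner_diff_right)
      qed
      then show "\<exists>c. \<forall>y\<in>ball x r. soft_threshold e (v y) = c + cgrad v x \<bullet> y" by blast
    qed
  qed
qed

text \<open>Thresholding at level 1/(n+1) confines the support to a compact subset of \<Omega>,
  which leaves room for mollification at a smaller radius d n. Neither operation increases the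
  Lipschitz constant, hence the uniform gradient bound.\<close>

lemma smooth_approximation:
  fixes v :: "'a::euclidean_space \<Rightarrow> real"
  assumes \<Omega>: "open \<Omega>" "bounded \<Omega>" and v: "L-lipschitz_on UNIV v" and v0: "\<And>x. x \<notin> \<Omega> \<Longrightarrow> v x = 0"
    and ae: "AE x in lebesgue. locally_affine_at v x \<and> (v x \<noteq> 0 \<or> cgrad v x = 0)"
  obtains \<psi> :: "nat \<Rightarrow> 'a \<Rightarrow> real" where "\<And>n. test_fun \<Omega> (\<psi> n)"
    "\<And>n x. \<bar>v x - \<psi> n x\<bar> \<le> (L + 1) / real (Suc n)"
    "\<And>n x. norm (cgrad (\<psi> n) x) \<le> L"
    "AE x in lebesgue. \<forall>\<^sub>F n in sequentially. cgrad (\<psi> n) x = cgrad v x"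
proof -
  have cv: "continuous_on UNIV v" by (rule lipschitz_on_continuous_on[OF v])
  have L: "L \<ge> 0" by (rule lipschitz_on_nonneg[OF v])
  define e where "e = (\<lambda>n. 1 / real (Suc n))"
  have e: "e n > 0" for n by (simp add: e_def)
  define w where "w = (\<lambda>n x. soft_threshold (e n) (v x))"
  have w: "L-lipschitz_on UNIV (w n)" for n
  proof (rule lipschitz_onI[OF _ L])
    show "dist (w n x) (w n y) \<le> L * dist x y" for x y
      using soft_threshold_props(1)[of "e n" "v x" "v y"] lipschitz_onD[OF v, of x y]
      by (simp add: w_def dist_real_def)
  qed
  define S where "S = (\<lambda>n. {x. e n \<le> \<bar>v x\<bar>})"
  have S\<Omega>: "S n \<subseteq> \<Omega>" for n using v0 e[of n] by (force simp: S_def)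
  have "closed (S n)" for n
    unfolding S_def by (intro closed_Collect_le continuous_intros cv)
  then have Sc: "compact (S n)" for n
    using bounded_subset[OF \<Omega>(2) S\<Omega>] by (simp add: compact_eq_bounded_closed)
  have w0: "w n x = 0" if "x \<notin> S n" for n x
    using that unfolding w_def S_def by (intro soft_threshold_props(3)) simp
  have "\<exists>d>0. d \<le> e n \<and> (\<Union>x\<in>S n. cball x d) \<subseteq> \<Omega>" for n
  proof -
    obtain d where d: "d > 0" "(\<Union>x\<in>S n. cball x d) \<subseteq> \<Omega>"
      using compact_subset_open_imp_cball_epsilon_subset[OF Sc \<Omega>(1) S\<Omega>] by blast
    have "(\<Union>x\<in>S n. cball x (min d (e n))) \<subseteq> (\<Union>x\<in>S n. cball x d)" by auto
    then show ?thesis using d e[of n] by (intro exI[of _ "min d (e n)"]) auto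
  qed
  then obtain d where d: "\<And>n. d n > 0" "\<And>n. d n \<le> e n" "\<And>n. (\<Union>x\<in>S n. cball x (d n)) \<subseteq> \<Omega>"
    by metis
  define \<psi> where "\<psi> = (\<lambda>n. smoothing (d n) (w n))"
  have cw: "continuous_on UNIV (w n)" for n by (rule lipschitz_on_continuous_on[OF w])
  have t: "test_fun \<Omega> (\<psi> n)" for n
    unfolding \<psi>_def by (rule test_fun_smoothing(1)[OF d(1) cw Sc w0 d(3)])
  show ?thesis
  proof (rule that[of \<psi>, OF t])
    show "\<bar>v x - \<psi> n x\<bar> \<le> (L + 1) / real (Suc n)" for n x
    proof -
      have "\<bar>\<psi> n x - w n x\<bar> \<le> L * d n" unfolding \<psi>_def by (rule smoothing_close[OF d(1) w])
      also have "\<dots> \<le> L * e n" using d(2) L by (intro mult_left_mono) auto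
      finally have "\<bar>v x - \<psi> n x\<bar> \<le> L * e n + e n"
        using soft_threshold_props(2)[of "e n" "v x"] e[of n] unfolding w_def by linarith
      then show ?thesis by (simp add: e_def add_divide_distrib)
    qed
    show "norm (cgrad (\<psi> n) x) \<le> L" for n x
      using cgrad_norm_le_lipschitz[OF smoothing_lipschitz[OF d(1) w]] cinf_differentiable t[of n]
      unfolding \<psi>_def test_fun_def by blast
    show "AE x in lebesgue. \<forall>\<^sub>F n in sequentially. cgrad (\<psi> n) x = cgrad v x"
      using ae
    proof eventually_elim
      case (elim x)
      obtain r where r: "r > 0" "\<And>e. 0 \<le> e \<Longrightarrow> e \<le> r \<Longrightarrow>
          \<exists>c. \<forall>y\<in>ball x r. soft_threshold e (v y) = c + cgrad v x \<bullet> y"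
        using soft_threshold_locally_affine[OF v] elim by blast
      obtain N where N: "2 / r < real N" using reals_Archimedean2 by blast
      have "cgrad (\<psi> n) x = cgrad v x" if "n \<ge> N" for n
      proof -
        have "2 / r \<le> real (Suc n)" using N that by linarith
        \<comment> \<open>This single condition puts the threshold e n below r and, as d n \<le> e
          n, also gives the mollifier the radius 2 d n \<le> r that it needs.\<close>
        then have er: "2 * e n \<le> r" using r by (simp add: e_def field_simps)
        obtain c where "\<And>y. y \<in> ball x r \<Longrightarrow> w n y = c + cgrad v x \<bullet> y"
          using r(2)[of "e n"] e[of n] er unfolding w_def by force
        moreover have "2 * d n \<le> r" using d(2)[of n] er by linarith
        ultimately show ?thesis unfolding \<psi>_def using cgrad_smoothing[OF cw d(1)] by blast
      qed
      then show ?case by (auto simp: eventually_sequentially)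
    qed
  qed
qed

subsection \<open>Finite element functions in the weighted Sobolev space\<close>

lemma N_function_basic:
  assumes S: "structural \<Phi> \<phi>"
  shows "\<Phi> 0 = 0" "\<And>s t. 0 \<le> s \<Longrightarrow> s \<le> t \<Longrightarrow> \<Phi> s \<le> \<Phi> t" "\<And>t. t \<ge> 0 \<Longrightarrow> \<Phi> t \<ge> 0"
    "continuous_on {0..} \<Phi>" "\<And>t. t \<ge> 0 \<Longrightarrow> t / 2 * \<phi> (t / 2) \<le> \<Phi> t"
proof -
  note basic = structural_basic[OF S]
  have i: "\<phi> integrable_on {0..t}" "\<Phi> t = integral {0..t} \<phi>" if "t \<ge> 0" for t
    using S that by (auto simp: structural_def N_function_def)
  show 0: "\<Phi> 0 = 0" using i(2)[of 0] by simp
  show mono: "\<Phi> s \<le> \<Phi> t" if "0 \<le> s" "s \<le> t" for s t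
    unfolding i(2)[OF that(1)] i(2)[OF order_trans[OF that]]
    by (rule integral_subset_le) (use that i basic in auto)
  show "\<Phi> t \<ge> 0" if "t \<ge> 0" for t using mono[of 0 t] that 0 by simp
  show "continuous_on {0..} \<Phi>"
    using S by (intro DERIV_continuous_on[of _ _ \<phi>]) (auto simp: structural_def)
  \<comment> \<open>Only the upper half of the interval is kept, where \<phi> is at least its value
    at t/2.\<close>
  show "t / 2 * \<phi> (t / 2) \<le> \<Phi> t" if t: "t \<ge> 0" for t
  proof -
    have j: "\<phi> integrable_on {t / 2..t}"
      by (rule integrable_subinterval_real[OF i(1)[OF t]]) (use t in auto)
    have "t / 2 * \<phi> (t / 2) = integral {t / 2..t} (\<lambda>x. \<phi> (t / 2))" using t by simp
    also have "\<dots> \<le> integral {t / 2..t} \<phi>"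
      by (rule integral_le) (use t j basic(3) in auto)
    also have "\<dots> \<le> integral {0..t} \<phi>"
      by (rule integral_subset_le) (use t j i basic in auto)
    finally show ?thesis using i(2)[OF t] by simp
  qed
qed

lemma measurable_radial_profile:
  fixes h :: "real \<Rightarrow> real"
  assumes h: "continuous_on {0..} h" and w: "w \<in> borel_measurable M"
  shows "(\<lambda>x. h (norm (w x))) \<in> borel_measurable M"
proof -
  \<comment> \<open>The even reflection extends h continuously to the whole line.\<close>
  have "continuous_on UNIV (\<lambda>t. h \<bar>t\<bar>)"
    by (intro continuous_on_compose2[OF h] continuous_intros) auto
  then have "(\<lambda>t. h \<bar>t\<bar>) \<in> borel_measurable borel" by (rule borel_measurable_continuous_onI)
  from measurable_compose[OF measurable_compose[OF w borel_measurable_norm] this] show ?thesis by simp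
qed

lemma integrable_weighted_bounded:
  assumes S: "structural \<Phi> \<phi>" and \<omega>: "integrable M \<omega>"
    and w: "w \<in> borel_measurable M" "AE x in M. norm (w x) \<le> B" and l: "l > 0"
  shows "integrable M (\<lambda>x. \<omega> x * \<Phi> (norm (w x) / l))"
proof (rule Bochner_Integration.integrable_bound)
  note basic = N_function_basic[OF S]
  show "integrable M (\<lambda>x. \<omega> x * \<Phi> (B / l))" using \<omega> by simp
  have "(\<lambda>x. \<Phi> (norm (w x /\<^sub>R l))) \<in> borel_measurable M"
    by (rule measurable_radial_profile[OF basic(4)]) (use w in measurable)
  then show "(\<lambda>x. \<omega> x * \<Phi> (norm (w x) / l)) \<in> borel_measurable M"
    using borel_measurable_times[OF borel_measurable_integrable[OF \<omega>]] l by (simp add: divide_inverse_commute)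
  show "AE x in M. norm (\<omega> x * \<Phi> (norm (w x) / l)) \<le> norm (\<omega> x * \<Phi> (B / l))"
    using w(2)
  proof eventually_elim
    case (elim x)
    have "\<Phi> (norm (w x) / l) \<le> \<Phi> (B / l)" "0 \<le> \<Phi> (norm (w x) / l)"
      using elim l by (auto intro!: basic(2,3) divide_right_mono)
    then show ?case by (simp add: abs_mult mult_left_mono)
  qed
qed

text \<open>The Luxemburg norm is at most l once the modular at scale l is at most 1. For fixed l
  the modular tends to 0 by dominated convergence, with majorant |\<omega>| \<Phi>(B/l).\<close>

lemma lux_tendsto_0:
  assumes S: "structural \<Phi> \<phi>" and \<omega>: "integrable (lebesgue_on \<Omega>) \<omega>"
    and w: "\<And>n. w n \<in> borel_measurable (lebesgue_on \<Omega>)" "\<And>n. AE x in lebesgue_on \<Omega>. norm (w n x) \<le> B"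
    and lim: "AE x in lebesgue_on \<Omega>. (\<lambda>n. w n x) \<longlonglongrightarrow> 0"
  shows "(\<lambda>n. lux \<Phi> \<omega> \<Omega> (w n)) \<longlonglongrightarrow> 0"
proof (rule LIMSEQ_I)
  fix r :: real assume r: "r > 0"
  note basic = N_function_basic[OF S]
  let ?M = "lebesgue_on \<Omega>"
  define l where "l = r / 2"
  have l: "l > 0" "l < r" using r by (auto simp: l_def)
  have i: "integrable ?M (\<lambda>x. \<omega> x * \<Phi> (norm (w n x) / l))" for n
    by (rule integrable_weighted_bounded[OF S \<omega> w l(1)])
  have "(\<lambda>n. LINT x|?M. \<omega> x * \<Phi> (norm (w n x) / l)) \<longlonglongrightarrow> (LINT x|?M. 0)"
  proof (rule integral_dominated_convergence[where w = "\<lambda>x. norm (\<omega> x * \<Phi> (B / l))"])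
    show "AE x in ?M. norm (\<omega> x * \<Phi> (norm (w n x) / l)) \<le> norm (\<omega> x * \<Phi> (B / l))" for n
      using w(2)[of n]
    proof eventually_elim
      case (elim x)
      have "\<Phi> (norm (w n x) / l) \<le> \<Phi> (B / l)" "0 \<le> \<Phi> (norm (w n x) / l)"
        using elim l by (auto intro!: basic(2,3) divide_right_mono)
      then show ?case by (simp add: abs_mult mult_left_mono)
    qed
    show "AE x in ?M. (\<lambda>n. \<omega> x * \<Phi> (norm (w n x) / l)) \<longlonglongrightarrow> 0"
      using lim
    proof eventually_elim
      case (elim x)
      have "(\<lambda>n. norm (w n x) / l) \<longlonglongrightarrow> 0 / l"
        by (intro tendsto_divide tendsto_norm_zero elim tendsto_const) (use l in simp)
      then have "(\<lambda>n. \<Phi> (norm (w n x) / l)) \<longlonglongrightarrow> \<Phi> 0"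
        using l by (intro continuous_on_tendsto_compose[OF basic(4)]) auto
      from tendsto_mult_left[OF this, of "\<omega> x"] show ?case by (simp add: basic(1))
    qed
  qed (use i \<omega> in auto)
  then have "\<forall>\<^sub>F n in sequentially. (LINT x|?M. \<omega> x * \<Phi> (norm (w n x) / l)) < 1"
    by (rule order_tendstoD) simp
  then obtain N where N: "\<And>n. n \<ge> N \<Longrightarrow> (LINT x|?M. \<omega> x * \<Phi> (norm (w n x) / l)) < 1"
    by (auto simp: eventually_sequentially)
  have "norm (lux \<Phi> \<omega> \<Omega> (w n) - 0) < r" if "n \<ge> N" for n
  proof -
    let ?A = "{l. l > 0 \<and> integrable ?M (\<lambda>x. \<omega> x * \<Phi> (norm (w n x) / l)) \<and>
      (LINT x|?M. \<omega> x * \<Phi> (norm (w n x) / l)) \<le> 1}"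
    \<comment> \<open>Membership of l also shows that the set is nonempty, so that its infimum has 0
      as a lower bound.\<close>
    have A: "l \<in> ?A" using l i N[OF that] by (auto intro: less_imp_le)
    have "Inf ?A \<le> l" by (rule cInf_lower[OF A]) (auto intro!: bdd_belowI[of _ 0])
    moreover have "0 \<le> Inf ?A" by (rule cInf_greatest) (use A in auto)
    ultimately show ?thesis using l by (simp add: lux_def)
  qed
  then show "\<exists>N. \<forall>n\<ge>N. norm (lux \<Phi> \<omega> \<Omega> (w n) - 0) < r" by blast
qed

lemma weight_integrable:
  assumes "weight \<omega>" "open \<Omega>" "bounded \<Omega>"
  shows "integrable (lebesgue_on \<Omega>) \<omega>" "AE x in lebesgue_on \<Omega>. \<omega> x > 0"
proof -
  have s: "\<Omega> \<in> sets lebesgue" using assms by auto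
  have "set_integrable lebesgue (closure \<Omega>) \<omega>" using assms by (simp add: weight_def)
  then have "set_integrable lebesgue \<Omega> \<omega>" by (rule set_integrable_subset[OF _ s closure_subset])
  then show "integrable (lebesgue_on \<Omega>) \<omega>" using s by (simp add: set_integrable_def integrable_restrict_space)
  show "AE x in lebesgue_on \<Omega>. \<omega> x > 0"
    using s assms(1) by (auto simp: AE_restrict_space_iff weight_def elim: eventually_mono)
qed

lemma W0_piecewise_affine:
  fixes v :: "'a::euclidean_space \<Rightarrow> real"
  assumes S: "structural \<Phi> \<phi>" and \<omega>: "weight \<omega>" and \<Omega>: "open \<Omega>" "bounded \<Omega>"
    and v: "L-lipschitz_on UNIV v" and v0: "\<And>x. x \<notin> \<Omega> \<Longrightarrow> v x = 0"
    and ae: "AE x in lebesgue. locally_affine_at v x \<and> (v x \<noteq> 0 \<or> cgrad v x = 0)"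
  shows "has_weak_grad \<Omega> v (cgrad v)" "cgrad v \<in> orlicz \<Phi> \<omega> \<Omega>" "v \<in> W0 \<Phi> \<omega> \<Omega>"
proof -
  let ?M = "lebesgue_on \<Omega>"
  have s: "\<Omega> \<in> sets lebesgue" using \<Omega> by auto
  note \<omega>i = weight_integrable(1)[OF \<omega> \<Omega>]
  have L: "L \<ge> 0" by (rule lipschitz_on_nonneg[OF v])
  have cv: "continuous_on UNIV v" by (rule lipschitz_on_continuous_on[OF v])
  have aed: "AE x in lebesgue. v differentiable at x"
    using ae by eventually_elim (use locally_affine_at_differentiable in blast)
  have gb: "AE x in lebesgue. norm (cgrad v x) \<le> L"
    using aed by eventually_elim (rule cgrad_norm_le_lipschitz[OF v])
  have on: "AE x in ?M. P x" if "AE x in lebesgue. P x" for P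
    using that s by (auto simp: AE_restrict_space_iff elim: eventually_mono)
  have mg: "cgrad v \<in> borel_measurable lebesgue" by (rule cgrad_measurable[OF cv aed])
  have mM: "f \<in> borel_measurable ?M" if "f \<in> borel_measurable lebesgue" for f :: "'a \<Rightarrow> 'a"
    using that by (rule measurable_restrict_space1)
  have mM1: "f \<in> borel_measurable ?M" if "continuous_on UNIV f" for f :: "'a \<Rightarrow> real"
    by (rule measurable_restrict_space1[OF continuous_borel_measurable_lebesgue[OF that]])
  show wg: "has_weak_grad \<Omega> v (cgrad v)" by (rule has_weak_grad_lipschitz[OF \<Omega>(2) v v0 aed])
  obtain R where R: "\<And>x. norm (v x) \<le> R"
  proof (rule continuous_compact_support_bounded[OF cv, of "closure \<Omega>"])
    show "compact (closure \<Omega>)" using \<Omega> by simp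
    show "v x = 0" if "x \<notin> closure \<Omega>" for x using that v0 closure_subset by blast
  qed blast
  show og: "cgrad v \<in> orlicz \<Phi> \<omega> \<Omega>"
    using integrable_weighted_bounded[OF S \<omega>i mM[OF mg] on[OF gb], of 1] mM[OF mg]
    unfolding orlicz_def by (intro CollectI conjI exI[of _ 1]) auto
  have ov: "v \<in> orlicz \<Phi> \<omega> \<Omega>"
    using integrable_weighted_bounded[OF S \<omega>i mM1[OF cv] AE_I2[OF R], of 1] mM1[OF cv]
    unfolding orlicz_def by (intro CollectI conjI exI[of _ 1]) auto
  obtain \<psi> :: "nat \<Rightarrow> 'a \<Rightarrow> real" where \<psi>: "\<And>n. test_fun \<Omega> (\<psi> n)"
    "\<And>n x. \<bar>v x - \<psi> n x\<bar> \<le> (L + 1) / real (Suc n)" "\<And>n x. norm (cgrad (\<psi> n) x) \<le> L"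
    "AE x in lebesgue. \<forall>\<^sub>F n in sequentially. cgrad (\<psi> n) x = cgrad v x"
    using smooth_approximation[OF \<Omega> v v0 ae] by blast
  have c\<psi>: "continuous_on UNIV (\<psi> n)" "continuous_on UNIV (cgrad (\<psi> n))" for n
    using \<psi>(1)[of n] by (auto simp: test_fun_def intro: cinf_continuous cinf_cgrad_continuous)
  have "(\<lambda>n. lux \<Phi> \<omega> \<Omega> (\<lambda>x. v x - \<psi> n x)) \<longlonglongrightarrow> 0"
  proof (rule lux_tendsto_0[OF S \<omega>i, where B = "L + 1"])
    show "(\<lambda>x. v x - \<psi> n x) \<in> borel_measurable ?M" for n
      by (intro mM1 continuous_intros cv c\<psi>)
    show "AE x in ?M. norm (v x - \<psi> n x) \<le> L + 1" for n
    proof (rule AE_I2)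
      fix x
      have "(L + 1) / real (Suc n) \<le> L + 1" using L by (simp add: divide_le_eq mult_le_cancel_left1)
      then show "norm (v x - \<psi> n x) \<le> L + 1" using \<psi>(2)[where n=n and x=x] by simp
    qed
    have "(\<lambda>n. v x - \<psi> n x) \<longlonglongrightarrow> 0" for x
    proof (rule Lim_null_comparison[OF always_eventually])
      show "(\<lambda>n. (L + 1) / real (Suc n)) \<longlonglongrightarrow> 0"
        using tendsto_mult_left[OF LIMSEQ_inverse_real_of_nat, of "L + 1"] by (simp add: divide_inverse)
    qed (use \<psi>(2) in simp)
    then show "AE x in ?M. (\<lambda>n. v x - \<psi> n x) \<longlonglongrightarrow> 0" by simp
  qed
  moreover have "(\<lambda>n. lux \<Phi> \<omega> \<Omega> (\<lambda>x. cgrad v x - cgrad (\<psi> n) x)) \<longlonglongrightarrow> 0"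
  proof (rule lux_tendsto_0[OF S \<omega>i, where B = "L + L"])
    show "(\<lambda>x. cgrad v x - cgrad (\<psi> n) x) \<in> borel_measurable ?M" for n
      by (intro mM borel_measurable_diff mg borel_measurable_lebesgueI borel_measurable_continuous_onI c\<psi>)
    show "AE x in ?M. norm (cgrad v x - cgrad (\<psi> n) x) \<le> L + L" for n
      using on[OF gb]
    proof eventually_elim
      case (elim x)
      then show ?case using \<psi>(3)[where n=n and x=x] norm_triangle_ineq4[of "cgrad v x" "cgrad (\<psi> n) x"] by linarith
    qed
    show "AE x in ?M. (\<lambda>n. cgrad v x - cgrad (\<psi> n) x) \<longlonglongrightarrow> 0"
      using on[OF \<psi>(4)]
    proof eventually_elim
      case (elim x)
      then show ?case by (intro tendsto_eventually) (auto elim: eventually_mono)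
    qed
  qed
  ultimately have "(\<lambda>n. lux \<Phi> \<omega> \<Omega> (\<lambda>x. v x - \<psi> n x) + lux \<Phi> \<omega> \<Omega> (\<lambda>x. cgrad v x - cgrad (\<psi> n) x)) \<longlonglongrightarrow> 0 + 0"
    by (rule tendsto_add)
  then show "v \<in> W0 \<Phi> \<omega> \<Omega>"
    unfolding W0_def using ov wg og \<psi>(1)
    by (intro CollectI conjI exI[of _ "cgrad v"] exI[of _ \<psi>]) auto
qed

text \<open>The cells only cover the closure of \<Omega>, which need not be convex, so the global
  Lipschitz bound is proved along segments. The exceptional null set is chosen so that v is affine
  near every other point, and constant near every other zero.\<close>

lemma Vh_piecewise_affine:
  fixes v :: "'a::euclidean_space \<Rightarrow> real"
  assumes mesh: "conforming_mesh \<Omega> T" and \<Omega>: "open \<Omega>" and v: "v \<in> Vh \<Omega> T"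
  obtains L where "L-lipschitz_on UNIV v"
    "AE x in lebesgue. locally_affine_at v x \<and> (v x \<noteq> 0 \<or> cgrad v x = 0)"
proof -
  have T: "finite T" "\<Union>T = closure \<Omega>" and "\<And>K. K \<in> T \<Longrightarrow> int DIM('a) simplex K"
    using mesh by (auto simp: conforming_mesh_def)
  then have K: "convex K" "closed K" if "K \<in> T" for K
    using simplex_imp_polytope that by (blast intro: polytope_imp_convex polytope_imp_closed)+
  have v0: "v x = 0" if "x \<notin> \<Omega>" for x using v that by (simp add: Vh_def)
  have "\<forall>K\<in>T. \<exists>a b. \<forall>x\<in>K. v x = a \<bullet> x + b" using v by (simp add: Vh_def)
  then obtain a b where ab: "\<And>K x. K \<in> T \<Longrightarrow> x \<in> K \<Longrightarrow> v x = a K \<bullet> x + b K"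
    by metis
  \<comment> \<open>A crude common bound for all slopes. It depends on v and the mesh, but it is
    used only for membership in the Sobolev space and does not enter the final constant.\<close>
  define L where "L = (\<Sum>K\<in>T. norm (a K))"
  have L: "L \<ge> 0" "\<And>K. K \<in> T \<Longrightarrow> norm (a K) \<le> L"
    using T(1) by (auto simp: L_def intro!: sum_nonneg member_le_sum)
  have lip: "L-lipschitz_on UNIV v"
  proof (rule lipschitz_onI[OF _ L(1)])
    fix x y :: 'a
    define p where "p = (\<lambda>t. x + t *\<^sub>R (y - x))"
    have cp: "continuous_on UNIV p" unfolding p_def by (intro continuous_intros)
    define U where "U = (\<lambda>K. p -` K)"
    \<comment> \<open>Finitely many closed sets cover the segment: the preimages of the cells, on
      each of which v is affine, and of the complement of \<Omega>, which the segment may enter and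
      where v is 0.\<close>
    have "(L * dist x y)-lipschitz_on {0..1} (\<lambda>t. v (p t))"
    proof (rule lipschitz_on_closed_Union[where U = U and I = "insert (- \<Omega>) T"])
      fix K assume K': "K \<in> insert (- \<Omega>) T"
      show "closed (U K)"
        unfolding U_def using K' K(2) \<Omega> by (intro continuous_closed_vimage) (auto simp: p_def)
      show "(L * dist x y)-lipschitz_on (U K) (\<lambda>t. v (p t))"
      proof (rule lipschitz_onI)
        fix s t assume st: "s \<in> U K" "t \<in> U K"
        show "dist (v (p s)) (v (p t)) \<le> L * dist x y * dist s t"
        proof (cases "K \<in> T")
          case True
          have "dist (v (p s)) (v (p t)) = \<bar>a K \<bullet> (p s - p t)\<bar>"
            using st ab[OF True] by (simp add: U_def dist_real_def inner_diff_right)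
          also have "p s - p t = (s - t) *\<^sub>R (y - x)" by (simp add: p_def algebra_simps)
          also have "\<bar>a K \<bullet> ((s - t) *\<^sub>R (y - x))\<bar> \<le> norm (a K) * norm ((s - t) *\<^sub>R (y - x))"
            by (rule Cauchy_Schwarz_ineq2)
          also have "\<dots> \<le> L * norm ((s - t) *\<^sub>R (y - x))"
            using L(2)[OF True] by (rule mult_right_mono) simp
          also have "\<dots> = L * dist x y * dist s t"
            by (simp add: dist_norm norm_minus_commute)
          finally show ?thesis .
        next
          case False
          then show ?thesis using K' st v0 L(1) by (auto simp: U_def)
        qed
      qed (use L(1) in simp)
    next
      show "{0..1} \<subseteq> (\<Union>K\<in>insert (- \<Omega>) T. U K)"
      proof
        fix t
        show "t \<in> (\<Union>K\<in>insert (- \<Omega>) T. U K)"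
        proof (cases "p t \<in> \<Omega>")
          case True
          then have "p t \<in> \<Union>T" unfolding T(2) using closure_subset by blast
          then show ?thesis by (auto simp: U_def)
        qed (simp add: U_def)
      qed
    qed (use T(1) L(1) in auto)
    from lipschitz_onD[OF this, of 0 1] show "dist (v x) (v y) \<le> L * dist x y"
      by (simp add: p_def)
  qed
  \<comment> \<open>Besides the cell boundaries, N contains the zero hyperplane of every piece with
    nonzero slope, so a zero of v outside N lies in a cell of slope 0 or outside the closure of
    \<Omega>.\<close>
  define N where "N = (\<Union>K\<in>T. frontier K) \<union> (\<Union>K\<in>{K\<in>T. a K \<noteq> 0}. {x. a K \<bullet> x = - b K})"
  have "negligible N"
    unfolding N_def using T(1) K
    by (intro negligible_Un negligible_Union) (auto intro!: negligible_convex_frontier negligible_hyperplane)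
  then have "N \<in> null_sets lebesgue" by (simp add: negligible_iff_null_sets)
  from AE_not_in[OF this]
  have "AE x in lebesgue. locally_affine_at v x \<and> (v x \<noteq> 0 \<or> cgrad v x = 0)"
  proof (rule eventually_mono)
    fix x assume x: "x \<notin> N"
    have "\<exists>e>0. \<exists>c. (\<forall>y\<in>ball x e. v y = v x + c \<bullet> (y - x)) \<and> (v x \<noteq> 0 \<or> c = 0)"
    proof (cases "x \<in> closure \<Omega>")
      case True
      then obtain K' where K': "K' \<in> T" "x \<in> K'" using T(2) by blast
      then have "x \<in> interior K'" using x K(2)[OF K'(1)] by (auto simp: N_def frontier_def)
      then obtain e where e: "e > 0" "ball x e \<subseteq> K'" by (meson mem_interior)
      have "v y = v x + a K' \<bullet> (y - x)" if "y \<in> ball x e" for y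
        using ab[OF K'(1), of y] ab[OF K'] e(2) that by (simp add: inner_diff_right subset_eq)
      moreover have "v x \<noteq> 0 \<or> a K' = 0"
        using x K' ab[OF K'] by (auto simp: N_def)
      ultimately show ?thesis using e(1) by blast
    next
      case False
      then have "open (- closure \<Omega>)" "x \<in> - closure \<Omega>" by auto
      then obtain e where e: "e > 0" "ball x e \<subseteq> - closure \<Omega>" by (meson openE)
      have "v y = 0" if "y \<notin> closure \<Omega>" for y using v0[of y] that closure_subset[of \<Omega>] by blast
      then have "\<forall>y\<in>ball x e. v y = v x + 0 \<bullet> (y - x)" using e False by auto
      then show ?thesis using e(1) by blast
    qed
    then obtain e c where ec: "e > 0" "\<And>y. y \<in> ball x e \<Longrightarrow> v y = v x + c \<bullet> (y - x)" "v x \<noteq> 0 \<or> c = 0"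
      by blast
    have "cgrad v x = c" by (rule cgrad_unique, rule affine_has_derivative[of e x v c]) (fact ec)+
    then show "locally_affine_at v x \<and> (v x \<noteq> 0 \<or> cgrad v x = 0)"
      using ec unfolding locally_affine_at_def by blast
  qed
  with lip show ?thesis by (rule that)
qed

lemma Vh_diff:
  assumes "u \<in> Vh \<Omega> T" "v \<in> Vh \<Omega> T"
  shows "(\<lambda>x. u x - v x) \<in> Vh \<Omega> T"
  unfolding Vh_def
proof (intro CollectI conjI ballI)
  show "continuous_on UNIV (\<lambda>x. u x - v x)" using assms by (auto simp: Vh_def intro!: continuous_intros)
  fix K assume K: "K \<in> T"
  have "\<exists>a b. \<forall>x\<in>K. w x = a \<bullet> x + b" if "w \<in> Vh \<Omega> T" for w
    using that K by (simp add: Vh_def)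
  from this[OF assms(1)] this[OF assms(2)]
  obtain a b c d where "\<forall>x\<in>K. u x = a \<bullet> x + b" "\<forall>x\<in>K. v x = c \<bullet> x + d"
    by blast
  then show "\<exists>a b. \<forall>x\<in>K. u x - v x = a \<bullet> x + b"
    by (intro exI[of _ "a - c"] exI[of _ "b - d"]) (simp add: inner_diff_left)
qed (use assms in \<open>simp add: Vh_def\<close>)

lemma zero_in_Vh: "(\<lambda>x. 0) \<in> Vh \<Omega> T"
  unfolding Vh_def by (intro CollectI conjI ballI exI[of _ 0]) auto

lemma wgrad_AE:
  assumes "open \<Omega>" "has_weak_grad \<Omega> v g"
  shows "AE x in lebesgue_on \<Omega>. wgrad \<Omega> v x = g x"
proof -
  have "has_weak_grad \<Omega> v (wgrad \<Omega> v)" unfolding wgrad_def using assms(2) by (rule someI[of "has_weak_grad \<Omega> v"])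
  from weak_grad_unique[OF assms(1) this assms(2)] show ?thesis
    using assms(1) by (simp add: AE_restrict_space_iff)
qed

subsection \<open>Quasi-optimality\<close>

text \<open>Orlicz membership provides integrability of \<Phi>(k |P|) only for some k > 0. The
  scaling bound removes this k, since t \<le> l (k t / 2) for l = max 1 (2/k), and \<Phi>(s)
  dominates (s/2) \<phi>(s/2).\<close>

lemma N_function_dominates:
  assumes S: "structural \<Phi> \<phi>" and k: "k > 0"
  obtains C where "C > 0" "\<And>t. t \<ge> 0 \<Longrightarrow> t * \<phi> t \<le> C * \<Phi> (k * t)"
proof -
  obtain q where q: "q > 0" "\<And>l t. l \<ge> 1 \<Longrightarrow> t \<ge> 0 \<Longrightarrow> \<phi> (l * t) \<le> l powr q * \<phi> t"
    using structural_scaling[OF S] by blast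
  define l where "l = max 1 (2 / k)"
  have l: "l \<ge> 1" by (simp add: l_def)
  show ?thesis
  proof (rule that[of "l powr q * (2 / k)"])
    show "0 < l powr q * (2 / k)" using l k by simp
    fix t :: real assume t: "t \<ge> 0"
    have kt: "k * t \<ge> 0" using k t by simp
    have "2 / k * (k * t / 2) \<le> l * (k * t / 2)"
      using kt by (intro mult_right_mono) (auto simp: l_def)
    then have "t \<le> l * (k * t / 2)" using k by simp
    then have "\<phi> t \<le> \<phi> (l * (k * t / 2))" using structural_basic(3)[OF S] t by blast
    also have "\<dots> \<le> l powr q * \<phi> (k * t / 2)" using q(2)[OF l, of "k * t / 2"] kt by simp
    finally have "t * \<phi> t \<le> t * (l powr q * \<phi> (k * t / 2))" using t by (intro mult_left_mono)
    also have "\<dots> = l powr q * (2 / k) * (k * t / 2 * \<phi> (k * t / 2))" using k by simp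
    also have "\<dots> \<le> l powr q * (2 / k) * \<Phi> (k * t)"
      using N_function_basic(5)[OF S kt] k by (intro mult_left_mono) auto
    finally show "t * \<phi> t \<le> l powr q * (2 / k) * \<Phi> (k * t)" .
  qed
qed

text \<open>The density is |V(P)|^2, comparable to \<Phi>(|P|). In this form it bounds both the
  products of A(P) with Q and the squared differences of V directly, with no free scaling
  parameter.\<close>

definition finite_energy :: "(real \<Rightarrow> real) \<Rightarrow> ('a::euclidean_space \<Rightarrow> real) \<Rightarrow> 'a set \<Rightarrow> ('a \<Rightarrow> 'a) \<Rightarrow> bool" where
  "finite_energy \<phi> \<omega> \<Omega> P \<longleftrightarrow> P \<in> borel_measurable (lebesgue_on \<Omega>) \<and>
     integrable (lebesgue_on \<Omega>) (\<lambda>x. \<omega> x * (norm (P x) * \<phi> (norm (P x))))"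

lemma finite_energy_orlicz:
  assumes S: "structural \<Phi> \<phi>" and \<omega>: "integrable (lebesgue_on \<Omega>) \<omega>" and P: "P \<in> orlicz \<Phi> \<omega> \<Omega>"
  shows "finite_energy \<phi> \<omega> \<Omega> P"
  unfolding finite_energy_def
proof
  show m: "P \<in> borel_measurable (lebesgue_on \<Omega>)" using P by (simp add: orlicz_def)
  obtain k where k: "k > 0" "integrable (lebesgue_on \<Omega>) (\<lambda>x. \<omega> x * \<Phi> (k * norm (P x)))"
    using P by (auto simp: orlicz_def)
  obtain C where C: "C > 0" "\<And>t. t \<ge> 0 \<Longrightarrow> t * \<phi> t \<le> C * \<Phi> (k * t)"
    using N_function_dominates[OF S k(1)] by blast
  show "integrable (lebesgue_on \<Omega>) (\<lambda>x. \<omega> x * (norm (P x) * \<phi> (norm (P x))))"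
  proof (rule Bochner_Integration.integrable_bound)
    show "integrable (lebesgue_on \<Omega>) (\<lambda>x. C * (\<omega> x * \<Phi> (k * norm (P x))))" using k(2) by simp
    show "(\<lambda>x. \<omega> x * (norm (P x) * \<phi> (norm (P x)))) \<in> borel_measurable (lebesgue_on \<Omega>)"
      by (rule borel_measurable_times[OF borel_measurable_integrable[OF \<omega>]
            borel_measurable_times[OF measurable_compose[OF m borel_measurable_norm]
            measurable_radial_profile[OF structural_basic(4)[OF S] m]]])
    show "AE x in lebesgue_on \<Omega>. norm (\<omega> x * (norm (P x) * \<phi> (norm (P x)))) \<le> norm (C * (\<omega> x * \<Phi> (k * norm (P x))))"
    proof (rule AE_I2)
      fix x
      have "0 \<le> norm (P x) * \<phi> (norm (P x))" using structural_basic(5)[OF S] by simp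
      then have "\<bar>norm (P x) * \<phi> (norm (P x))\<bar> \<le> \<bar>C * \<Phi> (k * norm (P x))\<bar>"
        using C(2)[of "norm (P x)"] by simp
      then have "\<bar>\<omega> x\<bar> * \<bar>norm (P x) * \<phi> (norm (P x))\<bar> \<le> \<bar>\<omega> x\<bar> * \<bar>C * \<Phi> (k * norm (P x))\<bar>"
        by (rule mult_left_mono) simp
      then show "norm (\<omega> x * (norm (P x) * \<phi> (norm (P x)))) \<le> norm (C * (\<omega> x * \<Phi> (k * norm (P x))))"
        by (simp add: abs_mult mult_ac)
    qed
  qed
qed

lemma borel_measurable_lebesgue_on_AE:
  fixes f :: "'a::euclidean_space \<Rightarrow> 'b::euclidean_space"
  assumes f: "f \<in> borel_measurable (lebesgue_on \<Omega>)" and \<Omega>: "\<Omega> \<in> sets lebesgue"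
    and ae: "AE x in lebesgue_on \<Omega>. f x = g x"
  shows "g \<in> borel_measurable (lebesgue_on \<Omega>)"
proof (rule borel_measurable_if_D, rule borel_measurable_AE)
  show "(\<lambda>x. if x \<in> \<Omega> then f x else 0) \<in> borel_measurable lebesgue"
    by (rule borel_measurable_if_I[OF f \<Omega>])
  have "AE x in lebesgue. x \<in> \<Omega> \<longrightarrow> f x = g x"
    using ae \<Omega> by (simp add: AE_restrict_space_iff)
  then show "AE x in lebesgue. (if x \<in> \<Omega> then f x else 0) = (if x \<in> \<Omega> then g x else 0)"
    by (rule eventually_mono) auto
qed

text \<open>For passing from a gradient known to lie in the Orlicz space to the representative
  \<open>wgrad\<close>, which equals it only almost everywhere; its measurability rests on
  completeness.\<close>

lemma finite_energy_AE:
  assumes S: "structural \<Phi> \<phi>" and \<omega>: "integrable (lebesgue_on \<Omega>) \<omega>" and \<Omega>: "\<Omega> \<in> sets lebesgue"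
    and P: "finite_energy \<phi> \<omega> \<Omega> P" and ae: "AE x in lebesgue_on \<Omega>. Q x = P x"
  shows "finite_energy \<phi> \<omega> \<Omega> Q"
  unfolding finite_energy_def
proof
  have ae': "AE x in lebesgue_on \<Omega>. P x = Q x" using ae by eventually_elim simp
  have mP: "P \<in> borel_measurable (lebesgue_on \<Omega>)" using P by (simp add: finite_energy_def)
  show m: "Q \<in> borel_measurable (lebesgue_on \<Omega>)"
    by (rule borel_measurable_lebesgue_on_AE[OF mP \<Omega> ae'])
  show "integrable (lebesgue_on \<Omega>) (\<lambda>x. \<omega> x * (norm (Q x) * \<phi> (norm (Q x))))"
  proof (rule integrable_cong_AE_imp)
    show "integrable (lebesgue_on \<Omega>) (\<lambda>x. \<omega> x * (norm (P x) * \<phi> (norm (P x))))"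
      using P by (simp add: finite_energy_def)
    show "(\<lambda>x. \<omega> x * (norm (Q x) * \<phi> (norm (Q x)))) \<in> borel_measurable (lebesgue_on \<Omega>)"
      by (rule borel_measurable_times[OF borel_measurable_integrable[OF \<omega>]
            borel_measurable_times[OF measurable_compose[OF m borel_measurable_norm]
            measurable_radial_profile[OF structural_basic(4)[OF S] m]]])
    show "AE x in lebesgue_on \<Omega>. \<omega> x * (norm (P x) * \<phi> (norm (P x))) = \<omega> x * (norm (Q x) * \<phi> (norm (Q x)))"
      using ae by eventually_elim simp
  qed
qed

lemma measurable_Aop_Vop:
  fixes X :: "'b \<Rightarrow> 'a::euclidean_space"
  assumes S: "structural \<Phi> \<phi>" and X: "X \<in> borel_measurable M"
  shows "(\<lambda>x. Aop \<phi> (X x)) \<in> borel_measurable M" "(\<lambda>x. Vop \<phi> (X x)) \<in> borel_measurable M"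
proof -
  have n: "(\<lambda>x. norm (X x)) \<in> borel_measurable M" by (rule measurable_compose[OF X borel_measurable_norm])
  have p: "(\<lambda>x. \<phi> (norm (X x))) \<in> borel_measurable M"
    by (rule measurable_radial_profile[OF structural_basic(4)[OF S] X])
  show "(\<lambda>x. Aop \<phi> (X x)) \<in> borel_measurable M" "(\<lambda>x. Vop \<phi> (X x)) \<in> borel_measurable M"
    unfolding Aop_def Vop_def using X n p by measurable
qed

lemma Vop_norm:
  assumes "structural \<Phi> \<phi>"
  shows "(norm (Vop \<phi> z))\<^sup>2 = norm z * \<phi> (norm z)"
  using structural_basic[OF assms] by (cases "z = 0") (simp_all add: Vop_def)

text \<open>A Young type inequality: by monotonicity \<phi>(|X|) |Y| is at most s \<phi>(s) at the
  larger of the two norms.\<close>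

lemma Aop_inner_bound:
  fixes X Y :: "'a::euclidean_space"
  assumes S: "structural \<Phi> \<phi>"
  shows "\<bar>Aop \<phi> X \<bullet> Y\<bar> \<le> norm X * \<phi> (norm X) + norm Y * \<phi> (norm Y)"
proof -
  note basic = structural_basic[OF S]
  have pos: "0 \<le> norm z * \<phi> (norm z)" for z :: 'a using basic(5) by simp
  have "norm (Aop \<phi> X) = \<phi> (norm X)" unfolding Aop_radial by (rule norm_radial) (use basic in auto)
  then have "\<bar>Aop \<phi> X \<bullet> Y\<bar> \<le> \<phi> (norm X) * norm Y" using Cauchy_Schwarz_ineq2[of "Aop \<phi> X" Y] by simp
  also have "\<dots> \<le> norm X * \<phi> (norm X) + norm Y * \<phi> (norm Y)"
  proof (cases "norm X \<le> norm Y")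
    case True
    then have "\<phi> (norm X) * norm Y \<le> \<phi> (norm Y) * norm Y" using basic(3) by (intro mult_right_mono) auto
    then show ?thesis using pos[of X] by (simp add: mult.commute)
  next
    case False
    then have "\<phi> (norm X) * norm Y \<le> \<phi> (norm X) * norm X" using basic(5) by (intro mult_left_mono) auto
    then show ?thesis using pos[of Y] by (simp add: mult.commute)
  qed
  finally show ?thesis .
qed

lemma integrable_Aop_inner:
  assumes S: "structural \<Phi> \<phi>" and \<omega>: "integrable (lebesgue_on \<Omega>) \<omega>"
    and X: "finite_energy \<phi> \<omega> \<Omega> X" and Y: "finite_energy \<phi> \<omega> \<Omega> Y"
  shows "integrable (lebesgue_on \<Omega>) (\<lambda>x. \<omega> x * (Aop \<phi> (X x) \<bullet> Y x))"
proof (rule Bochner_Integration.integrable_bound)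
  let ?e = "\<lambda>Z x. norm (Z x) * \<phi> (norm (Z x))"
  show "integrable (lebesgue_on \<Omega>) (\<lambda>x. \<omega> x * ?e X x + \<omega> x * ?e Y x)"
    using X Y by (simp add: finite_energy_def)
  have m: "X \<in> borel_measurable (lebesgue_on \<Omega>)" "Y \<in> borel_measurable (lebesgue_on \<Omega>)"
    using X Y by (auto simp: finite_energy_def)
  show "(\<lambda>x. \<omega> x * (Aop \<phi> (X x) \<bullet> Y x)) \<in> borel_measurable (lebesgue_on \<Omega>)"
    by (rule borel_measurable_times[OF borel_measurable_integrable[OF \<omega>]
          borel_measurable_inner[OF measurable_Aop_Vop(1)[OF S m(1)] m(2)]])
  show "AE x in lebesgue_on \<Omega>. norm (\<omega> x * (Aop \<phi> (X x) \<bullet> Y x)) \<le> norm (\<omega> x * ?e X x + \<omega> x * ?e Y x)"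
  proof (rule AE_I2)
    fix x
    have "\<bar>Aop \<phi> (X x) \<bullet> Y x\<bar> \<le> \<bar>?e X x + ?e Y x\<bar>"
      using Aop_inner_bound[OF S, of "X x" "Y x"] by simp
    then have "\<bar>\<omega> x\<bar> * \<bar>Aop \<phi> (X x) \<bullet> Y x\<bar> \<le> \<bar>\<omega> x\<bar> * \<bar>?e X x + ?e Y x\<bar>" by (rule mult_left_mono) simp
    then show "norm (\<omega> x * (Aop \<phi> (X x) \<bullet> Y x)) \<le> norm (\<omega> x * ?e X x + \<omega> x * ?e Y x)"
      by (simp add: abs_mult[symmetric] distrib_left)
  qed
qed

lemma integrable_Vop_diff:
  assumes S: "structural \<Phi> \<phi>" and \<omega>: "integrable (lebesgue_on \<Omega>) \<omega>"
    and X: "finite_energy \<phi> \<omega> \<Omega> X" and Y: "finite_energy \<phi> \<omega> \<Omega> Y"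
  shows "integrable (lebesgue_on \<Omega>) (\<lambda>x. \<omega> x * (norm (Vop \<phi> (X x) - Vop \<phi> (Y x)))\<^sup>2)"
proof (rule Bochner_Integration.integrable_bound)
  let ?e = "\<lambda>Z x. norm (Z x) * \<phi> (norm (Z x))"
  show "integrable (lebesgue_on \<Omega>) (\<lambda>x. 2 * (\<omega> x * ?e X x) + 2 * (\<omega> x * ?e Y x))"
    using X Y by (simp add: finite_energy_def)
  have m: "X \<in> borel_measurable (lebesgue_on \<Omega>)" "Y \<in> borel_measurable (lebesgue_on \<Omega>)"
    using X Y by (auto simp: finite_energy_def)
  show "(\<lambda>x. \<omega> x * (norm (Vop \<phi> (X x) - Vop \<phi> (Y x)))\<^sup>2) \<in> borel_measurable (lebesgue_on \<Omega>)"
    by (rule borel_measurable_times[OF borel_measurable_integrable[OF \<omega>] borel_measurable_power[OF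
          measurable_compose[OF borel_measurable_diff[OF measurable_Aop_Vop(2)[OF S m(1)]
            measurable_Aop_Vop(2)[OF S m(2)]] borel_measurable_norm]]])
  show "AE x in lebesgue_on \<Omega>. norm (\<omega> x * (norm (Vop \<phi> (X x) - Vop \<phi> (Y x)))\<^sup>2)
      \<le> norm (2 * (\<omega> x * ?e X x) + 2 * (\<omega> x * ?e Y x))"
  proof (rule AE_I2)
    fix x
    let ?a = "Vop \<phi> (X x)" and ?b = "Vop \<phi> (Y x)"
    have "(norm (?a - ?b))\<^sup>2 \<le> (norm ?a + norm ?b)\<^sup>2"
      by (intro power_mono norm_triangle_ineq4) simp
    also have "\<dots> \<le> 2 * (norm ?a)\<^sup>2 + 2 * (norm ?b)\<^sup>2"
      using sum_squares_bound[of "norm ?a" "norm ?b"] by (simp add: power2_sum)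
    finally have "(norm (?a - ?b))\<^sup>2 \<le> \<bar>2 * ?e X x + 2 * ?e Y x\<bar>"
      unfolding Vop_norm[OF S] by linarith
    then have "\<bar>\<omega> x\<bar> * (norm (?a - ?b))\<^sup>2 \<le> \<bar>\<omega> x\<bar> * \<bar>2 * ?e X x + 2 * ?e Y x\<bar>" by (rule mult_left_mono) simp
    then have "\<bar>\<omega> x * (norm (?a - ?b))\<^sup>2\<bar> \<le> \<bar>\<omega> x * (2 * ?e X x + 2 * ?e Y x)\<bar>"
      by (simp only: abs_mult abs_power2 abs_norm_cancel)
    then show "norm (\<omega> x * (norm (?a - ?b))\<^sup>2) \<le> norm (2 * (\<omega> x * ?e X x) + 2 * (\<omega> x * ?e Y x))"
      by (simp only: real_norm_def distrib_left mult.left_commute[of "\<omega> x" 2])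
  qed
qed

text \<open>Write P - Q = (P - R) - D; the D term integrates to 0 by \<open>orth\<close>. Then
  \<open>lower\<close> followed by \<open>upper\<close> gives 2 E \<le> E + K F for the squared
  errors E and F, and the finite energies justify the splitting of the integrals. D is a field of
  its own because the weak gradient of a difference equals Q - R only almost everywhere.\<close>

lemma galerkin_quasi_optimal:
  fixes P Q R D :: "'a::euclidean_space \<Rightarrow> 'a"
  assumes S: "structural \<Phi> \<phi>" and \<omega>: "integrable (lebesgue_on \<Omega>) \<omega>" "AE x in lebesgue_on \<Omega>. \<omega> x > 0"
    and K: "K \<ge> 0" and C: "C > 0"
    and lower: "\<And>P Q :: 'a. (norm (Vop \<phi> P - Vop \<phi> Q))\<^sup>2 \<le> C * ((Aop \<phi> P - Aop \<phi> Q) \<bullet> (P - Q))"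
    and upper: "\<And>P Q R :: 'a. 2 * C * ((Aop \<phi> P - Aop \<phi> Q) \<bullet> (P - R)) \<le>
       (norm (Vop \<phi> P - Vop \<phi> Q))\<^sup>2 + K * (norm (Vop \<phi> P - Vop \<phi> R))\<^sup>2"
    and fe: "finite_energy \<phi> \<omega> \<Omega> P" "finite_energy \<phi> \<omega> \<Omega> Q" "finite_energy \<phi> \<omega> \<Omega> R" "finite_energy \<phi> \<omega> \<Omega> D"
    and D: "AE x in lebesgue_on \<Omega>. D x = Q x - R x"
    and orth: "(LINT x|lebesgue_on \<Omega>. \<omega> x * (Aop \<phi> (P x) \<bullet> D x)) = (LINT x|lebesgue_on \<Omega>. \<omega> x * (Aop \<phi> (Q x) \<bullet> D x))"
  shows "L2w \<omega> \<Omega> (\<lambda>x. Vop \<phi> (P x) - Vop \<phi> (Q x)) \<le> sqrt K * L2w \<omega> \<Omega> (\<lambda>x. Vop \<phi> (P x) - Vop \<phi> (R x))"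
proof -
  let ?M = "lebesgue_on \<Omega>"
  let ?E = "LINT x|?M. \<omega> x * (norm (Vop \<phi> (P x) - Vop \<phi> (Q x)))\<^sup>2"
  let ?F = "LINT x|?M. \<omega> x * (norm (Vop \<phi> (P x) - Vop \<phi> (R x)))\<^sup>2"
  note iA = integrable_Aop_inner[OF S \<omega>(1)] and iV = integrable_Vop_diff[OF S \<omega>(1)]
  have i: "integrable ?M (\<lambda>x. \<omega> x * (Aop \<phi> (P x) \<bullet> P x))" "integrable ?M (\<lambda>x. \<omega> x * (Aop \<phi> (P x) \<bullet> R x))"
    "integrable ?M (\<lambda>x. \<omega> x * (Aop \<phi> (Q x) \<bullet> P x))" "integrable ?M (\<lambda>x. \<omega> x * (Aop \<phi> (Q x) \<bullet> R x))"
    "integrable ?M (\<lambda>x. \<omega> x * (Aop \<phi> (P x) \<bullet> D x))" "integrable ?M (\<lambda>x. \<omega> x * (Aop \<phi> (Q x) \<bullet> D x))"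
    by (rule iA; rule fe)+
  have iPR: "integrable ?M (\<lambda>x. \<omega> x * ((Aop \<phi> (P x) - Aop \<phi> (Q x)) \<bullet> (P x - R x)))"
    using Bochner_Integration.integrable_diff[OF Bochner_Integration.integrable_diff[OF i(1) i(2)]
        Bochner_Integration.integrable_diff[OF i(3) i(4)]]
    by (simp add: inner_diff_left inner_diff_right algebra_simps)
  have iD: "integrable ?M (\<lambda>x. \<omega> x * ((Aop \<phi> (P x) - Aop \<phi> (Q x)) \<bullet> D x))"
    using Bochner_Integration.integrable_diff[OF i(5) i(6)] by (simp add: inner_diff_left right_diff_distrib)
  have D0: "(LINT x|?M. \<omega> x * ((Aop \<phi> (P x) - Aop \<phi> (Q x)) \<bullet> D x)) = 0"
    using Bochner_Integration.integral_diff[OF i(5) i(6)] orth by (simp add: inner_diff_left right_diff_distrib)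
  have "?E \<le> (LINT x|?M. C * (\<omega> x * ((Aop \<phi> (P x) - Aop \<phi> (Q x)) \<bullet> (P x - R x))
      - \<omega> x * ((Aop \<phi> (P x) - Aop \<phi> (Q x)) \<bullet> D x)))"
  proof (rule integral_mono_AE)
    show "AE x in ?M. \<omega> x * (norm (Vop \<phi> (P x) - Vop \<phi> (Q x)))\<^sup>2 \<le>
      C * (\<omega> x * ((Aop \<phi> (P x) - Aop \<phi> (Q x)) \<bullet> (P x - R x)) - \<omega> x * ((Aop \<phi> (P x) - Aop \<phi> (Q x)) \<bullet> D x))"
      using D \<omega>(2)
    proof eventually_elim
      case (elim x)
      have e: "P x - R x - D x = P x - Q x" using elim by simp
      have "\<omega> x * (norm (Vop \<phi> (P x) - Vop \<phi> (Q x)))\<^sup>2 \<le> \<omega> x * (C * ((Aop \<phi> (P x) - Aop \<phi> (Q x)) \<bullet> (P x - Q x)))"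
        using lower elim by (intro mult_left_mono) auto
      then show ?case unfolding e[symmetric] inner_diff_right[of _ "P x - R x" "D x"]
        by (simp add: right_diff_distrib mult.left_commute[of C])
    qed
    show "integrable ?M (\<lambda>x. \<omega> x * (norm (Vop \<phi> (P x) - Vop \<phi> (Q x)))\<^sup>2)" by (rule iV[OF fe(1,2)])
  qed (intro integrable_mult_right Bochner_Integration.integrable_diff iPR iD)
  also have "\<dots> = C * (LINT x|?M. \<omega> x * ((Aop \<phi> (P x) - Aop \<phi> (Q x)) \<bullet> (P x - R x)))"
    using D0 Bochner_Integration.integral_diff[OF iPR iD] by simp
  finally have 1: "2 * ?E \<le> 2 * C * (LINT x|?M. \<omega> x * ((Aop \<phi> (P x) - Aop \<phi> (Q x)) \<bullet> (P x - R x)))" by simp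
  have "2 * C * (LINT x|?M. \<omega> x * ((Aop \<phi> (P x) - Aop \<phi> (Q x)) \<bullet> (P x - R x)))
     = (LINT x|?M. 2 * C * (\<omega> x * ((Aop \<phi> (P x) - Aop \<phi> (Q x)) \<bullet> (P x - R x))))" by simp
  also have "\<dots> \<le> (LINT x|?M. \<omega> x * (norm (Vop \<phi> (P x) - Vop \<phi> (Q x)))\<^sup>2
      + K * (\<omega> x * (norm (Vop \<phi> (P x) - Vop \<phi> (R x)))\<^sup>2))"
  proof (rule integral_mono_AE)
    show "AE x in ?M. 2 * C * (\<omega> x * ((Aop \<phi> (P x) - Aop \<phi> (Q x)) \<bullet> (P x - R x))) \<le>
      \<omega> x * (norm (Vop \<phi> (P x) - Vop \<phi> (Q x)))\<^sup>2 + K * (\<omega> x * (norm (Vop \<phi> (P x) - Vop \<phi> (R x)))\<^sup>2)"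
      using \<omega>(2)
    proof eventually_elim
      case (elim x)
      have "\<omega> x * (2 * C * ((Aop \<phi> (P x) - Aop \<phi> (Q x)) \<bullet> (P x - R x))) \<le>
        \<omega> x * ((norm (Vop \<phi> (P x) - Vop \<phi> (Q x)))\<^sup>2 + K * (norm (Vop \<phi> (P x) - Vop \<phi> (R x)))\<^sup>2)"
        using upper elim by (intro mult_left_mono) auto
      then show ?case by (simp only: distrib_left mult.left_commute[of "\<omega> x"] mult.assoc)
    qed
    show "integrable ?M (\<lambda>x. 2 * C * (\<omega> x * ((Aop \<phi> (P x) - Aop \<phi> (Q x)) \<bullet> (P x - R x))))"
      by (intro integrable_mult_right iPR)
    show "integrable ?M (\<lambda>x. \<omega> x * (norm (Vop \<phi> (P x) - Vop \<phi> (Q x)))\<^sup>2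
      + K * (\<omega> x * (norm (Vop \<phi> (P x) - Vop \<phi> (R x)))\<^sup>2))"
      by (intro Bochner_Integration.integrable_add integrable_mult_right iV fe)
  qed
  also have "\<dots> = ?E + K * ?F"
    using Bochner_Integration.integral_add[OF iV[OF fe(1,2)] integrable_mult_right[OF iV[OF fe(1,3)], of K]] by simp
  finally have "?E \<le> K * ?F" using 1 by linarith
  then have "sqrt ?E \<le> sqrt (K * ?F)" by (rule real_sqrt_le_mono)
  then show ?thesis by (simp add: L2w_def real_sqrt_mult)
qed

theorem mainTheorem3:
  fixes \<Omega> :: "'a::euclidean_space set"
    and \<Phi> \<phi> :: "real \<Rightarrow> real"
    and \<omega> f u :: "'a \<Rightarrow> real"
    and \<T> :: "'a set set set"
  assumes dim: "DIM('a) \<ge> 2"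
    and dom: "lipschitz_polytope \<Omega>"
    and Phi: "structural \<Phi> \<phi>"
    and w: "A_Phi \<phi> \<omega>"
    and f: "f \<in> orlicz (conj_N \<phi>) \<omega> \<Omega>"
    and u: "u \<in> W0 \<Phi> \<omega> \<Omega>"
    and ueq: "\<forall>v\<in>W0 \<Phi> \<omega> \<Omega>.
       (LINT x|lebesgue_on \<Omega>. \<omega> x * (Aop \<phi> (wgrad \<Omega> u x) \<bullet> wgrad \<Omega> v x))
         = (LINT x|lebesgue_on \<Omega>. \<omega> x * f x * v x)"
    and fam: "shape_regular_family \<Omega> \<T>"
  shows "\<exists>C. \<forall>T\<in>\<T>. \<forall>uh\<in>Vh \<Omega> T.
     (\<forall>vh\<in>Vh \<Omega> T.
        (LINT x|lebesgue_on \<Omega>. \<omega> x * (Aop \<phi> (wgrad \<Omega> uh x) \<bullet> wgrad \<Omega> vh x))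
          = (LINT x|lebesgue_on \<Omega>. \<omega> x * f x * vh x)) \<longrightarrow>
     L2w \<omega> \<Omega> (\<lambda>x. Vop \<phi> (wgrad \<Omega> u x) - Vop \<phi> (wgrad \<Omega> uh x))
       \<le> C * (INF vh\<in>Vh \<Omega> T. L2w \<omega> \<Omega> (\<lambda>x. Vop \<phi> (wgrad \<Omega> u x) - Vop \<phi> (wgrad \<Omega> vh x)))"
proof -
  have \<Omega>: "open \<Omega>" "bounded \<Omega>" using dom by (auto simp: lipschitz_polytope_def lipschitz_domain_def)
  have s: "\<Omega> \<in> sets lebesgue" using \<Omega> by auto
  have wt: "weight \<omega>" using w by (simp add: A_Phi_def)
  note \<omega> = weight_integrable[OF wt \<Omega>]
  let ?W = "wgrad \<Omega>"
  have fe: "finite_energy \<phi> \<omega> \<Omega> (?W v)" if "has_weak_grad \<Omega> v g" "g \<in> orlicz \<Phi> \<omega> \<Omega>" for v g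
    by (rule finite_energy_AE[OF Phi \<omega>(1) s finite_energy_orlicz[OF Phi \<omega>(1) that(2)] wgrad_AE[OF \<Omega>(1) that(1)]])
  obtain g where "has_weak_grad \<Omega> u g" "g \<in> orlicz \<Phi> \<omega> \<Omega>" using u unfolding W0_def by blast
  then have fu: "finite_energy \<phi> \<omega> \<Omega> (?W u)" by (rule fe)
  obtain C K where CK: "C > 0" "K > 0"
    and lower: "\<And>P Q :: 'a. (norm (Vop \<phi> P - Vop \<phi> Q))\<^sup>2 \<le> C * ((Aop \<phi> P - Aop \<phi> Q) \<bullet> (P - Q))"
    and upper: "\<And>P Q R :: 'a. 2 * C * ((Aop \<phi> P - Aop \<phi> Q) \<bullet> (P - R)) \<le>
       (norm (Vop \<phi> P - Vop \<phi> Q))\<^sup>2 + K * (norm (Vop \<phi> P - Vop \<phi> R))\<^sup>2"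
    using Vop_quasi_optimal_pointwise[OF Phi, where 'a='a] by blast
  show ?thesis
  \<comment> \<open>K was fixed from \<phi> before the mesh and \<open>uh\<close> were introduced,
    so the constant is independent of h.\<close>
  proof (intro exI[of _ "sqrt K"] ballI impI)
    fix T uh
    assume T: "T \<in> \<T>" and uh: "uh \<in> Vh \<Omega> T"
      and uheq: "\<forall>vh\<in>Vh \<Omega> T. (LINT x|lebesgue_on \<Omega>. \<omega> x * (Aop \<phi> (?W uh x) \<bullet> ?W vh x))
          = (LINT x|lebesgue_on \<Omega>. \<omega> x * f x * vh x)"
    let ?e = "\<lambda>v. L2w \<omega> \<Omega> (\<lambda>x. Vop \<phi> (?W u x) - Vop \<phi> (?W v x))"
    have mesh: "conforming_mesh \<Omega> T" using fam T by (simp add: shape_regular_family_def)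
    have Vh: "finite_energy \<phi> \<omega> \<Omega> (?W v)" "v \<in> W0 \<Phi> \<omega> \<Omega>"
      "AE x in lebesgue_on \<Omega>. ?W v x = cgrad v x \<and> v differentiable at x" if v: "v \<in> Vh \<Omega> T" for v
    proof -
      have v0: "v x = 0" if "x \<notin> \<Omega>" for x using v that by (simp add: Vh_def)
      obtain L where L: "L-lipschitz_on UNIV v"
        "AE x in lebesgue. locally_affine_at v x \<and> (v x \<noteq> 0 \<or> cgrad v x = 0)"
        using Vh_piecewise_affine[OF mesh \<Omega>(1) v] by blast
      have pa: "has_weak_grad \<Omega> v (cgrad v)" "cgrad v \<in> orlicz \<Phi> \<omega> \<Omega>" "v \<in> W0 \<Phi> \<omega> \<Omega>"
        using W0_piecewise_affine[OF Phi wt \<Omega> L(1) _ L(2)] v0 by blast+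
      show "finite_energy \<phi> \<omega> \<Omega> (?W v)" by (rule fe[OF pa(1,2)])
      show "v \<in> W0 \<Phi> \<omega> \<Omega>" by (rule pa(3))
      have "AE x in lebesgue. v differentiable at x"
        using L(2) by eventually_elim (use locally_affine_at_differentiable in blast)
      then have "AE x in lebesgue_on \<Omega>. v differentiable at x"
        using s by (auto simp: AE_restrict_space_iff elim: eventually_mono)
      then show "AE x in lebesgue_on \<Omega>. ?W v x = cgrad v x \<and> v differentiable at x"
        using wgrad_AE[OF \<Omega>(1) pa(1)] by eventually_elim simp
    qed
    have best: "?e uh \<le> sqrt K * ?e vh" if vh: "vh \<in> Vh \<Omega> T" for vh
    proof -
      let ?d = "\<lambda>x. uh x - vh x"
      have d: "?d \<in> Vh \<Omega> T" by (rule Vh_diff[OF uh vh])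
      \<comment> \<open>Linearity of \<open>wgrad\<close> on finite element functions is obtained
        through classical gradients, which subtract wherever both functions are
        differentiable.\<close>
      have D: "AE x in lebesgue_on \<Omega>. ?W ?d x = ?W uh x - ?W vh x"
        using Vh(3)[OF d] Vh(3)[OF uh] Vh(3)[OF vh]
      proof eventually_elim
        case (elim x)
        have "(?d has_derivative (\<lambda>h. cgrad uh x \<bullet> h - cgrad vh x \<bullet> h)) (at x)"
          using elim by (intro has_derivative_diff has_derivative_cgrad) auto
        then have "(?d has_derivative (\<lambda>h. (cgrad uh x - cgrad vh x) \<bullet> h)) (at x)"
          by (simp add: inner_diff_left)
        then have "cgrad ?d x = cgrad uh x - cgrad vh x" by (rule cgrad_unique)
        then show ?case using elim by simp
      qed
      show ?thesis
      proof (rule galerkin_quasi_optimal[OF Phi \<omega> _ CK(1) lower upper fu Vh(1)[OF uh] Vh(1)[OF vh] Vh(1)[OF d] D])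
        \<comment> \<open>Galerkin orthogonality: the difference \<open>uh - vh\<close> is
          admissible in both equations, with the same load term.\<close>
        show "(LINT x|lebesgue_on \<Omega>. \<omega> x * (Aop \<phi> (?W u x) \<bullet> ?W ?d x))
            = (LINT x|lebesgue_on \<Omega>. \<omega> x * (Aop \<phi> (?W uh x) \<bullet> ?W ?d x))"
          using bspec[OF ueq Vh(2)[OF d]] bspec[OF uheq d] by (rule trans[OF _ sym])
      qed (use CK in simp)
    qed
    \<comment> \<open>After division by the positive \<open>sqrt K\<close> the left side is a lower
      bound of all approximation errors; the zero function makes the family nonempty, so the bound
      passes to the infimum.\<close>
    have "?e uh / sqrt K \<le> (INF vh\<in>Vh \<Omega> T. ?e vh)"
    proof (rule cINF_greatest)
      show "Vh \<Omega> T \<noteq> {}" using zero_in_Vh by blast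
      show "?e uh / sqrt K \<le> ?e vh" if "vh \<in> Vh \<Omega> T" for vh
        using best[OF that] CK by (simp add: divide_le_eq mult.commute)
    qed
    then show "?e uh \<le> sqrt K * (INF vh\<in>Vh \<Omega> T. ?e vh)"
      using CK by (simp add: divide_le_eq mult.commute)
  qed
qed

end
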